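(* Each bounded Yin set $\mathcal{Y}\subset\mathbb{R}^2$ can be partitioned into a regularized union of a finite number of curved quadrilaterals and curved triangles; that is, there exist finitely many pairwise disjoint Yin sets $\mathcal{Q}_1,\ldots,\mathcal{Q}_n$, each of which is a curved quadrilateral or a curved triangle, such that $$\mathcal{Y}=\Bigl(\mathcal{Q}_1\cup\mathcal{Q}_2\cup\cdots\cup\mathcal{Q}_n\Bigr)^{\perp\perp}.$$
   Context: For a subset $\mathcal{P}$ of $\mathbb{R}^2$ (usual topology), $\mathcal{P}'$ is its complement, $\mathcal{P}^\circ$ its interior, and $\mathcal{P}^{\perp}:=(\mathcal{P}')^{\circ}$ its exterior. $\mathcal{P}$ is regular open if $\mathcal{P}=(\mathcal{P}^{\perp})^{\perp}$. A set $\mathcal{P}\subseteq\mathbb{R}^2$ is semianalytic if there exist finitely many analytic functions $g_i:\mathbb{R}^2\to\mathbb{R}$ such that $\mathcal{P}$ is in the universe of the finite Boolean algebra formed by the sets $\{\mathbf{x}\in\mathbb{R}^2: g_i(\mathbf{x})\ge 0\}$. A Yin set is a regular open semianalytic set $\mathcal{Y}\subseteq\mathbb{R}^2$ whose boundary is bounded. The regularized union of Yin sets $\mathcal{P},\mathcal{Q}$ is $\mathcal{P}\cup^{\perp\perp}\mathcal{Q}:=((\mathcal{P}\cup\mathcal{Q})^{\perp})^{\perp}$, and similarly for finitely many sets; an empty regularized union is $\emptyset$. A curved quadrilateral (respectively curved triangle) is a Yin set homeomorphic to an open disk whose boundary is a Jordan curve with four (respectively three) vertices, consecutive vertices being joined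 by edges, each of which may be a line segment or a curved arc. *)

theory Defs
  imports "HOL-Analysis.Analysis"
begin

definition exterior :: "'a::topological_space set \<Rightarrow> 'a set" where
  "exterior P = interior (- P)"

definition regular_open :: "'a::topological_space set \<Rightarrow> bool" where
  "regular_open P \<longleftrightarrow> P = exterior (exterior P)"

text \<open>Real analyticity at a point: local representation by a (necessarily absolutely)
  convergent power series in two variables.\<close>

definition real_analytic_at :: "(real^2 \<Rightarrow> real) \<Rightarrow> real^2 \<Rightarrow> bool" where
  "real_analytic_at f p \<longleftrightarrow>
     (\<exists>(c :: nat \<Rightarrow> nat \<Rightarrow> real) r. r > 0 \<and>
        (\<forall>x\<in>ball p r.
           ((\<lambda>(i, j). c i j * (x $ 1 - p $ 1) ^ i * (x $ 2 - p $ 2) ^ j) has_sum f x) UNIV))"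

definition real_analytic :: "(real^2 \<Rightarrow> real) \<Rightarrow> bool" where
  "real_analytic f \<longleftrightarrow> (\<forall>p. real_analytic_at f p)"

text \<open>\<open>algebra UNIV hull S\<close> is the smallest Boolean algebra of subsets of the plane that
  contains \<open>S\<close>.\<close>

definition semianalytic :: "(real^2) set \<Rightarrow> bool" where
  "semianalytic P \<longleftrightarrow>
     (\<exists>G. finite G \<and> (\<forall>g\<in>G. real_analytic g) \<and>
          P \<in> algebra UNIV hull ((\<lambda>g. {x. g x \<ge> 0}) ` G))"

definition yin_set :: "(real^2) set \<Rightarrow> bool" where
  "yin_set Y \<longleftrightarrow> regular_open Y \<and> semianalytic Y \<and> bounded (frontier Y)"

definition regularized_Union :: "(real^2) set set \<Rightarrow> (real^2) set" where
  "regularized_Union F = exterior (exterior (\<Union>F))"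

definition jordan_curve :: "(real^2) set \<Rightarrow> bool" where
  "jordan_curve C \<longleftrightarrow>
     (\<exists>g. simple_path g \<and> pathfinish g = pathstart g \<and> path_image g = C)"

text \<open>The Jordan curve \<open>C\<close> has the distinct vertices \<open>v 0, \<dots>, v (n - 1)\<close> in cyclic order,
  consecutive ones joined by the edges \<open>e 0, \<dots>, e (n - 1)\<close>, which meet only in common
  vertices. An edge is any arc; line segments are the special case of straight edges, and no
  smoothness or angle condition is imposed.\<close>

definition polygonal_structure ::
    "nat \<Rightarrow> (real^2) set \<Rightarrow> (nat \<Rightarrow> real^2) \<Rightarrow> (nat \<Rightarrow> real \<Rightarrow> real^2) \<Rightarrow> bool" where
  "polygonal_structure n C v e \<longleftrightarrow>
     inj_on v {..<n} \<and>
     (\<forall>i<n. arc (e i) \<and> pathstart (e i) = v i \<and> pathfinish (e i) = v (Suc i mod n)) \<and>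
     (\<forall>i<n. \<forall>j<n. i \<noteq> j \<longrightarrow>
        path_image (e i) \<inter> path_image (e j) \<subseteq>
          {v i, v (Suc i mod n)} \<inter> {v j, v (Suc j mod n)}) \<and>
     C = (\<Union>i<n. path_image (e i))"

definition curved_polygon :: "nat \<Rightarrow> (real^2) set \<Rightarrow> bool" where
  "curved_polygon n Q \<longleftrightarrow>
     yin_set Q \<and> Q homeomorphic ball (0 :: real^2) 1 \<and> jordan_curve (frontier Q) \<and>
     (\<exists>v e. polygonal_structure n (frontier Q) v e)"

definition curved_quadrilateral :: "(real^2) set \<Rightarrow> bool" where
  "curved_quadrilateral Q \<longleftrightarrow> curved_polygon 4 Q"

definition curved_triangle :: "(real^2) set \<Rightarrow> bool" where
  "curved_triangle Q \<longleftrightarrow> curved_polygon 3 Q"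

end

theory Submission
  imports Defs "HOL-Complex_Analysis.Complex_Analysis"
begin

text \<open>Cut a large square into thin vertical strips and each strip into boxes so small that, in each
  box centred at a point \<open>p\<close>, every defining function \<open>g\<close> is identically zero or of the form
  \<open>(v $ 1 - p $ 1) ^ k * h v\<close> with \<open>h\<close> of finite order \<open>d\<close> along the vertical line through \<open>p\<close>. Add to
  the defining functions their vertical derivatives up to order \<open>d\<close>. By the argument principle the power
  sums of the complex zeros of this family over a nearby abscissa depend holomorphically on the
  abscissa, so the rank of their Hankel matrix, which is the number of distinct zeros, is constant off the
  centre. Hence the real zeros form finitely many disjoint continuous graphs, converging to \<open>p\<close>, and the
  graphs cut each half box into a stack of Jordan domains. By Thom's lemma the signs of the family separate
  the members of a stack, so each of them is semianalytic; and each is inside or outside \<open>Y\<close>. Bolzano's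
  bisection lemma, first in the vertical and then in the horizontal direction, glues the local
  decompositions together. Since an edge is any arc, every Jordan domain is a curved triangle.\<close>

text \<open>Two constraints shape the proof. The generators in \<open>semianalytic\<close> must be
  analytic on the whole plane, so a piece may not be described by roots, Weierstrass polynomials or
  quotients that exist only near a point; vertical derivatives of the given functions are again
  global. Moreover real zeros can merge or vanish in pairs, so it is the complex zeros whose number
  is controlled, and conjugation symmetry brings the conclusion back to the real line. This replaces
  the preparation theorem and Puiseux series. The width of a box depends on its heights, since the
  zeros near the centre must leave neither through the top nor through the bottom. This dictates the
  order of the two bisections: widths can shrink only while finitely many boxes are stacked. A box
  is halved at its central abscissa because the graphs meet there, and the horizontal line through
  the centre joins the family so that a box can also be cut at that height. Since the union is
  regularized, the pieces need only be dense; graphs and cut lines belong to no piece.\<close>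

no_notation Infinite_Set_Sum.abs_summable_on (infix "abs'_summable'_on" 50)
no_notation fps_nth (infixl "$" 75)

section \<open>Double power series\<close>

text \<open>One coefficient array is evaluated both over the reals and over the complex numbers,
  since the zeros are counted by complex integration. The unordered sum is the one that
  \<open>real_analytic_at\<close> uses.\<close>

definition dps :: "(nat \<Rightarrow> nat \<Rightarrow> real) \<Rightarrow> 'a \<Rightarrow> 'a \<Rightarrow> 'a::{real_normed_field,banach}" where
  "dps c x y = (\<Sum>\<^sub>\<infinity>(i,j). of_real (c i j) * x ^ i * y ^ j)"

text \<open>Absolute convergence at the corner \<open>(r, r)\<close> dominates every term on the
  closed bidisc of radius \<open>r\<close>, over either field.\<close>

definition dps_conv :: "(nat \<Rightarrow> nat \<Rightarrow> real) \<Rightarrow> real \<Rightarrow> bool" where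
  "dps_conv c r \<longleftrightarrow> 0 < r \<and> (\<lambda>(i,j). \<bar>c i j\<bar> * r ^ i * r ^ j) summable_on UNIV"

definition dps_dx :: "(nat \<Rightarrow> nat \<Rightarrow> real) \<Rightarrow> nat \<Rightarrow> nat \<Rightarrow> real" where
  "dps_dx c i j = real (Suc i) * c (Suc i) j"

definition dps_dy :: "(nat \<Rightarrow> nat \<Rightarrow> real) \<Rightarrow> nat \<Rightarrow> nat \<Rightarrow> real" where
  "dps_dy c i j = real (Suc j) * c i (Suc j)"

definition dps_swap :: "(nat \<Rightarrow> nat \<Rightarrow> real) \<Rightarrow> nat \<Rightarrow> nat \<Rightarrow> real" where
  "dps_swap c i j = c j i"

lemma dps_dy_swap: "dps_dy c = dps_swap (dps_dx (dps_swap c))"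
  by (auto simp: dps_dy_def dps_swap_def dps_dx_def fun_eq_iff)

lemma dps_swap: "dps (dps_swap c) x y = dps c y x"
proof -
  have "dps c y x = infsum ((\<lambda>(i,j). of_real (c i j) * y ^ i * x ^ j) \<circ> prod.swap) UNIV"
    unfolding dps_def by (subst infsum_reindex[symmetric]) (auto simp: inj_swap)
  then show ?thesis
    by (simp add: dps_def dps_swap_def o_def case_prod_unfold mult_ac)
qed

lemma dps_conv_swap: "dps_conv (dps_swap c) r \<longleftrightarrow> dps_conv c r"
proof -
  have "(\<lambda>(i,j). \<bar>c i j\<bar> * r ^ i * r ^ j) summable_on range prod.swap \<longleftrightarrow>
    (\<lambda>(i,j). \<bar>c i j\<bar> * r ^ i * r ^ j) \<circ> prod.swap summable_on UNIV"
    by (rule summable_on_reindex) (auto simp: inj_swap)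
  then show ?thesis
    by (simp add: dps_conv_def dps_swap_def o_def case_prod_unfold mult_ac)
qed

lemma dps_conv_pos: "dps_conv c r \<Longrightarrow> 0 < r"
  by (simp add: dps_conv_def)

lemma dps_conv_mono:
  assumes "dps_conv c r" "0 < s" "s \<le> r"
  shows "dps_conv c s"
proof -
  have "(\<lambda>(i,j). \<bar>c i j\<bar> * r ^ i * r ^ j) abs_summable_on UNIV"
    using assms(1) by (intro summable_on_iff_abs_summable_on_real[THEN iffD1]) (simp add: dps_conv_def)
  then have "(\<lambda>(i,j). \<bar>c i j\<bar> * s ^ i * s ^ j) abs_summable_on UNIV"
    by (rule Infinite_Sum.abs_summable_on_comparison_test)
       (use assms in \<open>auto simp: abs_mult intro!: mult_mono power_mono\<close>)
  then show ?thesis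
    using assms(2) by (simp add: dps_conv_def summable_on_iff_abs_summable_on_real[THEN iffD2])
qed

lemma dps_term_bound:
  fixes x y :: "'a::{real_normed_field,banach}"
  assumes "norm x \<le> r" "norm y \<le> r"
  shows "norm (of_real (c i j) * x ^ i * y ^ j) \<le> \<bar>c i j\<bar> * r ^ i * r ^ j"
proof -
  have "0 \<le> r" using assms(1) norm_ge_zero[of x] by linarith
  then show ?thesis
    using assms by (auto simp: norm_mult norm_power intro!: mult_mono power_mono)
qed

lemma dps_abs_summable:
  fixes x y :: "'a::{real_normed_field,banach}"
  assumes "dps_conv c r" "norm x \<le> r" "norm y \<le> r"
  shows "(\<lambda>(i,j). of_real (c i j) * x ^ i * y ^ j) abs_summable_on UNIV"
proof (rule Infinite_Sum.abs_summable_on_comparison_test)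
  show "(\<lambda>(i,j). \<bar>c i j\<bar> * r ^ i * r ^ j) abs_summable_on UNIV"
    using assms(1) by (intro summable_on_iff_abs_summable_on_real[THEN iffD1]) (simp add: dps_conv_def)
  show "norm (case p of (i, j) \<Rightarrow> of_real (c i j) * x ^ i * y ^ j)
        \<le> norm (case p of (i, j) \<Rightarrow> \<bar>c i j\<bar> * r ^ i * r ^ j)" for p
    using dps_term_bound[OF assms(2,3), of c "fst p" "snd p"] using norm_ge_zero[of x] assms(2)
    by (cases p) (simp add: abs_mult del: norm_ge_zero)
qed

lemma dps_has_sum:
  fixes x y :: "'a::{real_normed_field,banach}"
  assumes "dps_conv c r" "norm x \<le> r" "norm y \<le> r"
  shows "((\<lambda>(i,j). of_real (c i j) * x ^ i * y ^ j) has_sum dps c x y) UNIV"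
  unfolding dps_def by (rule has_sum_infsum[OF abs_summable_summable[OF dps_abs_summable[OF assms]]])

lemma continuous_on_dps:
  assumes "dps_conv c r"
  shows "continuous_on (cball 0 r \<times> cball 0 r)
           (\<lambda>p. dps c (fst p) (snd p :: 'a::{real_normed_field,banach}))"
proof -
  let ?f = "\<lambda>(i,j) p. of_real (c i j) * (fst p) ^ i * (snd p :: 'a) ^ j"
  have "uniform_limit (cball 0 r \<times> cball 0 r) (\<lambda>X p. \<Sum>k\<in>X. ?f k p) (\<lambda>p. \<Sum>\<^sub>\<infinity>k. ?f k p)
          (finite_subsets_at_top UNIV)"
    using assms dps_term_bound[of _ r _ c]
    by (intro Weierstrass_m_test_general[where M = "\<lambda>(i,j). \<bar>c i j\<bar> * r ^ i * r ^ j"])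
       (auto simp: dps_conv_def)
  then have "continuous_on (cball 0 r \<times> cball 0 r) (\<lambda>p. \<Sum>\<^sub>\<infinity>k. ?f k p)"
    by (rule uniform_limit_theorem[rotated])
       (auto simp: case_prod_unfold intro!: always_eventually continuous_intros)
  then show ?thesis
    by (simp add: dps_def case_prod_unfold)
qed

text \<open>Fubini for an absolutely summable family: grouped by rows the double series becomes an
  ordinary power series in \<open>x\<close>, to which one-variable termwise differentiation
  applies.\<close>

lemma dps_sums_rows:
  fixes x y :: "'a::{real_normed_field,banach}"
  assumes "dps_conv c r" "norm x \<le> r" "norm y \<le> r"
  shows "(\<lambda>i. (\<Sum>\<^sub>\<infinity>j. of_real (c i j) * y ^ j) * x ^ i) sums dps c x y"
proof -
  let ?f = "\<lambda>(i,j). of_real (c i j) * x ^ i * y ^ j"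
  have abs: "?f abs_summable_on (UNIV \<times> UNIV)"
    using dps_abs_summable[OF assms] by simp
  have hs: "(?f has_sum dps c x y) (Sigma UNIV (\<lambda>_. UNIV))"
    using dps_has_sum[OF assms] by simp
  have row: "(\<lambda>j. of_real (c i j) * y ^ j) summable_on UNIV" for i
  proof -
    have "(\<lambda>(i,j). \<bar>c i j\<bar> * r ^ i * r ^ j) abs_summable_on (UNIV \<times> UNIV)"
      using assms(1) by (intro summable_on_iff_abs_summable_on_real[THEN iffD1]) (simp add: dps_conv_def)
    then have "(\<lambda>j. \<bar>c i j\<bar> * r ^ i * r ^ j) abs_summable_on UNIV"
      by (subst (asm) Infinite_Sum.abs_summable_on_Sigma_iff) (auto simp: case_prod_unfold)
    then have "(\<lambda>j. \<bar>c i j\<bar> * r ^ i * r ^ j) summable_on UNIV"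
      by (rule summable_on_iff_abs_summable_on_real[THEN iffD2])
    then have "(\<lambda>j. (1 / r ^ i) * (\<bar>c i j\<bar> * r ^ i * r ^ j)) summable_on UNIV"
      by (rule summable_on_cmult_right)
    moreover have "(1 / r ^ i) * (\<bar>c i j\<bar> * r ^ i * r ^ j) = \<bar>c i j\<bar> * r ^ j" for j
      using dps_conv_pos[OF assms(1)] by simp
    ultimately have "(\<lambda>j. \<bar>c i j\<bar> * r ^ j) summable_on UNIV"
      by (simp only:)
    then have s: "(\<lambda>j. \<bar>c i j\<bar> * r ^ j) abs_summable_on UNIV"
      by (rule summable_on_iff_abs_summable_on_real[THEN iffD1])
    show ?thesis
      by (rule abs_summable_summable[OF Infinite_Sum.abs_summable_on_comparison_test[OF s]])
         (use assms(3) dps_conv_pos[OF assms(1)] in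
           \<open>auto simp: norm_mult norm_power abs_mult intro!: mult_left_mono power_mono\<close>)
  qed
  have "((\<lambda>i. (\<Sum>\<^sub>\<infinity>j. of_real (c i j) * y ^ j) * x ^ i) has_sum dps c x y) UNIV"
  proof (rule has_sum_SigmaD[OF hs])
    fix i
    have "((\<lambda>j. of_real (c i j) * y ^ j * x ^ i) has_sum (\<Sum>\<^sub>\<infinity>j. of_real (c i j) * y ^ j) * x ^ i) UNIV"
      by (intro has_sum_cmult_left has_sum_infsum row)
    then show "((\<lambda>j. ?f (i, j)) has_sum (\<Sum>\<^sub>\<infinity>j. of_real (c i j) * y ^ j) * x ^ i) UNIV"
      by (simp add: mult_ac)
  qed
  then show ?thesis by (rule has_sum_imp_sums)
qed

lemma power_Suc_bounded:
  fixes q :: real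
  assumes "0 \<le> q" "q < 1"
  shows "\<exists>B>0. \<forall>n. real (Suc n) * q ^ n \<le> B"
proof -
  have "summable (\<lambda>n. real (Suc n) * q ^ n)"
  proof -
    have "summable (\<lambda>n. diffs (\<lambda>_. 1) n * q ^ n)"
      using assms by (intro termdiff_converges[where K=1]) (auto intro: summable_geometric)
    then show ?thesis by (simp add: diffs_def)
  qed
  then have "(\<lambda>n. real (Suc n) * q ^ n) \<longlonglongrightarrow> 0" by (rule summable_LIMSEQ_zero)
  then have "Bseq (\<lambda>n. real (Suc n) * q ^ n)" using convergentI convergent_imp_Bseq by blast
  then obtain B where "B > 0" "\<And>n. norm (real (Suc n) * q ^ n) \<le> B" by (auto simp: Bseq_def)
  then show ?thesis by (intro exI[of _ B]) (auto simp: abs_le_iff)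
qed

text \<open>The strict loss of radius pays for the factor \<open>Suc i\<close>: the numbers
  \<open>real (Suc i) * (s/r) ^ i\<close> are bounded.\<close>

lemma dps_conv_dx:
  assumes "dps_conv c r" "0 < s" "s < r"
  shows "dps_conv (dps_dx c) s"
proof -
  obtain B where B: "B > 0" "\<And>n. real (Suc n) * (s/r) ^ n \<le> B"
    using power_Suc_bounded[of "s/r"] assms by auto
  have "(\<lambda>(i,j). \<bar>c i j\<bar> * r ^ i * r ^ j) summable_on range (\<lambda>(i::nat,j::nat). (Suc i, j))"
    using assms(1) summable_on_subset_banach by (auto simp: dps_conv_def)
  then have "(\<lambda>(i,j). \<bar>c i j\<bar> * r ^ i * r ^ j) \<circ> (\<lambda>(i,j). (Suc i, j)) summable_on UNIV"
    by (subst (asm) summable_on_reindex) (auto simp: inj_on_def)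
  then have "(\<lambda>(i,j). \<bar>c (Suc i) j\<bar> * r ^ Suc i * r ^ j) summable_on UNIV"
    by (simp add: o_def case_prod_unfold)
  then have "(\<lambda>p. (B / r) * (case p of (i,j) \<Rightarrow> \<bar>c (Suc i) j\<bar> * r ^ Suc i * r ^ j)) summable_on UNIV"
    by (rule summable_on_cmult_right)
  then have "(\<lambda>p. (B / r) * (case p of (i,j) \<Rightarrow> \<bar>c (Suc i) j\<bar> * r ^ Suc i * r ^ j)) abs_summable_on UNIV"
    by (rule summable_on_iff_abs_summable_on_real[THEN iffD1])
  then have "(\<lambda>(i,j). \<bar>dps_dx c i j\<bar> * s ^ i * s ^ j) abs_summable_on UNIV"
  proof (rule Infinite_Sum.abs_summable_on_comparison_test)
    fix p :: "nat \<times> nat"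
    obtain i j where p: "p = (i,j)" by (cases p)
    have "real (Suc i) * s ^ i \<le> B * r ^ i"
      using B(2)[of i] assms by (simp add: power_divide pos_divide_le_eq)
    then have "\<bar>c (Suc i) j\<bar> * (real (Suc i) * s ^ i) * s ^ j \<le> \<bar>c (Suc i) j\<bar> * (B * r ^ i) * r ^ j"
      using assms B by (intro mult_mono[OF mult_left_mono power_mono]) auto
    moreover have "norm (case p of (i, j) \<Rightarrow> \<bar>dps_dx c i j\<bar> * s ^ i * s ^ j)
        = \<bar>c (Suc i) j\<bar> * (real (Suc i) * s ^ i) * s ^ j"
      using assms by (simp add: p dps_dx_def abs_mult mult_ac)
    moreover have "norm (B / r * (case p of (i, j) \<Rightarrow> \<bar>c (Suc i) j\<bar> * r ^ Suc i * r ^ j))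
        = \<bar>c (Suc i) j\<bar> * (B * r ^ i) * r ^ j"
      using assms B(1) by (simp add: p abs_mult mult_ac)
    ultimately show "norm (case p of (i, j) \<Rightarrow> \<bar>dps_dx c i j\<bar> * s ^ i * s ^ j)
        \<le> norm (B / r * (case p of (i, j) \<Rightarrow> \<bar>c (Suc i) j\<bar> * r ^ Suc i * r ^ j))"
      by simp
  qed
  then show ?thesis
    using assms(2) by (simp add: dps_conv_def summable_on_iff_abs_summable_on_real[THEN iffD2])
qed

lemma dps_conv_dy:
  assumes "dps_conv c r" "0 < s" "s < r"
  shows "dps_conv (dps_dy c) s"
  using dps_conv_dx[of "dps_swap c" r s] assms by (simp add: dps_dy_swap dps_conv_swap)

lemma has_field_derivative_dps_dx:
  fixes x y :: "'a::{real_normed_field,banach}"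
  assumes "dps_conv c r" "norm x < r" "norm y < r"
  shows "((\<lambda>x. dps c x y) has_field_derivative dps (dps_dx c) x y) (at x)"
proof -
  define e where "e = (\<lambda>i. \<Sum>\<^sub>\<infinity>j. of_real (c i j) * y ^ j)"
  have s: "(\<lambda>i. e i * z ^ i) sums dps c z y" if "norm z < r" for z
    unfolding e_def using that assms by (intro dps_sums_rows[OF assms(1)]) auto
  have d: "((\<lambda>z. \<Sum>n. e n * z ^ n) has_field_derivative (\<Sum>n. diffs e n * x ^ n)) (at x)"
    using s by (intro termdiffs_strong'[of r]) (auto simp: assms sums_iff)
  \<comment> \<open>\<open>dps_dx c\<close> is known to converge at radii below \<open>r\<close>
    only, so \<open>t\<close> is placed strictly between both norms and \<open>r\<close>.\<close>
  define t where "t = (max (norm x) (norm y) + r) / 2"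
  have t: "norm x < t" "norm y < t" "t < r" using assms by (simp_all add: t_def max_def)
  then have t0: "0 < t" using norm_ge_zero[of x] by linarith
  have "diffs e n = (\<Sum>\<^sub>\<infinity>j. of_real (dps_dx c n j) * y ^ j)" for n
    unfolding diffs_def e_def dps_dx_def
    by (subst infsum_cmult_right'[symmetric]) (simp add: mult_ac)
  then have "(\<lambda>n. diffs e n * x ^ n) sums dps (dps_dx c) x y"
    using dps_sums_rows[OF dps_conv_dx[OF assms(1) t0 t(3)], of x y] t by simp
  then have d': "((\<lambda>z. \<Sum>n. e n * z ^ n) has_field_derivative dps (dps_dx c) x y) (at x)"
    using d by (simp add: sums_iff)
  show ?thesis
    by (rule has_field_derivative_transform_within_open[OF d', of "ball 0 r"])
       (use s assms in \<open>auto simp: sums_iff\<close>)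
qed

lemma has_field_derivative_dps_dy:
  fixes x y :: "'a::{real_normed_field,banach}"
  assumes "dps_conv c r" "norm x < r" "norm y < r"
  shows "((\<lambda>y. dps c x y) has_field_derivative dps (dps_dy c) x y) (at y)"
  using has_field_derivative_dps_dx[of "dps_swap c" r y x] assms
  by (simp add: dps_dy_swap dps_conv_swap dps_swap)

definition dps_shift :: "nat \<Rightarrow> (nat \<Rightarrow> nat \<Rightarrow> real) \<Rightarrow> nat \<Rightarrow> nat \<Rightarrow> real" where
  "dps_shift k c i j = c (i + k) j"

lemma dps_conv_shift:
  assumes "dps_conv c r"
  shows "dps_conv (dps_shift k c) r"
proof -
  have "(\<lambda>(i,j). \<bar>c i j\<bar> * r ^ i * r ^ j) summable_on range (\<lambda>(i::nat,j::nat). (i + k, j))"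
    using assms(1) summable_on_subset_banach by (auto simp: dps_conv_def)
  then have "(\<lambda>(i,j). \<bar>c i j\<bar> * r ^ i * r ^ j) \<circ> (\<lambda>(i,j). (i + k, j)) summable_on UNIV"
    by (subst (asm) summable_on_reindex) (auto simp: inj_on_def)
  then have "(\<lambda>(i,j). \<bar>c (i + k) j\<bar> * r ^ (i + k) * r ^ j) summable_on UNIV"
    by (simp add: o_def case_prod_unfold)
  then have "(\<lambda>p. (1 / r ^ k) * (case p of (i,j) \<Rightarrow> \<bar>c (i + k) j\<bar> * r ^ (i + k) * r ^ j)) summable_on UNIV"
    by (rule summable_on_cmult_right)
  moreover have "(1 / r ^ k) * (case p of (i,j) \<Rightarrow> \<bar>c (i + k) j\<bar> * r ^ (i + k) * r ^ j)
     = (case p of (i,j) \<Rightarrow> \<bar>dps_shift k c i j\<bar> * r ^ i * r ^ j)" for p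
    using dps_conv_pos[OF assms] by (cases p) (simp add: dps_shift_def power_add)
  ultimately show ?thesis
    using dps_conv_pos[OF assms] by (simp add: dps_conv_def)
qed

lemma dps_shift:
  fixes x y :: "'a::{real_normed_field,banach}"
  assumes "dps_conv c r" "norm x \<le> r" "norm y \<le> r" and z: "\<And>i j. i < k \<Longrightarrow> c i j = 0"
  shows "dps c x y = x ^ k * dps (dps_shift k c) x y"
proof -
  let ?f = "\<lambda>(i,j). of_real (c i j) * x ^ i * y ^ j"
  have "((\<lambda>p. x ^ k * (case p of (i,j) \<Rightarrow> of_real (dps_shift k c i j) * x ^ i * y ^ j))
     has_sum (x ^ k * dps (dps_shift k c) x y)) UNIV"
    by (intro has_sum_cmult_right dps_has_sum[OF dps_conv_shift[OF assms(1)]] assms)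
  moreover have "x ^ k * (case p of (i,j) \<Rightarrow> of_real (dps_shift k c i j) * x ^ i * y ^ j)
      = (?f \<circ> (\<lambda>(i,j). (i + k, j))) p" for p
    by (cases p) (simp add: dps_shift_def power_add)
  ultimately have "((?f \<circ> (\<lambda>(i,j). (i + k, j))) has_sum (x ^ k * dps (dps_shift k c) x y)) UNIV"
    by (simp only:)
  then have "(?f has_sum (x ^ k * dps (dps_shift k c) x y)) (range (\<lambda>(i::nat,j::nat). (i + k, j)))"
    by (subst has_sum_reindex) (auto simp: inj_on_def)
  then have "(?f has_sum (x ^ k * dps (dps_shift k c) x y)) UNIV"
  proof (rule has_sum_cong_neutral[THEN iffD1, rotated -1])
    fix p :: "nat \<times> nat" assume "p \<in> UNIV - range (\<lambda>(i::nat,j::nat). (i + k, j))"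
    then have "fst p < k"
    proof (rule_tac ccontr)
      assume "\<not> fst p < k"
      then have "p = (\<lambda>(i::nat,j::nat). (i + k, j)) (fst p - k, snd p)" by (cases p) simp
      then show False using \<open>p \<in> _\<close> by blast
    qed
    then show "?f p = 0" using z by (cases p) auto
  qed auto
  then show ?thesis
    using dps_has_sum[OF assms(1-3)] has_sum_unique by blast
qed

lemma dps_of_real:
  assumes "dps_conv c r" "\<bar>x\<bar> \<le> r" "\<bar>y\<bar> \<le> r"
  shows "dps c (of_real x) (of_real y) = (of_real (dps c x y) :: 'a::{real_normed_field,banach})"
proof -
  have "((\<lambda>p. of_real (case p of (i,j) \<Rightarrow> of_real (c i j) * x ^ i * y ^ j)) has_sum
      (of_real (dps c x y) :: 'a)) UNIV"
    using dps_has_sum[OF assms(1), of x y] assms by (intro has_sum_of_real) auto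
  moreover have "((\<lambda>(i,j). of_real (c i j) * of_real x ^ i * of_real y ^ j) has_sum
      (dps c (of_real x) (of_real y) :: 'a)) UNIV"
    using assms by (intro dps_has_sum[OF assms(1)]) auto
  ultimately show ?thesis
    using has_sum_unique by (force simp: case_prod_unfold)
qed

text \<open>Reflection symmetry from real coefficients. It makes a complex zero real when it is the
  only zero near a real point.\<close>

lemma dps_cnj:
  assumes "dps_conv c r" "cmod x \<le> r" "cmod y \<le> r"
  shows "dps c (cnj x) (cnj y) = cnj (dps c x y)"
proof -
  have "((\<lambda>p. cnj (case p of (i,j) \<Rightarrow> of_real (c i j) * x ^ i * y ^ j)) has_sum cnj (dps c x y)) UNIV"
    using dps_has_sum[OF assms] by simp
  moreover have "((\<lambda>(i,j). of_real (c i j) * cnj x ^ i * cnj y ^ j) has_sum dps c (cnj x) (cnj y)) UNIV"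
    using assms by (intro dps_has_sum[OF assms(1)]) auto
  ultimately show ?thesis
    using has_sum_unique by (force simp: case_prod_unfold)
qed

lemma dps_0_left:
  fixes y :: "'a::{real_normed_field,banach}"
  assumes "dps_conv c r" "norm y \<le> r"
  shows "(\<lambda>j. of_real (c 0 j) * y ^ j) sums dps c 0 y"
proof -
  let ?f = "\<lambda>(i,j). of_real (c i j) * 0 ^ i * y ^ j"
  have "(?f has_sum dps c 0 y) UNIV"
    using assms dps_conv_pos[OF assms(1)] by (intro dps_has_sum[OF assms(1)]) auto
  then have "(?f has_sum dps c 0 y) (range (Pair 0))"
    by (rule has_sum_cong_neutral[THEN iffD1, rotated -1])
       (auto simp: image_iff power_0_left)
  then have "((\<lambda>j. of_real (c 0 j) * y ^ j) has_sum dps c 0 y) UNIV"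
    by (subst (asm) has_sum_reindex) (auto simp: inj_on_def o_def)
  then show ?thesis by (rule has_sum_imp_sums)
qed

lemma dps_0_0: "dps c 0 0 = (of_real (c 0 0) :: 'a::{real_normed_field,banach})"
proof -
  have "dps c 0 0 = (\<Sum>\<^sub>\<infinity>(i,j)\<in>{(0,0)}. of_real (c i j) * 0 ^ i * 0 ^ j :: 'a)"
    unfolding dps_def by (rule infsum_cong_neutral) (auto simp: power_0_left split: if_splits)
  then show ?thesis by simp
qed

lemma dps_dy_funpow:
  "((dps_dy ^^ n) c) i j = (fact (j + n) / fact j) * c i (j + n)"
proof (induction n arbitrary: j)
  case (Suc n)
  have "((dps_dy ^^ Suc n) c) i j = real (Suc j) * ((fact (Suc j + n) / fact (Suc j)) * c i (Suc j + n))"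
    by (simp add: dps_dy_def Suc.IH)
  also have "real (Suc j) * (F / fact (Suc j) * C) = F / fact j * C" for F C :: real
    by (simp add: fact_Suc del: of_nat_Suc)
  finally show ?case by simp
qed simp

section \<open>The number of distinct zeros\<close>

text \<open>Full column rank at the single point \<open>w\<close> spreads to a punctured
  neighbourhood of any \<open>z\<close>. The proof is Gaussian elimination, one column per induction
  step: a pivot that is nonzero at \<open>w\<close> is not identically zero, hence has isolated
  zeros in the connected set \<open>S\<close>. No determinant is formed.\<close>

lemma eventually_columns_independent:
  fixes A :: "nat \<Rightarrow> nat \<Rightarrow> complex \<Rightarrow> complex"
  assumes S: "open S" "connected S" "z \<in> S" "w \<in> S"
    and hol: "\<And>i j. A i j holomorphic_on S"
    and inj: "\<And>v. (\<forall>i<n. (\<Sum>j<k. A i j w * v j) = 0) \<Longrightarrow> \<forall>j<k. v j = 0"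
  shows "\<forall>\<^sub>F x in at z. \<forall>v. (\<forall>i<n. (\<Sum>j<k. A i j x * v j) = 0) \<longrightarrow> (\<forall>j<k. v j = 0)"
  using hol inj
proof (induction k arbitrary: A)
  case (Suc k)
  obtain r where r: "r < n" "A r 0 w \<noteq> 0"
  proof (rule ccontr)
    assume "\<not> thesis"
    with that have "\<forall>i<n. A i 0 w = 0" by blast
    then have "\<forall>i<n. (\<Sum>j<Suc k. A i j w * (if j = 0 then 1 else 0)) = 0"
      by (simp add: sum.lessThan_Suc_shift del: sum.lessThan_Suc)
    from Suc.prems(2)[OF this] show False by auto
  qed
  \<comment> \<open>Elimination by cross-multiplication instead of division, so that the entries
    stay holomorphic on all of \<open>S\<close>.\<close>
  define B where "B i j x = A r 0 x * A i (Suc j) x - A i 0 x * A r (Suc j) x" for i j x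
  have row: "(\<Sum>j<k. B i j x * v j) =
      A r 0 x * (\<Sum>j<k. A i (Suc j) x * v j) - A i 0 x * (\<Sum>j<k. A r (Suc j) x * v j)" for i x v
    by (simp add: B_def algebra_simps sum_subtractf sum_distrib_left)
  have "\<forall>\<^sub>F x in at z. \<forall>v. (\<forall>i<n. (\<Sum>j<k. B i j x * v j) = 0) \<longrightarrow> (\<forall>j<k. v j = 0)"
  proof (rule Suc.IH)
    show "B i j holomorphic_on S" for i j
      unfolding B_def by (intro holomorphic_intros Suc.prems)
  next
    fix v :: "nat \<Rightarrow> complex"
    assume v: "\<forall>i<n. (\<Sum>j<k. B i j w * v j) = 0"
    \<comment> \<open>A kernel vector of the reduced matrix at \<open>w\<close> is completed by
      solving the pivot row for the first coordinate.\<close>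
    define u where "u j = (case j of 0 \<Rightarrow> - (\<Sum>j<k. A r (Suc j) w * v j) / A r 0 w | Suc j \<Rightarrow> v j)" for j
    have "\<forall>i<n. (\<Sum>j<Suc k. A i j w * u j) = 0"
    proof (intro allI impI)
      fix i assume "i < n"
      then have "A r 0 w * (\<Sum>j<Suc k. A i j w * u j) = 0"
        using v r row[of i w v] by (simp add: sum.lessThan_Suc_shift u_def field_simps del: sum.lessThan_Suc)
      then show "(\<Sum>j<Suc k. A i j w * u j) = 0" using r by simp
    qed
    from Suc.prems(2)[OF this] show "\<forall>j<k. v j = 0"
      by (force simp: u_def)
  qed
  moreover have "\<forall>\<^sub>F x in at z. A r 0 x \<noteq> 0 \<and> x \<in> S"
    using non_zero_neighbour_alt[OF Suc.prems(1) S r(2)] .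
  ultimately show ?case
  proof eventually_elim
    case (elim x)
    show ?case
    proof (intro allI impI)
      fix v :: "nat \<Rightarrow> complex" and j
      assume v: "\<forall>i<n. (\<Sum>j<Suc k. A i j x * v j) = 0" and j: "j < Suc k"
      have eq: "A i 0 x * v 0 = - (\<Sum>j<k. A i (Suc j) x * v (Suc j))" if "i < n" for i
        using v that by (simp add: sum.lessThan_Suc_shift add_eq_0_iff2 del: sum.lessThan_Suc)
      have "(\<Sum>j<k. B i j x * v (Suc j)) = 0" if "i < n" for i
      proof -
        have "(\<Sum>j<k. B i j x * v (Suc j)) = - (A r 0 x * (A i 0 x * v 0)) + A i 0 x * (A r 0 x * v 0)"
          unfolding row eq[OF that] eq[OF r(1)] by simp
        then show ?thesis by simp
      qed
      then have 0: "\<forall>j<k. v (Suc j) = 0"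
        using elim(1)[rule_format, of "\<lambda>j. v (Suc j)"] by blast
      then have "v 0 = 0" using eq[OF r(1)] elim(2) by simp
      with 0 j show "v j = 0" by (cases j) auto
    qed
  qed
qed simp

definition power_sum :: "('a \<Rightarrow> 'a::comm_semiring_1) \<Rightarrow> 'a set \<Rightarrow> nat \<Rightarrow> 'a" where
  "power_sum m Z i = (\<Sum>w\<in>Z. m w * w ^ i)"

text \<open>Read \<open>v\<close> as the coefficients of a polynomial: row \<open>i\<close> of the
  Hankel matrix pairs this polynomial with \<open>w ^ i\<close> in the bilinear form given by point
  masses \<open>m w\<close> on \<open>Z\<close>.\<close>

lemma hankel_row:
  fixes m :: "complex \<Rightarrow> complex"
  shows "(\<Sum>j<k. power_sum m Z (i + j) * v j) = (\<Sum>w\<in>Z. m w * w ^ i * (\<Sum>j<k. v j * w ^ j))"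
proof -
  have "(\<Sum>j<k. power_sum m Z (i + j) * v j) = (\<Sum>j<k. \<Sum>w\<in>Z. m w * w ^ i * (v j * w ^ j))"
    by (simp add: power_sum_def sum_distrib_left sum_distrib_right power_add mult_ac)
  also have "\<dots> = (\<Sum>w\<in>Z. \<Sum>j<k. m w * w ^ i * (v j * w ^ j))"
    by (rule sum.swap)
  finally show ?thesis by (simp add: sum_distrib_left)
qed

lemma poly_eq_sum_lessThan:
  fixes p :: "'a::comm_semiring_1 poly"
  assumes "degree p < k"
  shows "poly p x = (\<Sum>i<k. coeff p i * x ^ i)"
  unfolding poly_altdef using assms
  by (intro sum.mono_neutral_left) (auto simp: coeff_eq_0)

text \<open>A kernel vector is a polynomial \<open>Q\<close> of degree below \<open>k\<close> that
  is orthogonal, for the weights \<open>m\<close>, to all polynomials of degree below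
  \<open>k\<close>. Testing against those that vanish on \<open>Z\<close> except at one point gives
  \<open>k\<close> roots of \<open>Q\<close>.\<close>

lemma hankel_injective:
  fixes m :: "complex \<Rightarrow> complex"
  assumes Z: "finite Z" "card Z = k" and m: "\<And>w. w \<in> Z \<Longrightarrow> m w \<noteq> 0"
    and v: "\<forall>i<k. (\<Sum>j<k. power_sum m Z (i + j) * v j) = 0"
  shows "\<forall>j<k. v j = 0"
proof -
  define Q where "Q = (\<Sum>j<k. monom (v j) j)"
  have Q: "poly Q x = (\<Sum>j<k. v j * x ^ j)" for x
    by (simp add: Q_def poly_sum poly_monom)
  have cQ: "coeff Q j = (if j < k then v j else 0)" for j
    by (simp add: Q_def coeff_sum)
  have 0: "(\<Sum>w\<in>Z. m w * poly r w * poly Q w) = 0" if "degree r < k" for r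
  proof -
    have "(\<Sum>w\<in>Z. m w * poly r w * poly Q w)
        = (\<Sum>w\<in>Z. \<Sum>i<k. coeff r i * (m w * w ^ i * (\<Sum>j<k. v j * w ^ j)))"
      by (simp add: poly_eq_sum_lessThan[OF that] Q sum_distrib_left sum_distrib_right mult_ac)
    also have "\<dots> = (\<Sum>i<k. \<Sum>w\<in>Z. coeff r i * (m w * w ^ i * (\<Sum>j<k. v j * w ^ j)))"
      by (rule sum.swap)
    also have "\<dots> = (\<Sum>i<k. coeff r i * (\<Sum>j<k. power_sum m Z (i + j) * v j))"
      by (simp add: hankel_row sum_distrib_left)
    also have "\<dots> = 0" using v by simp
    finally show ?thesis .
  qed
  have root: "poly Q w = 0" if w: "w \<in> Z" for w
  proof -
    \<comment> \<open>Up to scaling, the Lagrange basis polynomial of \<open>w\<close> on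
      \<open>Z\<close>.\<close>
    define r where "r = (\<Prod>u\<in>Z - {w}. [:- u, 1:])"
    have "degree r \<le> (\<Sum>u\<in>Z - {w}. degree [:- u, 1:])"
      unfolding r_def using Z degree_prod_sum_le[of "Z - {w}" "\<lambda>u. [:- u, 1:]"] by (simp add: o_def)
    also have "\<dots> < k" using w Z card_gt_0_iff[of Z] by auto
    finally have "(\<Sum>u\<in>Z. m u * poly r u * poly Q u) = 0" by (rule 0)
    moreover have "poly r u = 0" if "u \<in> Z - {w}" for u
      using that Z by (auto simp: r_def poly_prod prod_zero_iff)
    ultimately have "m w * poly r w * poly Q w = 0"
      using Z w by (simp add: sum.remove[of Z w])
    moreover have "poly r w \<noteq> 0"
      using Z by (auto simp: r_def poly_prod)
    ultimately show ?thesis using m w by simp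
  qed
  have "Q = 0"
  proof (rule ccontr)
    assume Q0: "Q \<noteq> 0"
    have "k \<le> card {x. poly Q x = 0}"
      using Z root by (auto intro!: card_mono poly_roots_finite Q0)
    also have "\<dots> \<le> degree Q" using card_poly_roots_bound[OF Q0] .
    finally have "k \<le> degree Q" .
    moreover have "coeff Q (degree Q) \<noteq> 0" using Q0 by simp
    ultimately show False by (simp add: cQ)
  qed
  then show ?thesis using cQ by (metis coeff_0)
qed

text \<open>The kernel vector consists of the coefficients of the monic polynomial with the simple
  roots \<open>Z\<close>, whose degree is \<open>card Z\<close>.\<close>

lemma hankel_kernel:
  fixes m :: "complex \<Rightarrow> complex"
  assumes "finite Z" "card Z < k"
  shows "\<exists>v. (\<forall>i. (\<Sum>j<k. power_sum m Z (i + j) * v j) = 0) \<and> (\<exists>j<k. v j \<noteq> 0)"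
proof -
  define r where "r = (\<Prod>u\<in>Z. [:- u, 1:])"
  have "degree r \<le> (\<Sum>u\<in>Z. degree [:- u, 1:])"
    unfolding r_def using assms(1) degree_prod_sum_le[of Z "\<lambda>u. [:- u, 1:]"] by (simp add: o_def)
  also have "\<dots> < k" using assms by simp
  finally have d: "degree r < k" .
  have "r \<noteq> 0" using assms(1) by (auto simp: r_def)
  moreover have "(\<Sum>j<k. power_sum m Z (i + j) * coeff r j) = 0" for i
  proof -
    have "poly r w = 0" if "w \<in> Z" for w
      using that assms(1) by (auto simp: r_def poly_prod prod_zero_iff)
    then show ?thesis
      unfolding hankel_row by (simp add: poly_eq_sum_lessThan[OF d, symmetric])
  qed
  ultimately show ?thesis using d leading_coeff_0_iff by (intro exI[of _ "coeff r"]) blast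
qed


section \<open>Zeros in the second variable, counted by contour integrals\<close>

lemma dps_uniformly_close:
  fixes x0 :: complex
  assumes "dps_conv c r" "norm x0 < r" "0 < \<epsilon>"
  shows "\<forall>\<^sub>F x in nhds x0. \<forall>y\<in>cball 0 r. norm (dps c x y - dps c x0 y) < \<epsilon>"
proof -
  let ?f = "\<lambda>p. dps c (fst p) (snd p :: complex)"
  have "uniformly_continuous_on (cball 0 r \<times> cball 0 r) ?f"
    using assms(1) by (intro compact_uniformly_continuous continuous_on_dps compact_Times compact_cball)
  then obtain d where d: "d > 0"
    "\<And>p q. p \<in> cball 0 r \<times> cball 0 r \<Longrightarrow> q \<in> cball 0 r \<times> cball 0 r \<Longrightarrow> dist q p < d \<Longrightarrow>
       dist (?f q) (?f p) < \<epsilon>"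
    unfolding uniformly_continuous_on_def using assms(3) by meson
  have "\<forall>\<^sub>F x in nhds x0. x \<in> ball 0 r \<inter> ball x0 d"
    using assms d(1) by (intro eventually_nhds_in_open) auto
  then show ?thesis
  proof eventually_elim
    case (elim x)
    show ?case
    proof
      fix y :: complex assume y: "y \<in> cball 0 r"
      have "dist (x, y) (x0, y) < d"
        using elim by (simp add: dist_Pair_Pair dist_commute)
      then have "dist (?f (x, y)) (?f (x0, y)) < \<epsilon>"
        using elim y assms by (intro d(2)) auto
      then show "norm (dps c x y - dps c x0 y) < \<epsilon>" by (simp add: dist_norm)
    qed
  qed
qed

lemma continuous_on_dps_right:
  fixes x :: "'a::{real_normed_field,banach}"
  assumes "dps_conv c r" "norm x \<le> r"
  shows "continuous_on (cball 0 r) (dps c x)"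
proof -
  have "continuous_on (cball 0 r) ((\<lambda>p. dps c (fst p) (snd p)) \<circ> (\<lambda>y. (x, y)))"
    using assms
    by (intro continuous_on_compose continuous_intros)
       (auto intro!: continuous_on_subset[OF continuous_on_dps[OF assms(1)]])
  then show ?thesis by (simp add: o_def)
qed

text \<open>At \<open>x0\<close> the modulus has a positive minimum over the compact
  \<open>K\<close>, which exceeds the uniform perturbation for \<open>x\<close> near
  \<open>x0\<close>.\<close>

lemma dps_eventually_nonzero:
  fixes x0 :: complex
  assumes "dps_conv c r" "norm x0 < r" "compact K" "K \<subseteq> cball 0 r"
    and "\<And>y. y \<in> K \<Longrightarrow> dps c x0 y \<noteq> 0"
  shows "\<forall>\<^sub>F x in nhds x0. \<forall>y\<in>K. dps c x y \<noteq> 0"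
proof (cases "K = {}")
  case False
  have "continuous_on K (\<lambda>y. norm (dps c x0 y))"
    using assms by (intro continuous_on_norm continuous_on_subset[OF continuous_on_dps_right]) auto
  then obtain z where z: "z \<in> K" "\<And>y. y \<in> K \<Longrightarrow> norm (dps c x0 z) \<le> norm (dps c x0 y)"
    using continuous_attains_inf[OF assms(3) False] by blast
  have "\<forall>\<^sub>F x in nhds x0. \<forall>y\<in>cball 0 r. norm (dps c x y - dps c x0 y) < norm (dps c x0 z)"
    using assms z by (intro dps_uniformly_close) auto
  then show ?thesis
  proof eventually_elim
    case (elim x)
    show ?case
    proof
      fix y assume "y \<in> K"
      then have "norm (dps c x y - dps c x0 y) < norm (dps c x0 y)"
        using elim z assms(4) by fastforce
      then show "dps c x y \<noteq> 0" by auto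
    qed
  qed
qed simp

lemma holomorphic_on_dps_right:
  fixes x :: complex
  assumes "dps_conv c r" "norm x < r"
  shows "dps c x holomorphic_on ball 0 r"
proof -
  have "(dps c x has_field_derivative dps (dps_dy c) x y) (at y)" if "y \<in> ball 0 r" for y
    using has_field_derivative_dps_dy[of c r x y] assms that by simp
  then show ?thesis unfolding holomorphic_on_open[OF open_ball] by blast
qed

lemma deriv_dps_right:
  fixes x :: complex
  assumes "dps_conv c r" "norm x < r" "norm y < r"
  shows "deriv (dps c x) y = dps (dps_dy c) x y"
  using has_field_derivative_dps_dy[OF assms] by (rule DERIV_imp_deriv)

lemma dps_isolated_zero:
  assumes "dps_conv c r" "c 0 j \<noteq> 0"
  shows "\<forall>\<^sub>F y in at (0::complex). dps c 0 y \<noteq> 0"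
\<comment> \<open>\<open>powser_0_nonzero\<close> asks for a zero at the centre and a nonzero
  coefficient of positive index; a nonzero value at the centre is settled by continuity.\<close>
proof (cases "dps c 0 0 = (0::complex)")
  case True
  then have "j > 0" using assms(2) by (cases j) (auto simp: dps_0_0)
  have "norm (x - 0) < r \<Longrightarrow> (\<lambda>n. of_real (c 0 n) * (x - 0) ^ n) sums dps c 0 x" for x :: complex
    using dps_0_left[OF assms(1), of x] by simp
  then obtain s where "0 < s" "\<And>z. z \<in> cball 0 s - {0} \<Longrightarrow> dps c 0 z \<noteq> (0::complex)"
    by (rule powser_0_nonzero[OF dps_conv_pos[OF assms(1)], where \<xi> = 0 and f = "dps c 0" and m = j])
       (use True \<open>j > 0\<close> assms(2) in auto)
  then show ?thesis
    unfolding eventually_at by (auto intro!: exI[of _ s])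
next
  case False
  have "isCont (dps c 0) (0::complex)"
    using has_field_derivative_dps_dy[OF assms(1), of 0 "0::complex"] dps_conv_pos[OF assms(1)] DERIV_isCont
    by auto
  then have "(dps c 0 \<longlongrightarrow> dps c 0 0) (at (0::complex))" by (simp add: isCont_def)
  then show ?thesis using False tendsto_imp_eventually_ne by blast
qed

definition dps_zeros :: "(nat \<Rightarrow> nat \<Rightarrow> real) \<Rightarrow> real \<Rightarrow> 'a \<Rightarrow> 'a::{real_normed_field,banach} set" where
  "dps_zeros c s x = {y. norm y < s \<and> dps c x y = 0}"

lemma finite_zeros_cball:
  fixes x :: complex
  assumes "dps_conv c r" "norm x < r" "t < r" "norm u < r" "dps c x u \<noteq> 0"
  shows "finite {y\<in>cball 0 t. dps c x y = 0}"
proof (cases "dps c x constant_on ball 0 r")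
  case True
  then obtain k where "\<And>y. y \<in> ball 0 r \<Longrightarrow> dps c x y = k" by (auto simp: constant_on_def)
  then have "{y\<in>cball 0 t. dps c x y = 0} = {}" using assms by auto
  then show ?thesis by (metis finite.emptyI)
next
  case False
  then show ?thesis
    using assms holomorphic_on_dps_right[OF assms(1,2)]
    by (intro holomorphic_compact_finite_zeros[where S = "ball 0 r"]) auto
qed

text \<open>The argument principle weighted with \<open>y ^ n\<close> yields the power sums of the
  zeros inside the circle, each counted with its order. The orders are positive, as the Hankel
  argument requires nonzero weights.\<close>

lemma contour_integral_dps_zeros:
  fixes x :: complex
  assumes c: "dps_conv c r" and x: "norm x < r" and s: "0 < s" "s < r"
    and nz: "\<And>y. norm y = s \<Longrightarrow> dps c x y \<noteq> 0"
  shows "finite (dps_zeros c s x)"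
    and "\<And>w. w \<in> dps_zeros c s x \<Longrightarrow> zorder (dps c x) w > 0"
    and "contour_integral (circlepath 0 s) (\<lambda>y. dps (dps_dy c) x y * y ^ n / dps c x y) =
       2 * pi * \<i> * power_sum (\<lambda>w. of_int (zorder (dps c x) w)) (dps_zeros c s x) n"
proof -
  \<comment> \<open>The argument principle is applied on the slightly larger disc of radius
    \<open>t\<close>; zeros there outside the circle have winding number 0 and drop out.\<close>
  obtain t where t: "s < t" "t < r" using s dense by blast
  define pz where "pz = {w\<in>ball 0 t. dps c x w = 0 \<or> w \<in> {}}"
  have fin: "finite {y\<in>cball 0 t. dps c x y = 0}"
    using finite_zeros_cball[OF c x t(2), of "of_real s"] nz[of "of_real s"] s by simp
  then have fpz: "finite pz" by (rule rev_finite_subset) (auto simp: pz_def)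
  have hol: "dps c x holomorphic_on ball 0 r" by (rule holomorphic_on_dps_right[OF c x])
  show fz: "finite (dps_zeros c s x)"
    by (rule finite_subset[OF _ fin]) (use t in \<open>auto simp: dps_zeros_def\<close>)
  show "zorder (dps c x) w > 0" if w: "w \<in> dps_zeros c s x" for w
  proof -
    have wt: "w \<in> ball 0 t" using w t by (auto simp: dps_zeros_def)
    have "\<forall>\<^sub>F z in at w. z \<in> ball 0 t - ({y\<in>cball 0 t. dps c x y = 0} - {w}) - {w}"
      using wt by (intro eventually_at_in_open open_Diff finite_imp_closed finite_Diff fin) auto
    then have "\<forall>\<^sub>F z in at w. dps c x z \<noteq> 0"
      by eventually_elim auto
    then have "\<exists>\<^sub>F z in at w. dps c x z \<noteq> 0"
      by (intro eventually_frequently) auto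
    then show ?thesis
      using w zorder_pos_iff[OF hol] s by (auto simp: dps_zeros_def)
  qed
  have "contour_integral (circlepath 0 s) (\<lambda>y. deriv (dps c x) y * y ^ n / dps c x y) =
      2 * pi * \<i> * (\<Sum>p\<in>pz. winding_number (circlepath 0 s) p * p ^ n * zorder (dps c x) p)"
    unfolding pz_def
  proof (rule argument_principle[where S = "ball 0 t" and f = "dps c x" and poles = "{}" and h = "\<lambda>y. y ^ n" and g = "circlepath 0 s"])
    show "dps c x holomorphic_on ball 0 t - {}"
      using hol by (rule holomorphic_on_subset) (use t in auto)
    show "path_image (circlepath 0 s) \<subseteq> ball 0 t - {w \<in> ball 0 t. dps c x w = 0 \<or> w \<in> {}}"
      using s t nz by auto
    show "\<forall>z. z \<notin> ball 0 t \<longrightarrow> winding_number (circlepath 0 s) z = 0"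
      using s t by (intro allI impI winding_number_zero_outside[where s = "ball 0 t"]) auto
    show "finite {w \<in> ball 0 t. dps c x w = 0 \<or> w \<in> {}}"
      using fpz by (simp add: pz_def)
  qed (auto intro!: holomorphic_intros)
  also have "(\<Sum>p\<in>pz. winding_number (circlepath 0 s) p * p ^ n * zorder (dps c x) p)
      = (\<Sum>p\<in>dps_zeros c s x. zorder (dps c x) p * p ^ n)"
  proof (rule sum.mono_neutral_cong_right[OF fpz])
    show "dps_zeros c s x \<subseteq> pz" using t by (auto simp: dps_zeros_def pz_def)
    show "\<forall>p\<in>pz - dps_zeros c s x. winding_number (circlepath 0 s) p * p ^ n * zorder (dps c x) p = 0"
    proof
      fix p assume p: "p \<in> pz - dps_zeros c s x"
      then have "p \<notin> cball 0 s" using nz[of p] by (auto simp: pz_def dps_zeros_def)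
      then have "winding_number (circlepath 0 s) p = 0"
        using s by (intro winding_number_zero_outside[where s = "cball 0 s"]) auto
      then show "winding_number (circlepath 0 s) p * p ^ n * zorder (dps c x) p = 0" by simp
    qed
    show "winding_number (circlepath 0 s) p * p ^ n * zorder (dps c x) p = zorder (dps c x) p * p ^ n"
      if "p \<in> dps_zeros c s x" for p :: complex
      using that winding_number_circlepath[of p 0 s] by (simp add: dps_zeros_def)
  qed
  also have "contour_integral (circlepath 0 s) (\<lambda>y. deriv (dps c x) y * y ^ n / dps c x y) =
      contour_integral (circlepath 0 s) (\<lambda>y. dps (dps_dy c) x y * y ^ n / dps c x y)"
    using s by (intro contour_integral_cong) (auto simp: deriv_dps_right[OF c x])
  finally show "contour_integral (circlepath 0 s) (\<lambda>y. dps (dps_dy c) x y * y ^ n / dps c x y) =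
       2 * pi * \<i> * power_sum (\<lambda>w. of_int (zorder (dps c x) w)) (dps_zeros c s x) n"
    by (simp add: power_sum_def)
qed

text \<open>Differentiation under the integral sign. The integrand contains \<open>dps_dy c\<close>,
  whose derivative in \<open>x\<close> is needed on the circle as well, so two radii are inserted
  below \<open>r\<close>, one per differentiation.\<close>

lemma holomorphic_on_contour_integral_dps:
  assumes c: "dps_conv c r" and s: "0 < s" "s < r" and e: "e < r"
    and nz: "\<And>x y. norm x < e \<Longrightarrow> norm y = s \<Longrightarrow> dps c x y \<noteq> (0::complex)"
  shows "(\<lambda>x. contour_integral (circlepath 0 s) (\<lambda>y. dps (dps_dy c) x y * y ^ n / dps c x y))
           holomorphic_on ball 0 e"
proof -
  obtain t where t: "max s e < t" "t < r" using s e dense[of "max s e" r] by auto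
  obtain u where u: "max s e < u" "u < t" using t dense by blast
  have pos: "0 < u" "0 < t" using s u t by auto
  let ?g = "circlepath 0 s" and ?g' = "\<lambda>\<tau>. vector_derivative (circlepath 0 s) (at \<tau>)"
  have cu: "dps_conv c u" "dps_conv (dps_dx c) u" "dps_conv (dps_dy c) u" "dps_conv (dps_dx (dps_dy c)) u"
    "dps_conv (dps_dy c) t"
    using dps_conv_mono[OF c, of u] dps_conv_dx[OF c, of u] dps_conv_dy[OF c, of u] pos u t
      dps_conv_dx[OF dps_conv_dy[OF c, of t], of u] dps_conv_dy[OF c, of t] by auto
  define f where "f x \<tau> = dps (dps_dy c) x (?g \<tau>) * ?g \<tau> ^ n / dps c x (?g \<tau>) * ?g' \<tau>" for x \<tau>
  define fx where "fx x \<tau> = (dps (dps_dx (dps_dy c)) x (?g \<tau>) * ?g \<tau> ^ n * dps c x (?g \<tau>)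
      - dps (dps_dy c) x (?g \<tau>) * ?g \<tau> ^ n * dps (dps_dx c) x (?g \<tau>))
      / (dps c x (?g \<tau>) * dps c x (?g \<tau>)) * ?g' \<tau>" for x \<tau>
  have ng: "norm (?g \<tau>) = s" for \<tau>
    using s by (simp add: circlepath norm_mult)
  have cont: "continuous_on (ball 0 e \<times> cbox 0 1) (\<lambda>p. dps d (fst p) (?g (snd p)))"
    if "dps_conv d u" for d
  proof -
    have "continuous_on (ball 0 e \<times> cbox 0 1)
        ((\<lambda>p. dps d (fst p) (snd p)) \<circ> (\<lambda>p. (fst p, ?g (snd p))))"
      using u s
      by (intro continuous_on_compose continuous_on_subset[OF continuous_on_dps[OF that]])
         (auto simp: circlepath norm_mult intro!: continuous_intros)
    then show ?thesis by (simp add: o_def)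
  qed
  have contg: "continuous_on (ball (0::complex) e \<times> cbox 0 1) (\<lambda>p. ?g (snd p))"
    "continuous_on (ball (0::complex) e \<times> cbox 0 1) (\<lambda>p. ?g' (snd p))"
    unfolding vector_derivative_circlepath by (auto simp: circlepath intro!: continuous_intros)
  have nz': "dps c x (?g \<tau>) \<noteq> 0" if "norm x < e" for x \<tau>
    using nz[OF that ng] .
  have "(\<lambda>x. integral (cbox 0 1) (f x)) holomorphic_on ball 0 e"
  proof (rule leibniz_rule_holomorphic[where f = f and fx = fx])
    fix x :: complex and \<tau> :: real
    assume x: "x \<in> ball 0 e"
    have d1: "((\<lambda>x. dps c x (?g \<tau>)) has_field_derivative dps (dps_dx c) x (?g \<tau>)) (at x within ball 0 e)"
      using x t u s e ng by (intro has_field_derivative_at_within[OF has_field_derivative_dps_dx[OF c]]) auto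
    have d2: "((\<lambda>x. dps (dps_dy c) x (?g \<tau>)) has_field_derivative dps (dps_dx (dps_dy c)) x (?g \<tau>))
        (at x within ball 0 e)"
      using x t u s e ng by (intro has_field_derivative_at_within[OF has_field_derivative_dps_dx[OF cu(5)]]) auto
    show "((\<lambda>x. f x \<tau>) has_field_derivative fx x \<tau>) (at x within ball 0 e)"
      unfolding f_def fx_def
      by (rule DERIV_cmult_right[OF DERIV_divide[OF DERIV_cmult_right[OF d2] d1]])
         (use nz'[of x \<tau>] x in auto)
  next
    fix x :: complex assume x: "x \<in> ball 0 e"
    have "continuous_on (ball 0 e \<times> cbox 0 1) (\<lambda>p. f (fst p) (snd p))"
      unfolding f_def using nz' by (intro continuous_intros cont contg cu) auto
    then have "continuous_on (cbox 0 1) ((\<lambda>p. f (fst p) (snd p)) \<circ> (\<lambda>\<tau>. (x, \<tau>)))"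
      using x by (intro continuous_on_compose continuous_intros) (auto elim!: continuous_on_subset)
    then show "f x integrable_on cbox 0 1"
      by (intro integrable_continuous) (simp add: o_def)
  next
    show "continuous_on (ball 0 e \<times> cbox 0 1) (\<lambda>(x, \<tau>). fx x \<tau>)"
      unfolding fx_def case_prod_unfold using nz' by (intro continuous_intros cont contg cu) auto
  qed auto
  then show ?thesis
    by (simp add: contour_integral_integral f_def[abs_def])
qed

definition zero_set :: "(nat \<Rightarrow> nat \<Rightarrow> real) set \<Rightarrow> real \<Rightarrow> 'a \<Rightarrow> 'a::{real_normed_field,banach} set" where
  "zero_set F s x = {y. norm y < s \<and> (\<exists>c\<in>F. dps c x y = 0)}"

lemma zero_set_Union: "zero_set F s x = (\<Union>c\<in>F. dps_zeros c s x)"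
  by (auto simp: zero_set_def dps_zeros_def)

lemma isolating_radius:
  assumes "finite F" "0 < r" "\<And>c. c \<in> F \<Longrightarrow> dps_conv c r" "\<forall>c\<in>F. \<exists>j. c 0 j \<noteq> 0"
  shows "\<exists>s. 0 < s \<and> s < r \<and> (\<forall>c\<in>F. \<forall>y::complex. 0 < norm y \<and> norm y \<le> s \<longrightarrow> dps c 0 y \<noteq> 0)"
proof -
  have "\<forall>\<^sub>F y in at (0::complex). \<forall>c\<in>F. dps c 0 y \<noteq> 0"
    using assms(1) dps_isolated_zero[OF assms(3)] assms(4) by (intro eventually_ball_finite) blast+
  then obtain d where d: "d > 0" "\<And>y::complex. y \<noteq> 0 \<Longrightarrow> dist y 0 < d \<Longrightarrow> \<forall>c\<in>F. dps c 0 y \<noteq> 0"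
    unfolding eventually_at by blast
  define s where "s = min d r / 2"
  have "0 < s" "s < d" "s < r" using d(1) assms(2) by (auto simp: s_def)
  then show ?thesis using d(2) by (intro exI[of _ s]) auto
qed

text \<open>At \<open>x = 0\<close> the annulus is compact and free of zeros. With
  \<open>\<eta> = s\<close> this clears the circle of integration; with small \<open>\<eta>\<close>
  it forces all zeros to the centre as \<open>x\<close> tends to 0.\<close>

lemma nonvanishing_annulus:
  assumes "finite F" "\<And>c. c \<in> F \<Longrightarrow> dps_conv c r" "0 < r" "s < r"
    and "\<And>c y. c \<in> F \<Longrightarrow> 0 < norm y \<Longrightarrow> norm y \<le> s \<Longrightarrow> dps c 0 y \<noteq> (0::complex)"
    and "0 < \<eta>"
  shows "\<exists>e>0. e < r \<and> (\<forall>c\<in>F. \<forall>x y. norm x < e \<longrightarrow> \<eta> \<le> norm y \<longrightarrow> norm y \<le> s \<longrightarrow> dps c x y \<noteq> (0::complex))"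
proof -
  let ?K = "cball 0 s - ball (0::complex) \<eta>"
  have "\<forall>\<^sub>F x in nhds 0. \<forall>y\<in>?K. dps c x y \<noteq> 0" if "c \<in> F" for c
  proof (rule dps_eventually_nonzero[OF assms(2)[OF that]])
    show "dps c 0 y \<noteq> 0" if "y \<in> ?K" for y
      using assms(5)[OF \<open>c \<in> F\<close>, of y] assms(6) that by (cases "y = 0") auto
  qed (use assms in \<open>auto intro!: compact_diff\<close>)
  then have "\<forall>\<^sub>F x in nhds 0. \<forall>c\<in>F. \<forall>y\<in>?K. dps c x y \<noteq> 0"
    by (intro eventually_ball_finite assms) auto
  then obtain d where d: "d > 0" "\<And>x. dist x 0 < d \<Longrightarrow> \<forall>c\<in>F. \<forall>y\<in>?K. dps c x y \<noteq> 0"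
    unfolding eventually_nhds_metric by blast
  show ?thesis
  proof (intro exI[of _ "min d r / 2"] conjI ballI allI impI)
    fix c and x y :: complex
    assume "c \<in> F" "norm x < min d r / 2" "\<eta> \<le> norm y" "norm y \<le> s"
    then show "dps c x y \<noteq> 0" using d(1) assms(3) d(2)[of x] by auto
  qed (use d assms(3) in auto)
qed

text \<open>The Hankel matrix of the power sums of the zeros has rank equal to the number of distinct
  zeros, and its entries are holomorphic in \<open>x\<close>; hence that number can only drop on a discrete set.\<close>

theorem eventually_card_zero_set:
  assumes F: "finite F" "\<And>c. c \<in> F \<Longrightarrow> dps_conv c r" and s: "0 < s" "s < r" and e: "0 < e" "e < r"
    and nz: "\<And>c x y. c \<in> F \<Longrightarrow> norm x < e \<Longrightarrow> norm y = s \<Longrightarrow> dps c x y \<noteq> (0::complex)"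
  shows "\<And>x::complex. norm x < e \<Longrightarrow> finite (zero_set F s x)"
    and "\<exists>k. \<forall>\<^sub>F x in at (0::complex). card (zero_set F s x) = k"
proof -
  have fin: "finite (dps_zeros c s x)" if "c \<in> F" "norm x < e" for c and x :: complex
    using contour_integral_dps_zeros(1)[OF F(2)[OF that(1)] _ s, of x] nz[OF that] that e by auto
  show finZ: "finite (zero_set F s x)" if "norm x < e" for x :: complex
    unfolding zero_set_Union using fin that F(1) by auto
  \<comment> \<open>Orders are added up over the family, so a zero shared by several members occurs
    once in \<open>zero_set F s x\<close>, with a weight that cannot vanish.\<close>
  define m where "m x w = (\<Sum>c\<in>F. if w \<in> dps_zeros c s x then of_int (zorder (dps c x) w) else 0 :: complex)" for x w
  define p where "p n x = (\<Sum>c\<in>F. contour_integral (circlepath 0 s)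
      (\<lambda>y. dps (dps_dy c) x y * y ^ n / dps c x y) / (2 * pi * \<i>))" for n x
  have hol: "p n holomorphic_on ball 0 e" for n
    unfolding p_def
    by (intro holomorphic_intros holomorphic_on_contour_integral_dps[OF F(2) s e(2)] nz) auto
  have p: "p n x = power_sum (m x) (zero_set F s x) n" if x: "norm x < e" for n x
  proof -
    have "p n x = (\<Sum>c\<in>F. power_sum (\<lambda>w. of_int (zorder (dps c x) w)) (dps_zeros c s x) n)"
      unfolding p_def
    proof (rule sum.cong[OF refl])
      fix c assume c: "c \<in> F"
      have "contour_integral (circlepath 0 s) (\<lambda>y. dps (dps_dy c) x y * y ^ n / dps c x y) =
          2 * pi * \<i> * power_sum (\<lambda>w. of_int (zorder (dps c x) w)) (dps_zeros c s x) n"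
        using x e nz[OF c x] by (intro contour_integral_dps_zeros(3)[OF F(2)[OF c] _ s]) auto
      then show "contour_integral (circlepath 0 s) (\<lambda>y. dps (dps_dy c) x y * y ^ n / dps c x y) / (2 * pi * \<i>)
          = power_sum (\<lambda>w. of_int (zorder (dps c x) w)) (dps_zeros c s x) n"
        by simp
    qed
    also have "\<dots> = (\<Sum>c\<in>F. \<Sum>w\<in>zero_set F s x.
        (if w \<in> dps_zeros c s x then of_int (zorder (dps c x) w) else 0) * w ^ n)"
      unfolding power_sum_def
      by (intro sum.cong refl sum.mono_neutral_cong_left finZ[OF x]) (auto simp: zero_set_Union)
    also have "\<dots> = (\<Sum>w\<in>zero_set F s x. \<Sum>c\<in>F.
        (if w \<in> dps_zeros c s x then of_int (zorder (dps c x) w) else 0) * w ^ n)"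
      by (rule sum.swap)
    finally show ?thesis by (simp add: power_sum_def m_def sum_distrib_right)
  qed
  have m: "1 \<le> Re (m x w)" if x: "norm x < e" and w: "w \<in> zero_set F s x" for x w
  proof -
    have z: "0 < zorder (dps c x) w" if "c \<in> F" "w \<in> dps_zeros c s x" for c
      using x e nz[OF that(1) x] that
      by (intro contour_integral_dps_zeros(2)[OF F(2)[OF that(1)] _ s]) auto
    obtain c0 where c0: "c0 \<in> F" "w \<in> dps_zeros c0 s x" using w by (auto simp: zero_set_Union)
    have "1 \<le> real_of_int (zorder (dps c0 x) w)" using z[OF c0] by linarith
    also have "\<dots> = (if w \<in> dps_zeros c0 s x then real_of_int (zorder (dps c0 x) w) else 0)"
      using c0 by simp
    also have "\<dots> \<le> (\<Sum>c\<in>F. if w \<in> dps_zeros c s x then real_of_int (zorder (dps c x) w) else 0)"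
      using z c0 F(1) by (intro member_le_sum) (auto simp: less_imp_le)
    also have "\<dots> = Re (m x w)" by (auto simp: m_def Re_sum intro!: sum.cong)
    finally show ?thesis .
  qed
  have e2: "0 < e / 2" "e / 2 < e" using e by auto
  \<comment> \<open>\<open>p 0\<close> is bounded on the closed half disc; as every weight has real
    part at least 1, this bounds the number of distinct zeros.\<close>
  have "compact (p 0 ` cball 0 (e / 2))"
    using e by (intro compact_continuous_image holomorphic_on_imp_continuous_on
        holomorphic_on_subset[OF hol]) auto
  then have "bounded (p 0 ` cball 0 (e / 2))" by (rule compact_imp_bounded)
  then obtain C where "\<forall>x\<in>cball 0 (e / 2). norm (p 0 x) \<le> C"
    by (auto simp: bounded_iff)
  then have C: "norm (p 0 x) \<le> C" if "norm x \<le> e / 2" for x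
    using that by auto
  have card_le: "card (zero_set F s x) \<le> nat \<lceil>C\<rceil>" if "norm x \<le> e / 2" for x :: complex
  proof -
    have x: "norm x < e" using that e2 by linarith
    have "real (card (zero_set F s x)) = (\<Sum>w\<in>zero_set F s x. 1)" by simp
    also have "\<dots> \<le> (\<Sum>w\<in>zero_set F s x. Re (m x w))"
      using m[OF x] by (intro sum_mono) auto
    also have "\<dots> = Re (p 0 x)" by (simp add: p[OF x] power_sum_def)
    also have "\<dots> \<le> C" using C[OF that] complex_Re_le_cmod[of "p 0 x"] by linarith
    finally show ?thesis by linarith
  qed
  \<comment> \<open>At a point \<open>w\<close> where the number of zeros is maximal the Hankel
    matrix of that size is injective. Injectivity spreads to a punctured neighbourhood of 0, where
    fewer zeros would give a kernel vector.\<close>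
  define N where "N = (\<lambda>x. card (zero_set F s x)) ` ball (0::complex) (e / 2)"
  have "N \<subseteq> {..nat \<lceil>C\<rceil>}" using card_le by (auto simp: N_def)
  then have N: "finite N" "N \<noteq> {}" using e2 by (auto simp: N_def intro: finite_subset)
  obtain w :: complex where w: "norm w < e / 2" "card (zero_set F s w) = Max N"
    using Max_in[OF N] by (auto simp: N_def)
  have "\<forall>\<^sub>F x in at 0. \<forall>v. (\<forall>i<Max N. (\<Sum>j<Max N. p (i + j) x * v j) = 0) \<longrightarrow> (\<forall>j<Max N. v j = 0)"
  proof (rule eventually_columns_independent[where S = "ball 0 (e / 2)" and w = w])
    show "p (i + j) holomorphic_on ball 0 (e / 2)" for i j
      using hol by (rule holomorphic_on_subset) (use e2 in auto)
    fix v assume v: "\<forall>i<Max N. (\<Sum>j<Max N. p (i + j) w * v j) = 0"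
    have we: "norm w < e" using w e2 by linarith
    have mw: "m w z \<noteq> 0" if "z \<in> zero_set F s w" for z using m[OF we that] by auto
    show "\<forall>j<Max N. v j = 0"
      by (rule hankel_injective[OF finZ[OF we] w(2) mw v[unfolded p[OF we]]])
  qed (use w e2 in auto)
  moreover have "\<forall>\<^sub>F x in at 0. x \<in> ball (0::complex) (e / 2) - {0}"
    using e2 by (intro eventually_at_in_open) auto
  ultimately have "\<forall>\<^sub>F x in at (0::complex). card (zero_set F s x) = Max N"
  proof eventually_elim
    case (elim x)
    then have x: "norm x < e / 2" "norm x < e" using e2 by auto
    have "card (zero_set F s x) \<le> Max N"
      using x N by (intro Max_ge) (auto simp: N_def)
    moreover have "\<not> card (zero_set F s x) < Max N"
      using hankel_kernel[OF finZ[OF x(2)], of "Max N" "m x"] elim(1) unfolding p[OF x(2)] by blast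
    ultimately show ?case by simp
  qed
  then show "\<exists>k. \<forall>\<^sub>F x in at (0::complex). card (zero_set F s x) = k" by blast
qed

text \<open>A zero cannot disappear under a small perturbation, as in Hurwitz's theorem: the modulus
  at the centre falls below its values on the circle, which a holomorphic function without zeros in
  the disc does not allow.\<close>

lemma ball_zero_nearby:
  fixes x0 z :: complex
  assumes c: "dps_conv c r" and x0: "norm x0 < r" and \<eta>: "0 < \<eta>" "cball z \<eta> \<subseteq> ball 0 r"
    and z: "dps c x0 z = 0" and nz: "\<And>y. norm (z - y) = \<eta> \<Longrightarrow> dps c x0 y \<noteq> 0"
  shows "\<forall>\<^sub>F x in nhds x0. \<exists>y. norm (y - z) < \<eta> \<and> dps c x y = 0"
proof -
  have "continuous_on (sphere z \<eta>) (\<lambda>y. norm (dps c x0 y))"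
    using x0 \<eta> by (intro continuous_on_norm continuous_on_subset[OF continuous_on_dps_right[OF c]]) force+
  moreover have "z + of_real \<eta> \<in> sphere z \<eta>" using \<eta> by (simp add: dist_norm)
  ultimately have "\<exists>y0\<in>sphere z \<eta>. \<forall>y\<in>sphere z \<eta>. norm (dps c x0 y0) \<le> norm (dps c x0 y)"
    using \<eta>(1) by (intro continuous_attains_inf) auto
  then obtain y0 where y0: "y0 \<in> sphere z \<eta>"
    "\<And>y. y \<in> sphere z \<eta> \<Longrightarrow> norm (dps c x0 y0) \<le> norm (dps c x0 y)"
    by blast
  \<comment> \<open>The minimum on the circle. With an error below half of it, the perturbed modulus
    is below \<open>\<mu> / 2\<close> at \<open>z\<close> and above it on the circle.\<close>
  define \<mu> where "\<mu> = norm (dps c x0 y0)"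
  have "\<mu> > 0" using nz[of y0] y0(1) by (auto simp: \<mu>_def dist_norm)
  have "\<forall>\<^sub>F x in nhds x0. \<forall>y\<in>cball 0 r. norm (dps c x y - dps c x0 y) < \<mu> / 2"
    using \<open>\<mu> > 0\<close> by (intro dps_uniformly_close c x0) auto
  moreover have "\<forall>\<^sub>F x in nhds x0. x \<in> ball 0 r"
    using x0 by (intro eventually_nhds_in_open) auto
  ultimately show ?thesis
  proof eventually_elim
    case (elim x)
    have "z \<in> cball z \<eta>" using \<eta> by simp
    have sub: "y \<in> cball 0 r" if "y \<in> cball z \<eta>" for y
      using that \<eta>(2) by force
    obtain y where "y \<in> ball z \<eta>" "dps c x y = 0"
    proof (rule holomorphic_contract_to_zero[of z \<eta> "dps c x"])
      show "continuous_on (cball z \<eta>) (dps c x)"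
        using elim sub by (intro continuous_on_subset[OF continuous_on_dps_right[OF c]]) auto
      show "dps c x holomorphic_on ball z \<eta>"
        using elim by (intro holomorphic_on_subset[OF holomorphic_on_dps_right[OF c]])
          (use \<eta>(2) in force)+
      fix y assume y: "norm (z - y) = \<eta>"
      have "norm (dps c x z) < \<mu> / 2"
        using elim(1) sub[OF \<open>z \<in> cball z \<eta>\<close>] z by fastforce
      moreover have "norm (dps c x y - dps c x0 y) < \<mu> / 2"
        using elim(1) sub[of y] y by (auto simp: dist_norm)
      moreover have "\<mu> \<le> norm (dps c x0 y)"
        using y0(2)[of y] y by (auto simp: \<mu>_def dist_norm)
      moreover have "norm (dps c x0 y) \<le> norm (dps c x y) + norm (dps c x y - dps c x0 y)"
        using norm_triangle_ineq4[of "dps c x y" "dps c x y - dps c x0 y"] by simp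
      ultimately show "norm (dps c x z) < norm (dps c x y)" by linarith
    qed (use \<eta> in auto)
    then show ?case by (auto simp: dist_norm norm_minus_commute)
  qed
qed


section \<open>Stability of the zeros where their number is locally constant\<close>

lemma finite_separation:
  fixes Z :: "'a::metric_space set"
  assumes "finite Z"
  shows "\<exists>d>0. \<forall>z\<in>Z. \<forall>w\<in>Z. z \<noteq> w \<longrightarrow> d < dist z w"
proof -
  let ?D = "insert 1 {dist z w |z w. z \<in> Z \<and> w \<in> Z \<and> z \<noteq> w}"
  have "{dist z w |z w. z \<in> Z \<and> w \<in> Z \<and> z \<noteq> w} \<subseteq> (\<lambda>(z, w). dist z w) ` (Z \<times> Z)" by auto
  then have fin: "finite ?D"
    using assms finite_subset[OF _ finite_imageI[OF finite_cartesian_product[OF assms assms]]] by simp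
  then have "0 < Min ?D" by (subst Min_gr_iff) auto
  moreover have "Min ?D \<le> dist z w" if "z \<in> Z" "w \<in> Z" "z \<noteq> w" for z w
    using fin that by (intro Min_le) auto
  ultimately show ?thesis
    by (intro exI[of _ "Min ?D / 2"]) force
qed

text \<open>Near a point where the number of zeros is locally constant every zero moves continuously;
  by symmetry under conjugation the real ones stay real.\<close>

theorem real_zero_set_stable:
  fixes x0 :: real
  assumes F: "\<And>c. c \<in> F \<Longrightarrow> dps_conv c r" and s: "0 < s" "s < r" and x0: "\<bar>x0\<bar> < r"
    and fin: "\<forall>\<^sub>F x in nhds (of_real x0 :: complex). finite (zero_set F s x)"
    and card: "\<forall>\<^sub>F x in nhds (of_real x0 :: complex). card (zero_set F s x) = k"
  shows "\<exists>\<eta>0>0. \<forall>\<eta>. 0 < \<eta> \<and> \<eta> \<le> \<eta>0 \<longrightarrow> (\<forall>\<^sub>F x in nhds x0.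
      (\<forall>z\<in>zero_set F s x0. \<exists>!y. y \<in> zero_set F s x \<and> \<bar>y - z\<bar> < \<eta>) \<and>
      (\<forall>y\<in>zero_set F s x. \<exists>z\<in>zero_set F s x0. \<bar>y - z\<bar> < \<eta>))"
proof -
  define Z where "Z = zero_set F s (of_real x0 :: complex)"
  have fZ: "finite Z" and cZ: "card Z = k"
    using fin card by (auto simp: Z_def dest: eventually_nhds_x_imp_x)
  obtain d1 where d1: "d1 > 0" "\<And>z w. z \<in> Z \<Longrightarrow> w \<in> Z \<Longrightarrow> z \<noteq> w \<Longrightarrow> d1 < dist z w"
    using finite_separation[OF fZ] by blast
  \<comment> \<open>\<open>d1\<close> keeps the discs around the zeros disjoint, \<open>d2\<close>
    keeps them inside the disc of radius \<open>s\<close>, and \<open>d3\<close> keeps those around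
    nonreal zeros off the real axis. The inserted 1 covers empty minima.\<close>
  define d2 where "d2 = Min (insert 1 ((\<lambda>z. s - norm z) ` Z))"
  have d2: "0 < d2" "\<And>z. z \<in> Z \<Longrightarrow> d2 \<le> s - norm z"
    using fZ by (auto simp: d2_def Z_def zero_set_def)
  define d3 where "d3 = Min (insert 1 ((\<lambda>z. \<bar>Im z\<bar>) ` {z\<in>Z. Im z \<noteq> 0}))"
  have d3: "0 < d3" "\<And>z. z \<in> Z \<Longrightarrow> Im z \<noteq> 0 \<Longrightarrow> d3 \<le> \<bar>Im z\<bar>"
    using fZ by (auto simp: d3_def)
  define \<eta>0 where "\<eta>0 = min (d1 / 2) (min (d2 / 2) d3)"
  have \<eta>0: "0 < \<eta>0" "2 * \<eta>0 \<le> d1" "\<eta>0 < d2" "\<eta>0 \<le> d3"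
    using d1 d2 d3 by (auto simp: \<eta>0_def)
  have main: "\<forall>\<^sub>F x in nhds x0.
      (\<forall>z\<in>zero_set F s x0. \<exists>!y. y \<in> zero_set F s x \<and> \<bar>y - z\<bar> < \<eta>) \<and>
      (\<forall>y\<in>zero_set F s x. \<exists>z\<in>zero_set F s x0. \<bar>y - z\<bar> < \<eta>)" if \<eta>: "0 < \<eta>" "\<eta> \<le> \<eta>0" for \<eta>
  proof -
    have ex: "\<forall>\<^sub>F x in nhds (of_real x0). \<exists>y\<in>zero_set F s x. norm (y - z) < \<eta>" if z: "z \<in> Z" for z
    proof -
      obtain c where c: "c \<in> F" "dps c (of_real x0) z = 0" "norm z < s"
        using z by (auto simp: Z_def zero_set_def)
      have in_s: "norm y < s" if "norm (z - y) \<le> \<eta>" for y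
      proof -
        have "norm y \<le> norm z + norm (z - y)"
          using norm_triangle_ineq4[of z "z - y"] by simp
        then show ?thesis using that \<eta> \<eta>0 d2(2)[OF z] by linarith
      qed
      have "\<forall>\<^sub>F x in nhds (of_real x0). \<exists>y. norm (y - z) < \<eta> \<and> dps c x y = 0"
      proof (rule ball_zero_nearby[OF F[OF c(1)] _ \<eta>(1) _ c(2)])
        show "cball z \<eta> \<subseteq> ball 0 r" using in_s s by (force simp: dist_norm)
        fix y assume y: "norm (z - y) = \<eta>"
        show "dps c (of_real x0) y \<noteq> 0"
        proof
          assume "dps c (of_real x0) y = 0"
          then have "y \<in> Z" using in_s[of y] y c by (auto simp: Z_def zero_set_def)
          moreover have "y \<noteq> z" using y \<eta> by auto
          ultimately show False using d1(2)[OF z, of y] y \<eta> \<eta>0 by (auto simp: dist_norm)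
        qed
      qed (use x0 in auto)
      then show ?thesis
      proof eventually_elim
        case (elim x)
        then obtain y where "norm (y - z) < \<eta>" "dps c x y = 0" by blast
        then show ?case using in_s[of y] c(1)
          by (intro bexI[of _ y]) (auto simp: zero_set_def norm_minus_commute)
      qed
    qed
    have "\<forall>\<^sub>F x in nhds (of_real x0). (\<forall>z\<in>Z. \<exists>y\<in>zero_set F s x. norm (y - z) < \<eta>) \<and>
        finite (zero_set F s x) \<and> card (zero_set F s x) = k"
      using fin card by (intro eventually_conj eventually_ball_finite fZ ballI ex)
    moreover have "filterlim (of_real :: real \<Rightarrow> complex) (nhds (of_real x0)) (nhds x0)"
      by (intro tendsto_of_real filterlim_ident)
    ultimately have "\<forall>\<^sub>F x in nhds x0. (\<forall>z\<in>Z. \<exists>y\<in>zero_set F s (of_real x :: complex). norm (y - z) < \<eta>) \<and>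
        finite (zero_set F s (of_real x :: complex)) \<and> card (zero_set F s (of_real x :: complex)) = k"
      by (rule eventually_compose_filterlim)
    moreover have "\<forall>\<^sub>F x in nhds x0. x \<in> ball 0 r"
      using x0 by (intro eventually_nhds_in_open) auto
    ultimately show ?thesis
    proof eventually_elim
      case (elim x)
      let ?W = "zero_set F s (of_real x :: complex)"
      obtain h where h: "\<And>z. z \<in> Z \<Longrightarrow> h z \<in> ?W \<and> norm (h z - z) < \<eta>"
        using elim(1) by metis
      have sep: "z = w" if "z \<in> Z" "w \<in> Z" "norm (y - z) < \<eta>" "norm (y - w) < \<eta>" for z w y
      proof (rule ccontr)
        assume "z \<noteq> w"
        then have "d1 < norm (z - w)" using d1(2)[OF that(1,2)] by (simp add: dist_norm)
        also have "\<dots> \<le> norm (y - w) + norm (y - z)"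
          using norm_triangle_ineq4[of "y - w" "y - z"] by simp
        finally show False using that \<eta> \<eta>0 by linarith
      qed
      \<comment> \<open>Each disc contains a zero over \<open>x\<close>, the discs are disjoint, and
        there are \<open>k\<close> zeros before and after: hence exactly one per disc.\<close>
      have "inj_on h Z"
      proof (rule inj_onI)
        fix z w assume "z \<in> Z" "w \<in> Z" "h z = h w"
        then show "z = w" using h[of z] h[of w] sep[of z w "h z"] by simp
      qed
      then have "card (h ` Z) = card ?W" using elim cZ by (simp add: card_image)
      then have surj: "h ` Z = ?W"
        using h elim by (intro card_subset_eq) auto
      have near: "\<exists>z\<in>Z. norm (y - z) < \<eta>" if "y \<in> ?W" for y
        using that h unfolding surj[symmetric] by blast
      have uniq: "y = y'" if "y \<in> ?W" "y' \<in> ?W" "z \<in> Z" "norm (y - z) < \<eta>" "norm (y' - z) < \<eta>" for y y' z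
      proof -
        obtain w w' where w: "w \<in> Z" "y = h w" "w' \<in> Z" "y' = h w'"
          using \<open>y \<in> ?W\<close> \<open>y' \<in> ?W\<close> unfolding surj[symmetric] by blast
        have "w = z" "w' = z" using sep[of w z y] sep[of w' z y'] h[of w] h[of w'] w that by auto
        then show ?thesis using w by simp
      qed
      have xr: "norm (of_real x :: complex) \<le> r" "\<bar>x\<bar> \<le> r" using elim by auto
      have real_iff: "of_real y \<in> zero_set F s (of_real t :: complex) \<longleftrightarrow> y \<in> zero_set F s t"
        if "\<bar>t\<bar> \<le> r" for y t
      proof (cases "\<bar>y\<bar> < s")
        case True
        then have "dps c (of_real t) (of_real y) = (of_real (dps c t y) :: complex)" if "c \<in> F" for c
          using s by (intro dps_of_real[OF F[OF that] \<open>\<bar>t\<bar> \<le> r\<close>]) auto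
        then show ?thesis by (auto simp: zero_set_def)
      qed (auto simp: zero_set_def)
      show ?case
      proof (intro conjI ballI)
        fix z assume z: "z \<in> zero_set F s x0"
        then have zZ: "of_real z \<in> Z" unfolding Z_def using real_iff x0 by auto
        obtain y where y: "y \<in> ?W" "norm (y - of_real z) < \<eta>" using h[OF zZ] by blast
        \<comment> \<open>The conjugate zero is equally close to the real \<open>z\<close>, so by
          uniqueness it is the same zero.\<close>
        have "cnj y \<in> ?W"
          using y(1) dps_cnj[OF F xr(1), of _ y] s by (auto simp: zero_set_def)
        moreover have "norm (cnj y - of_real z) < \<eta>"
          using y(2) complex_mod_cnj[of "y - of_real z"] by simp
        ultimately have "cnj y = y" using uniq y zZ by blast
        then have yr: "y = of_real (Re y)" by (simp add: complex_eq_iff)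
        have "Re y \<in> zero_set F s x" using y(1) yr real_iff[OF xr(2)] by metis
        moreover have "\<bar>Re y - z\<bar> < \<eta>" using y(2) yr by (metis norm_of_real of_real_diff)
        moreover have "t = Re y" if "t \<in> zero_set F s x" "\<bar>t - z\<bar> < \<eta>" for t
        proof -
          have "of_real t \<in> ?W" "norm (of_real t - of_real z :: complex) < \<eta>"
            using that real_iff[OF xr(2)] by (auto simp flip: of_real_diff)
          then have "of_real t = y" using uniq y zZ by blast
          then show ?thesis by auto
        qed
        ultimately show "\<exists>!y. y \<in> zero_set F s x \<and> \<bar>y - z\<bar> < \<eta>" by blast
      next
        fix y assume "y \<in> zero_set F s x"
        then have "of_real y \<in> ?W" using real_iff[OF xr(2)] by blast
        then obtain z where z: "z \<in> Z" "norm (of_real y - z) < \<eta>" using near by blast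
        have "Im z = 0"
        proof (rule ccontr)
          assume "Im z \<noteq> 0"
          then have "d3 \<le> \<bar>Im z\<bar>" using d3(2) z by blast
          also have "\<dots> \<le> norm (of_real y - z)" using abs_Im_le_cmod[of "of_real y - z"] by simp
          finally show False using z \<eta> \<eta>0 by linarith
        qed
        then have zr: "z = of_real (Re z)" by (simp add: complex_eq_iff)
        have "Re z \<in> zero_set F s x0"
          using z(1) zr real_iff[of x0] x0 unfolding Z_def by (metis less_imp_le)
        moreover have "\<bar>y - Re z\<bar> < \<eta>" using z(2) zr by (metis norm_of_real of_real_diff)
        ultimately show "\<exists>z\<in>zero_set F s x0. \<bar>y - z\<bar> < \<eta>" by blast
      qed
    qed
  qed
  then show ?thesis using \<eta>0(1) by blast
qed

section \<open>Continuous enumeration of the real zeros\<close>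

text \<open>The stability just proved, stated for any set-valued function: asking for all small
  \<open>\<eta>\<close> gives continuity of the points of \<open>R x\<close>, and uniqueness keeps
  them from splitting or merging.\<close>

definition tracked :: "(real \<Rightarrow> real set) \<Rightarrow> real \<Rightarrow> bool" where
  "tracked R x0 \<longleftrightarrow> (\<exists>\<eta>0>0. \<forall>\<eta>. 0 < \<eta> \<and> \<eta> \<le> \<eta>0 \<longrightarrow> (\<forall>\<^sub>F x in nhds x0.
      (\<forall>z\<in>R x0. \<exists>!y. y \<in> R x \<and> \<bar>y - z\<bar> < \<eta>) \<and>
      (\<forall>y\<in>R x. \<exists>z\<in>R x0. \<bar>y - z\<bar> < \<eta>)))"

text \<open>Off the centre the number of complex zeros is constant, so the real ones are tracked. At
  the centre itself they may merge, and only their convergence to 0 is recorded.\<close>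

lemma real_zeros_local:
  assumes "finite F" "0 < r" and Fc: "\<forall>c\<in>F. dps_conv c r"
    and nz: "\<forall>c\<in>F. \<exists>j. c 0 j \<noteq> 0"
  obtains s e where "0 < s" "s < r" "0 < e" "e < r"
    "\<And>x::real. \<bar>x\<bar> < e \<Longrightarrow> finite (zero_set F s x)"
    "\<And>x. 0 < \<bar>x\<bar> \<Longrightarrow> \<bar>x\<bar> < e \<Longrightarrow> tracked (zero_set F s) x"
    "\<And>\<eta>. 0 < \<eta> \<Longrightarrow> \<exists>d>0. \<forall>x::real. \<bar>x\<bar> < d \<longrightarrow> (\<forall>y\<in>zero_set F s x. \<bar>y\<bar> < \<eta>)"
proof -
  have F: "dps_conv c r" if "c \<in> F" for c using Fc that by blast
  obtain s where s: "0 < s" "s < r"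
    "\<And>c y. c \<in> F \<Longrightarrow> 0 < norm y \<Longrightarrow> norm y \<le> s \<Longrightarrow> dps c 0 y \<noteq> (0::complex)"
    using isolating_radius[OF assms(1,2) F nz] by blast
  have ann: "\<exists>d>0. d < r \<and> (\<forall>c\<in>F. \<forall>x y. norm x < d \<longrightarrow> \<eta> \<le> norm y \<longrightarrow> norm y \<le> s \<longrightarrow> dps c x y \<noteq> (0::complex))"
    if "0 < \<eta>" for \<eta>
    using that s by (intro nonvanishing_annulus assms(1,2) F) auto
  obtain e1 where e1: "0 < e1" "e1 < r"
    "\<And>c x y. c \<in> F \<Longrightarrow> norm x < e1 \<Longrightarrow> s \<le> norm y \<Longrightarrow> norm y \<le> s \<Longrightarrow> dps c x y \<noteq> (0::complex)"
    using ann[OF s(1)] by blast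
  have e1': "dps c x y \<noteq> 0" if "c \<in> F" "norm x < e1" "norm y = s" for c and x y :: complex
    using e1(3)[OF that(1,2), of y] that(3) by simp
  have ev: "\<And>x::complex. norm x < e1 \<Longrightarrow> finite (zero_set F s x)"
    "\<exists>k. \<forall>\<^sub>F x in at (0::complex). card (zero_set F s x) = k"
    using eventually_card_zero_set[where F = F and r = r and s = s and e = e1] assms(1) F s(1,2) e1(1,2) e1'
    by blast+
  obtain k where "\<forall>\<^sub>F x in at (0::complex). card (zero_set F s x) = k" using ev(2) by blast
  then obtain e2 where e2: "e2 > 0"
    "\<And>x::complex. x \<noteq> 0 \<Longrightarrow> norm x < e2 \<Longrightarrow> card (zero_set F s x) = k"
    unfolding eventually_at by auto
  define e where "e = min e1 e2"
  have e: "0 < e" "e \<le> e1" "e \<le> e2" using e1 e2 by (auto simp: e_def)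
  have to_complex: "of_real y \<in> zero_set F s (of_real x :: complex)" if "y \<in> zero_set F s x" "\<bar>x\<bar> < r" for x y :: real
  proof -
    have "dps c (of_real x) (of_real y) = (of_real (dps c x y) :: complex)" if "c \<in> F" for c
      using s \<open>y \<in> _\<close> \<open>\<bar>x\<bar> < r\<close> by (intro dps_of_real[OF F[OF that]]) (auto simp: zero_set_def)
    then show ?thesis using that by (auto simp: zero_set_def)
  qed
  show thesis
  proof (rule that[of s e])
    show "finite (zero_set F s x)" if "\<bar>x\<bar> < e" for x :: real
    proof (rule inj_on_finite[of of_real])
      show "of_real ` zero_set F s x \<subseteq> zero_set F s (of_real x :: complex)"
        using to_complex that e e1 by auto
      show "finite (zero_set F s (of_real x :: complex))"
        using that e by (intro ev(1)) auto
    qed (simp add: inj_on_def)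
    show "tracked (zero_set F s) x" if x: "0 < \<bar>x\<bar>" "\<bar>x\<bar> < e" for x
      unfolding tracked_def
    proof (rule real_zero_set_stable[OF F s(1,2)])
      have "\<forall>\<^sub>F z in nhds (of_real x). z \<in> ball (0::complex) e - {0}"
        using x by (intro eventually_nhds_in_open) auto
      then show "\<forall>\<^sub>F z in nhds (of_real x :: complex). finite (zero_set F s z)"
        "\<forall>\<^sub>F z in nhds (of_real x :: complex). card (zero_set F s z) = k"
        by (eventually_elim, use e in \<open>auto intro: ev(1) e2(2)\<close>)+
    qed (use x e e1 in auto)
    show "\<exists>d>0. \<forall>x::real. \<bar>x\<bar> < d \<longrightarrow> (\<forall>y\<in>zero_set F s x. \<bar>y\<bar> < \<eta>)" if \<eta>: "0 < \<eta>" for \<eta>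
    proof -
      obtain d where d: "d > 0" "d < r"
        "\<And>c x y. c \<in> F \<Longrightarrow> norm x < d \<Longrightarrow> \<eta> \<le> norm y \<Longrightarrow> norm y \<le> s \<Longrightarrow> dps c x y \<noteq> (0::complex)"
        using ann[OF \<eta>] by blast
      have "\<bar>y\<bar> < \<eta>" if "\<bar>x\<bar> < d" "y \<in> zero_set F s x" for x y :: real
      proof (rule ccontr)
        assume "\<not> \<bar>y\<bar> < \<eta>"
        have "(of_real y :: complex) \<in> zero_set F s (of_real x)"
          using to_complex that d by auto
        then show False using d(3)[of _ "of_real x" "of_real y"] that \<open>\<not> \<bar>y\<bar> < \<eta>\<close>
          by (auto simp: zero_set_def)
      qed
      then show ?thesis using d(1) by blast
    qed
  qed (use s e e1 in auto)
qed

text \<open>Within half the separation of the points of \<open>R x0\<close>, moving each point to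
  its neighbour in \<open>R x\<close> preserves the order, so the sorted lists correspond entry by
  entry.\<close>

lemma tracked_sorted_list:
  assumes t: "tracked R x0" and fin: "finite (R x0)" and "0 < \<epsilon>"
  shows "\<forall>\<^sub>F x in nhds x0. \<exists>h. sorted_list_of_set (R x) = map h (sorted_list_of_set (R x0)) \<and>
      (\<forall>z\<in>R x0. \<bar>h z - z\<bar> < \<epsilon>)"
proof -
  obtain \<eta>0 where \<eta>0: "\<eta>0 > 0" "\<And>\<eta>. 0 < \<eta> \<Longrightarrow> \<eta> \<le> \<eta>0 \<Longrightarrow> \<forall>\<^sub>F x in nhds x0.
      (\<forall>z\<in>R x0. \<exists>!y. y \<in> R x \<and> \<bar>y - z\<bar> < \<eta>) \<and>
      (\<forall>y\<in>R x. \<exists>z\<in>R x0. \<bar>y - z\<bar> < \<eta>)"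
    using t unfolding tracked_def by blast
  obtain d where d: "d > 0" "\<And>z w. z \<in> R x0 \<Longrightarrow> w \<in> R x0 \<Longrightarrow> z \<noteq> w \<Longrightarrow> d < dist z w"
    using finite_separation[OF fin] by blast
  define \<eta> where "\<eta> = min \<epsilon> (min \<eta>0 (d / 2))"
  have \<eta>: "0 < \<eta>" "\<eta> \<le> \<epsilon>" "\<eta> \<le> \<eta>0" "2 * \<eta> \<le> d" using \<eta>0(1) d(1) assms(3) by (auto simp: \<eta>_def)
  show ?thesis using \<eta>0(2)[OF \<eta>(1,3)]
  proof eventually_elim
    case (elim x)
    obtain h where h: "\<And>z. z \<in> R x0 \<Longrightarrow> h z \<in> R x \<and> \<bar>h z - z\<bar> < \<eta>"
      using elim by metis
    have mono: "h z < h w" if "z \<in> R x0" "w \<in> R x0" "z < w" for z w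
      using h[OF that(1)] h[OF that(2)] d(2)[OF that(1,2)] that \<eta>(4) by (auto simp: dist_real_def)
    have im: "h ` R x0 = R x"
    proof
      show "R x \<subseteq> h ` R x0"
      proof
        fix y assume y: "y \<in> R x"
        then obtain z where "z \<in> R x0" "\<bar>y - z\<bar> < \<eta>" using elim by blast
        then have "y = h z" using elim h y by blast
        then show "y \<in> h ` R x0" using \<open>z \<in> R x0\<close> by blast
      qed
    qed (use h in blast)
    let ?l = "sorted_list_of_set (R x0)"
    have "sorted_wrt (<) (map h ?l)"
      unfolding sorted_wrt_map
      using strict_sorted_list_of_set[of "R x0"]
      by (rule sorted_wrt_mono_rel[rotated]) (use mono fin in auto)
    moreover have "set (map h ?l) = R x" using im fin by simp
    ultimately have "map h ?l = sorted_list_of_set (R x)"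
      using im fin by (metis finite_set sorted_list_of_set.idem_if_sorted_distinct strict_sorted_iff)
    then show ?case using h \<eta>(2) by (intro exI[of _ h]) force
  qed
qed

text \<open>The number of points is locally constant, hence constant on the connected
  \<open>I\<close>; the \<open>i\<close>-th smallest point is then a continuous function of
  \<open>x\<close>.\<close>

lemma tracked_levels:
  assumes I: "connected I" and fin: "\<And>x. x \<in> I \<Longrightarrow> finite (R x)" and t: "\<And>x. x \<in> I \<Longrightarrow> tracked R x"
    and bd: "\<And>x. x \<in> I \<Longrightarrow> R x \<subseteq> {y1<..<y2}" and "y1 < y2"
  obtains n :: nat and \<phi> :: "nat \<Rightarrow> real \<Rightarrow> real" where "0 < n"
    "\<And>i. i \<le> n \<Longrightarrow> continuous_on I (\<phi> i)"
    "\<And>x. x \<in> I \<Longrightarrow> \<phi> 0 x = y1" "\<And>x. x \<in> I \<Longrightarrow> \<phi> n x = y2"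
    "\<And>x i. x \<in> I \<Longrightarrow> i < n \<Longrightarrow> \<phi> i x < \<phi> (Suc i) x"
    "\<And>x. x \<in> I \<Longrightarrow> R x = {\<phi> i x |i. 0 < i \<and> i < n}"
proof (cases "I = {}")
  case True
  then show thesis by (intro that[of 1 "\<lambda>_ _. 0"]) auto
next
  case False
  then obtain w where w: "w \<in> I" by blast
  have card: "card (R x) = card (R w)" if "x \<in> I" for x
  proof (rule connected_local_const[OF I that w], intro ballI)
    fix u assume u: "u \<in> I"
    have "\<forall>\<^sub>F v in nhds u. card (R v) = card (R u)"
      using tracked_sorted_list[OF t[OF u] fin[OF u] zero_less_one]
      by eventually_elim (metis length_map length_sorted_list_of_set)
    then show "\<forall>\<^sub>F v in at u within I. card (R u) = card (R v)"
      by (subst (asm) eq_commute) (auto simp: eventually_at_filter elim: eventually_mono)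
  qed
  define m where "m = card (R w)"
  define l where "l x = sorted_list_of_set (R x)" for x
  \<comment> \<open>\<open>y1\<close> and \<open>y2\<close> act as sentinels: the points of
    \<open>R x\<close> are the levels 1 to \<open>m\<close>, and the number of gaps is
    \<open>n = Suc m\<close>.\<close>
  define \<phi> where "\<phi> i x = (y1 # l x @ [y2]) ! i" for i x
  have len: "length (l x) = m" if "x \<in> I" for x
    using card[OF that] by (simp add: l_def m_def)
  have set_l: "set (l x) = R x" if "x \<in> I" for x
    using fin[OF that] by (simp add: l_def)
  have \<phi>: "\<phi> 0 x = y1" "i < m \<Longrightarrow> \<phi> (Suc i) x = l x ! i" "\<phi> (Suc m) x = y2" if "x \<in> I" for x i
    using len[OF that] by (auto simp: \<phi>_def nth_append)
  have cont_l: "continuous_on I (\<lambda>x. l x ! i)" if i: "i < m" for i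
    unfolding continuous_on_def
  proof
    fix u assume u: "u \<in> I"
    show "((\<lambda>x. l x ! i) \<longlongrightarrow> l u ! i) (at u within I)"
    proof (rule tendstoI)
      fix \<epsilon> :: real assume "0 < \<epsilon>"
      have "\<forall>\<^sub>F x in nhds u. dist (l x ! i) (l u ! i) < \<epsilon>"
        using tracked_sorted_list[OF t[OF u] fin[OF u] \<open>0 < \<epsilon>\<close>]
      proof eventually_elim
        case (elim x)
        then obtain h where h: "l x = map h (l u)" "\<And>z. z \<in> R u \<Longrightarrow> \<bar>h z - z\<bar> < \<epsilon>"
          unfolding l_def by blast
        have "l u ! i \<in> R u" using i len[OF u] set_l[OF u] nth_mem by metis
        then show ?case using h i len[OF u] by (simp add: dist_real_def)
      qed
      then show "\<forall>\<^sub>F x in at u within I. dist (l x ! i) (l u ! i) < \<epsilon>"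
        by (auto simp: eventually_at_filter elim: eventually_mono)
    qed
  qed
  have sorted: "sorted_wrt (<) (y1 # l x @ [y2])" if "x \<in> I" for x
    using bd[OF that] set_l[OF that] \<open>y1 < y2\<close>
    by (auto simp: sorted_wrt_append l_def subset_iff)
  show thesis
  proof (rule that[of "Suc m" \<phi>])
    fix i assume i: "i \<le> Suc m"
    consider "i = 0" | "i = Suc m" | j where "i = Suc j" "j < m"
      using i by (cases i) (auto simp: le_less)
    then show "continuous_on I (\<phi> i)"
    proof cases
      case 3
      then show ?thesis using cont_l[of j] \<phi>(2) by (simp cong: continuous_on_cong)
    qed (use \<phi> in \<open>simp_all cong: continuous_on_cong\<close>)
  next
    fix x assume x: "x \<in> I"
    show "R x = {\<phi> i x |i. 0 < i \<and> i < Suc m}"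
    proof -
      have "{\<phi> i x |i. 0 < i \<and> i < Suc m} = {l x ! i |i. i < m}"
      proof safe
        fix i assume "0 < i" "i < Suc m"
        then show "\<exists>j. \<phi> i x = l x ! j \<and> j < m"
          using \<phi>(2)[OF x, of "i - 1"] by (intro exI[of _ "i - 1"]) auto
      next
        fix j assume "j < m"
        then show "\<exists>i. l x ! j = \<phi> i x \<and> 0 < i \<and> i < Suc m"
          using \<phi>(2)[OF x] by (intro exI[of _ "Suc j"]) auto
      qed
      then show ?thesis using set_l[OF x] len[OF x] by (simp add: set_conv_nth)
    qed
    fix i assume "i < Suc m"
    then show "\<phi> i x < \<phi> (Suc i) x"
      unfolding \<phi>_def using len[OF x]
      by (intro sorted_wrt_nth_less[OF sorted[OF x]]) auto
  qed (use \<phi> in auto)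
qed

text \<open>The width \<open>e\<close> is chosen after the heights, because the zeros must stay
  between \<open>y1\<close> and \<open>y2\<close>. The strict order of the levels is claimed only on
  the open interval: an endpoint may be the centre, where the inner levels meet.\<close>

theorem local_levels:
  assumes "finite F" "0 < r" "\<forall>c\<in>F. dps_conv c r" "\<forall>c\<in>F. \<exists>j. c 0 j \<noteq> 0"
  shows "\<exists>s>0. s < r \<and> (\<forall>y1 y2. - s < y1 \<and> y1 < 0 \<and> 0 < y2 \<and> y2 < s \<longrightarrow> (\<exists>e>0. e < r \<and>
      (\<forall>c d. - e < c \<and> c < d \<and> d < e \<and> (d \<le> 0 \<or> 0 \<le> c) \<longrightarrow>
        (\<exists>n \<phi>. 0 < n \<and> (\<forall>i\<le>n. continuous_on {c..d} (\<phi> i)) \<and>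
          (\<forall>x. c < x \<and> x < d \<longrightarrow> \<phi> 0 x = y1 \<and> \<phi> n x = y2 \<and> (\<forall>i<n. \<phi> i x < \<phi> (Suc i) x) \<and>
             {y. y1 < y \<and> y < y2 \<and> (\<exists>f\<in>F. dps f x y = 0)} = {\<phi> i x |i. 0 < i \<and> i < (n::nat)})))))"
proof -
  obtain s e where s: "0 < s" "s < r" and e: "0 < e" "e < r"
    and fin: "\<And>x::real. \<bar>x\<bar> < e \<Longrightarrow> finite (zero_set F s x)"
    and tr: "\<And>x. 0 < \<bar>x\<bar> \<Longrightarrow> \<bar>x\<bar> < e \<Longrightarrow> tracked (zero_set F s) x"
    and small: "\<And>\<eta>. 0 < \<eta> \<Longrightarrow> \<exists>d>0. \<forall>x::real. \<bar>x\<bar> < d \<longrightarrow> (\<forall>y\<in>zero_set F s x. \<bar>y\<bar> < \<eta>)"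
    using real_zeros_local[OF assms(1-4)] by metis
  show ?thesis
  proof (rule exI[of _ s], intro conjI allI impI s)
    fix y1 y2 assume "- s < y1 \<and> y1 < 0 \<and> 0 < y2 \<and> y2 < s"
    then have y: "- s < y1" "y1 < 0" "0 < y2" "y2 < s" by auto
    have "0 < min (- y1) y2" using y by simp
    then obtain d where d: "d > 0" "\<And>x y. \<bar>x\<bar> < d \<Longrightarrow> y \<in> zero_set F s x \<Longrightarrow> \<bar>y\<bar> < min (- y1) y2"
      using small by blast
    let ?e = "min e d"
    have "\<exists>n \<phi>. 0 < n \<and> (\<forall>i\<le>n. continuous_on {c..d} (\<phi> i)) \<and>
          (\<forall>x. c < x \<and> x < d \<longrightarrow> \<phi> 0 x = y1 \<and> \<phi> n x = y2 \<and> (\<forall>i<n. \<phi> i x < \<phi> (Suc i) x) \<and>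
             {y. y1 < y \<and> y < y2 \<and> (\<exists>f\<in>F. dps f x y = 0)} = {\<phi> i x |i. 0 < i \<and> i < (n::nat)})"
      if cd: "- ?e < c" "c < d" "d < ?e" "d \<le> 0 \<or> 0 \<le> c" for c d
    proof -
      define I where "I = {c..d} - {0}"
      have I: "\<bar>x\<bar> < e" "\<bar>x\<bar> < d'" "0 < \<bar>x\<bar>" if "x \<in> I" "d' = ?e" for x d'
        using that cd by (auto simp: I_def)
      \<comment> \<open>The centre can only be an endpoint of the interval, so its removal does not
        disconnect it.\<close>
      have "I = {c..d} \<or> I = {c<..d} \<or> I = {c..<d}"
        using cd by (cases "c = 0"; cases "d = 0") (auto simp: I_def)
      then have "connected I" by (auto simp: connected_Ioc connected_Ico)
      have "- e < c" "d < e" using cd by auto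
      have fI: "finite (zero_set F s x)" "tracked (zero_set F s) x" "zero_set F s x \<subseteq> {y1<..<y2}" if "x \<in> I" for x
        using I[OF that refl] fin tr d(2)[of x] by (auto simp: abs_less_iff)
      obtain n \<phi> where n: "0 < n" "\<And>i. i \<le> n \<Longrightarrow> continuous_on I (\<phi> i)"
        "\<And>x. x \<in> I \<Longrightarrow> \<phi> 0 x = y1" "\<And>x. x \<in> I \<Longrightarrow> \<phi> n x = y2"
        "\<And>x i. x \<in> I \<Longrightarrow> i < n \<Longrightarrow> \<phi> i x < \<phi> (Suc i) x"
        "\<And>x. x \<in> I \<Longrightarrow> zero_set F s x = {\<phi> i x |i. 0 < i \<and> i < n}"
        by (rule tracked_levels[OF \<open>connected I\<close> fI]) (use y in auto)
      \<comment> \<open>Inner levels take the value 0 at the centre, the limit of all zeros; bottom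
        and top remain constant.\<close>
      define \<psi> where "\<psi> i x = (if x \<noteq> 0 then \<phi> i x else if i = 0 then y1 else if i = n then y2 else 0)" for i x
      have "continuous_on {c..d} (\<psi> i)" if i: "i \<le> n" for i
        unfolding continuous_on_def
      proof
        fix u assume u: "u \<in> {c..d}"
        show "(\<psi> i \<longlongrightarrow> \<psi> i u) (at u within {c..d})"
        proof (cases "u = 0")
          case False
          then have uI: "u \<in> I" using u by (simp add: I_def)
          have "(\<phi> i \<longlongrightarrow> \<phi> i u) (at u within I)" using n(2)[OF i] uI by (auto simp: continuous_on_def)
          moreover have "at u within I = at u within {c..d}"
            unfolding I_def using False by (intro at_within_nhd[where S = "- {0}"]) auto
          moreover have "\<forall>\<^sub>F x in nhds u. x \<in> - {0}"
            using False by (intro eventually_nhds_in_open) auto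
          then have "\<forall>\<^sub>F x in at u within {c..d}. \<phi> i x = \<psi> i x"
            unfolding eventually_at_filter by eventually_elim (simp add: \<psi>_def)
          ultimately show ?thesis using False by (auto simp: \<psi>_def intro: Lim_transform_eventually)
        next
          case True
          show ?thesis
          proof (rule tendstoI)
            fix \<epsilon> :: real assume \<epsilon>: "0 < \<epsilon>"
            obtain \<delta> where \<delta>: "\<delta> > 0" "\<And>x y. \<bar>x\<bar> < \<delta> \<Longrightarrow> y \<in> zero_set F s x \<Longrightarrow> \<bar>y\<bar> < \<epsilon>"
              using small[OF \<epsilon>] by blast
            have "dist (\<psi> i x) (\<psi> i 0) < \<epsilon>" if x: "x \<in> {c..d}" "x \<noteq> 0" "\<bar>x\<bar> < \<delta>" for x
            proof -
              have xI: "x \<in> I" using x by (simp add: I_def)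
              consider "i = 0" | "i = n" | "0 < i" "i < n" using i by linarith
              then show ?thesis
              proof cases
                case 3
                then have "\<phi> i x \<in> zero_set F s x" using n(6)[OF xI] by blast
                then show ?thesis using \<delta>(2)[OF x(3)] x 3 by (simp add: \<psi>_def dist_real_def)
              qed (use n(1) n(3,4)[OF xI] x \<epsilon> in \<open>auto simp: \<psi>_def\<close>)
            qed
            then show "\<forall>\<^sub>F x in at u within {c..d}. dist (\<psi> i x) (\<psi> i u) < \<epsilon>"
              unfolding eventually_at True using \<delta>(1) by (intro exI[of _ \<delta>]) (auto simp: dist_real_def)
          qed
        qed
      qed
      moreover have "\<psi> 0 x = y1 \<and> \<psi> n x = y2 \<and> (\<forall>i<n. \<psi> i x < \<psi> (Suc i) x) \<and>
             {y. y1 < y \<and> y < y2 \<and> (\<exists>f\<in>F. dps f x y = 0)} = {\<psi> i x |i. 0 < i \<and> i < n}"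
        if "c < x" "x < d" for x
      proof -
        have xI: "x \<in> I" "x \<noteq> 0" using that cd by (auto simp: I_def)
        have "{y. y1 < y \<and> y < y2 \<and> (\<exists>f\<in>F. dps f x y = 0)} = zero_set F s x"
          using fI(3)[OF xI(1)] y by (auto simp: zero_set_def)
        then show ?thesis using n(3-6)[OF xI(1)] xI(2) by (simp add: \<psi>_def)
      qed
      ultimately show ?thesis using n(1) by (intro exI[of _ n] exI[of _ \<psi>]) blast
    qed
    then show "\<exists>e>0. e < r \<and>
      (\<forall>c d. - e < c \<and> c < d \<and> d < e \<and> (d \<le> 0 \<or> 0 \<le> c) \<longrightarrow>
        (\<exists>n \<phi>. 0 < n \<and> (\<forall>i\<le>n. continuous_on {c..d} (\<phi> i)) \<and>
          (\<forall>x. c < x \<and> x < d \<longrightarrow> \<phi> 0 x = y1 \<and> \<phi> n x = y2 \<and> (\<forall>i<n. \<phi> i x < \<phi> (Suc i) x) \<and>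
             {y. y1 < y \<and> y < y2 \<and> (\<exists>f\<in>F. dps f x y = 0)} = {\<phi> i x |i. 0 < i \<and> i < (n::nat)})))"
      using e d(1) by (intro exI[of _ ?e]) auto
  qed
qed

section \<open>Cells between two graphs\<close>

abbreviation pt :: "real \<Rightarrow> real \<Rightarrow> real^2" where
  "pt x y \<equiv> vector [x, y]"

lemma pt_eta: "pt (v $ 1) (v $ 2) = v"
  by (simp add: vec_eq_iff forall_2)

lemma continuous_on_pt [continuous_intros]:
  assumes "continuous_on S f" "continuous_on S g"
  shows "continuous_on S (\<lambda>x. pt (f x) (g x))"
proof -
  have "pt (f x) (g x) = (\<chi> i. if i = 1 then f x else g x)" for x
    by (simp add: vec_eq_iff forall_2)
  moreover have "continuous_on S (\<lambda>x. if i = 1 then f x else g x)" for i :: 2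
    using assms by (cases "i = 1") auto
  ultimately show ?thesis
    by (simp add: continuous_on_vec_lambda)
qed

definition graph_cell :: "real \<Rightarrow> real \<Rightarrow> (real \<Rightarrow> real) \<Rightarrow> (real \<Rightarrow> real) \<Rightarrow> (real^2) set" where
  "graph_cell c d \<phi> \<psi> = {v. c < v $ 1 \<and> v $ 1 < d \<and> \<phi> (v $ 1) < v $ 2 \<and> v $ 2 < \<psi> (v $ 1)}"

text \<open>Cutting a closed simple path at the parameters 1/3 and 2/3 gives the three edges, as an
  edge may be any arc.\<close>

lemma jordan_curve_polygonal_structure:
  assumes "jordan_curve C"
  shows "\<exists>v e. polygonal_structure 3 C v e"
proof -
  obtain g where g: "simple_path g" "pathfinish g = pathstart g" "path_image g = C"
    using assms by (auto simp: jordan_curve_def)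
  define v where "v i = g (real i / 3)" for i :: nat
  define e where "e i = subpath (real i / 3) (real (Suc i) / 3) g" for i :: nat
  have inj: "s = t \<or> s = 0 \<and> t = 1 \<or> s = 1 \<and> t = 0" if "s \<in> {0..1}" "t \<in> {0..1}" "g s = g t" for s t
    using g(1) that by (auto simp: simple_path_def loop_free_def)
  have g1: "g 1 = g 0" using g(2) by (simp add: pathfinish_def pathstart_def)
  have vne: "g s \<noteq> g t" if "0 \<le> s" "s < t" "t \<le> 1" "s \<noteq> 0 \<or> t \<noteq> 1" for s t
    using inj[of s t] that by auto
  have lt3: "i = 0 \<or> i = 1 \<or> i = 2" if "i < 3" for i :: nat using that by linarith
  have im: "path_image (e i) = g ` {real i / 3..real (Suc i) / 3}" for i
    by (simp add: e_def path_image_subpath field_simps)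
  have "inj_on v {..<3}"
    by (rule linorder_inj_onI) (use vne in \<open>auto simp: v_def\<close>)
  moreover have "arc (e i) \<and> pathstart (e i) = v i \<and> pathfinish (e i) = v (Suc i mod 3)" if "i < 3" for i
  proof -
    have "arc (e i)"
      unfolding e_def using g(1) that vne[of "real i / 3" "real (Suc i) / 3"]
      by (intro arc_simple_path_subpath) (use lt3[OF that] in auto)
    then show ?thesis using lt3[OF that] g1 by (auto simp: e_def v_def)
  qed
  moreover have "path_image (e i) \<inter> path_image (e j) \<subseteq> {v i, v (Suc i mod 3)} \<inter> {v j, v (Suc j mod 3)}"
    if ij: "i < 3" "j < 3" "i \<noteq> j" for i j
  proof
    fix z assume "z \<in> path_image (e i) \<inter> path_image (e j)"
    then obtain s t where st: "s \<in> {real i / 3..real (Suc i) / 3}" "t \<in> {real j / 3..real (Suc j) / 3}"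
      "z = g s" "z = g t" by (auto simp: im)
    then have "s = t \<or> s = 0 \<and> t = 1 \<or> s = 1 \<and> t = 0"
      using ij by (intro inj) auto
    \<comment> \<open>Different thirds of the parameter interval share at most an endpoint, and the
      identification of 0 with 1 also concerns endpoints.\<close>
    then have "(s = real i / 3 \<or> s = real (Suc i) / 3) \<and> (t = real j / 3 \<or> t = real (Suc j) / 3)"
    proof (elim disjE)
      assume "s = t"
      consider "Suc i \<le> j" | "Suc j \<le> i" using ij(3) by linarith
      then show ?thesis
      proof cases
        case 1
        then have "real (Suc i) \<le> real j" by (simp only: of_nat_le_iff)
        then show ?thesis using \<open>s = t\<close> st by auto
      next
        case 2
        then have "real (Suc j) \<le> real i" by (simp only: of_nat_le_iff)
        then show ?thesis using \<open>s = t\<close> st by auto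
      qed
    qed (use st ij in auto)
    then have "(z = g (real i / 3) \<or> z = g (real (Suc i) / 3)) \<and>
        (z = g (real j / 3) \<or> z = g (real (Suc j) / 3))"
      using st(3,4) by metis
    moreover have "g (real (Suc k) / 3) = v (Suc k mod 3)" if "k < 3" for k
      using lt3[OF that] g1 by (auto simp: v_def)
    ultimately show "z \<in> {v i, v (Suc i mod 3)} \<inter> {v j, v (Suc j mod 3)}"
      using ij by (auto simp: v_def simp del: of_nat_Suc)
  qed
  moreover have "C = (\<Union>i<3. path_image (e i))"
  proof -
    have "{0..1} = (\<Union>i<3. {real i / 3..real (Suc i) / 3})"
      by (auto simp: numeral_3_eq_3 lessThan_Suc)
    then have "g ` {0..1} = (\<Union>i<3. path_image (e i))" by (simp only: im image_UN)
    then show ?thesis using g(3) by (simp add: path_image_def)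
  qed
  ultimately show ?thesis unfolding polygonal_structure_def by blast
qed

text \<open>The case \<open>q = r\<close> serves a vertical side shrunk to a point, where
  \<open>linepath q r\<close> is no arc.\<close>

lemma arc_extend_segment:
  fixes g :: "real \<Rightarrow> 'a::euclidean_space"
  assumes "arc g" "pathfinish g = q" "path_image g \<inter> closed_segment q r \<subseteq> {q}"
  shows "\<exists>h. arc h \<and> pathstart h = pathstart g \<and> pathfinish h = r \<and>
           path_image h = path_image g \<union> closed_segment q r"
proof (cases "q = r")
  case True
  then show ?thesis using assms pathfinish_in_path_image[of g] by (intro exI[of _ g]) auto
next
  case False
  then show ?thesis
    using assms by (intro exI[of _ "g +++ linepath q r"]) (simp add: arc_join_eq path_image_join)
qed

lemma vertical_segment:
  assumes "y \<le> z"
  shows "closed_segment (pt x y) (pt x z) = {v. v $ 1 = x \<and> y \<le> v $ 2 \<and> v $ 2 \<le> z}"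
proof
  show "closed_segment (pt x y) (pt x z) \<subseteq> {v. v $ 1 = x \<and> y \<le> v $ 2 \<and> v $ 2 \<le> z}"
  proof
    fix v assume "v \<in> closed_segment (pt x y) (pt x z)"
    then obtain u where u: "0 \<le> u" "u \<le> 1" "v = (1 - u) *\<^sub>R pt x y + u *\<^sub>R pt x z"
      by (auto simp: closed_segment_def)
    have "v $ 2 = y + u * (z - y)" "v $ 1 = x" unfolding u(3) by (simp_all add: algebra_simps)
    moreover have "0 \<le> u * (z - y)" "u * (z - y) \<le> z - y"
      using u assms mult_right_mono[of u 1 "z - y"] by auto
    ultimately show "v \<in> {v. v $ 1 = x \<and> y \<le> v $ 2 \<and> v $ 2 \<le> z}" by auto
  qed
  show "{v. v $ 1 = x \<and> y \<le> v $ 2 \<and> v $ 2 \<le> z} \<subseteq> closed_segment (pt x y) (pt x z)"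
  proof
    fix v :: "real^2" assume v: "v \<in> {v. v $ 1 = x \<and> y \<le> v $ 2 \<and> v $ 2 \<le> z}"
    show "v \<in> closed_segment (pt x y) (pt x z)"
    proof (cases "y = z")
      case True
      then have "v = pt x y" using v by (simp add: vec_eq_iff forall_2)
      then show ?thesis by simp
    next
      case False
      define u where "u = (v $ 2 - y) / (z - y)"
      have "0 \<le> u" "u \<le> 1" "u * (z - y) = v $ 2 - y"
        using v False assms by (auto simp: u_def)
      moreover have "v = (1 - u) *\<^sub>R pt x y + u *\<^sub>R pt x z"
        using v calculation(3) by (simp add: vec_eq_iff forall_2 algebra_simps)
      ultimately show ?thesis by (auto simp: closed_segment_def)
    qed
  qed
qed

lemma graph_arc:
  assumes "c < d" "continuous_on {c..d} \<phi>"
  shows "\<exists>g. arc g \<and> pathstart g = pt c (\<phi> c) \<and> pathfinish g = pt d (\<phi> d) \<and>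
           path_image g = {v. c \<le> v $ 1 \<and> v $ 1 \<le> d \<and> v $ 2 = \<phi> (v $ 1)}"
proof -
  define g where "g t = pt (c + t * (d - c)) (\<phi> (c + t * (d - c)))" for t
  have ran: "c + t * (d - c) \<in> {c..d}" if "t \<in> {0..1}" for t
  proof -
    have "t * (d - c) \<le> 1 * (d - c)" using that assms(1) by (intro mult_right_mono) auto
    moreover have "0 \<le> t * (d - c)" using that assms(1) by simp
    ultimately show ?thesis by simp
  qed
  have "continuous_on {0..1} g"
    unfolding g_def
    by (intro continuous_intros continuous_on_compose2[OF assms(2)]) (use ran in auto)
  moreover have "inj_on g {0..1}"
    using assms(1) by (auto simp: inj_on_def g_def vec_eq_iff forall_2)
  ultimately have "arc g" by (simp add: arc_def path_def)
  moreover have "path_image g = {v. c \<le> v $ 1 \<and> v $ 1 \<le> d \<and> v $ 2 = \<phi> (v $ 1)}"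
  proof
    show "path_image g \<subseteq> {v. c \<le> v $ 1 \<and> v $ 1 \<le> d \<and> v $ 2 = \<phi> (v $ 1)}"
      using ran by (auto simp: path_image_def g_def)
    show "{v. c \<le> v $ 1 \<and> v $ 1 \<le> d \<and> v $ 2 = \<phi> (v $ 1)} \<subseteq> path_image g"
    proof
      fix v :: "real^2" assume v: "v \<in> {v. c \<le> v $ 1 \<and> v $ 1 \<le> d \<and> v $ 2 = \<phi> (v $ 1)}"
      have "c + ((v $ 1 - c) / (d - c)) * (d - c) = v $ 1" using assms(1) by simp
      then have "g ((v $ 1 - c) / (d - c)) = v"
        using v by (simp add: g_def vec_eq_iff forall_2)
      moreover have "(v $ 1 - c) / (d - c) \<in> {0..1}" using v assms(1) by auto
      ultimately show "v \<in> path_image g" unfolding path_image_def by (metis imageI)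
    qed
  qed
  ultimately show ?thesis
    by (intro exI[of _ g]) (simp add: pathstart_def pathfinish_def g_def)
qed

lemma homeomorphic_Times:
  assumes "A homeomorphic A'" "B homeomorphic B'"
  shows "(A \<times> B) homeomorphic (A' \<times> B')"
proof -
  obtain f f' where f: "homeomorphism A A' f f'" using assms(1) by (auto simp: homeomorphic_def)
  obtain g g' where g: "homeomorphism B B' g g'" using assms(2) by (auto simp: homeomorphic_def)
  note cont = homeomorphism_cont1[OF f] homeomorphism_cont2[OF f] homeomorphism_cont1[OF g] homeomorphism_cont2[OF g]
  have "homeomorphism (A \<times> B) (A' \<times> B') (\<lambda>p. (f (fst p), g (snd p))) (\<lambda>p. (f' (fst p), g' (snd p)))"
  proof (rule homeomorphismI)
    show "continuous_on (A \<times> B) (\<lambda>p. (f (fst p), g (snd p)))"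
      by (intro continuous_intros continuous_on_compose2[OF cont(1)] continuous_on_compose2[OF cont(3)]) auto
    show "continuous_on (A' \<times> B') (\<lambda>p. (f' (fst p), g' (snd p)))"
      by (intro continuous_intros continuous_on_compose2[OF cont(2)] continuous_on_compose2[OF cont(4)]) auto
  qed (use f g in \<open>auto simp: homeomorphism_def\<close>)
  then show ?thesis by (auto simp: homeomorphic_def)
qed

section \<open>Geometry of a cell whose bounding graphs may meet over the endpoints\<close>

context
  fixes c d :: real and \<phi> \<psi> :: "real \<Rightarrow> real"
  assumes cd: "c < d"
    and cont: "continuous_on {c..d} \<phi>" "continuous_on {c..d} \<psi>"
    and less: "\<And>x. c < x \<Longrightarrow> x < d \<Longrightarrow> \<phi> x < \<psi> x"
begin

lemma graph_le:
  assumes "x \<in> {c..d}"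
  shows "\<phi> x \<le> \<psi> x"
proof -
  have "closure {c<..<d} = {c..d}" using cd by simp
  then show ?thesis
    using continuous_le_on_closure[of "{c<..<d}" "\<lambda>x. \<phi> x - \<psi> x" x 0] less cont assms
    by (force intro: continuous_intros)
qed

text \<open>Affine on each vertical fibre. It maps the open rectangle homeomorphically onto the cell
  and the closed rectangle onto the closure, but collapses a vertical side over which the graphs
  meet.\<close>

definition cell_param :: "real \<times> real \<Rightarrow> real^2" where
  "cell_param p = pt (fst p) (\<phi> (fst p) + snd p * (\<psi> (fst p) - \<phi> (fst p)))"

lemma continuous_on_cell_param: "continuous_on ({c..d} \<times> {0..1}) cell_param"
  unfolding cell_param_def
  by (intro continuous_intros continuous_on_compose2[OF cont(1)] continuous_on_compose2[OF cont(2)]) auto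

lemma homeomorphism_cell_param:
  "homeomorphism ({c<..<d} \<times> {0<..<1}) (graph_cell c d \<phi> \<psi>) cell_param
     (\<lambda>v. (v $ 1, (v $ 2 - \<phi> (v $ 1)) / (\<psi> (v $ 1) - \<phi> (v $ 1))))"
proof (rule homeomorphismI)
  show "continuous_on ({c<..<d} \<times> {0<..<1}) cell_param"
    by (rule continuous_on_subset[OF continuous_on_cell_param]) auto
  have "continuous_on (graph_cell c d \<phi> \<psi>) (\<lambda>v. \<phi> (v $ 1))" "continuous_on (graph_cell c d \<phi> \<psi>) (\<lambda>v. \<psi> (v $ 1))"
    by (intro continuous_on_compose2[OF cont(1)] continuous_on_compose2[OF cont(2)] continuous_intros;
        auto simp: graph_cell_def)+
  then show "continuous_on (graph_cell c d \<phi> \<psi>)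
      (\<lambda>v. (v $ 1, (v $ 2 - \<phi> (v $ 1)) / (\<psi> (v $ 1) - \<phi> (v $ 1))))"
    by (intro continuous_intros) (auto simp: graph_cell_def)
  show "cell_param ` ({c<..<d} \<times> {0<..<1}) \<subseteq> graph_cell c d \<phi> \<psi>"
  proof safe
    fix x t :: real assume x: "x \<in> {c<..<d}" and t: "t \<in> {0<..<1}"
    have "0 < t * (\<psi> x - \<phi> x)" using x t less[of x] by simp
    moreover have "t * (\<psi> x - \<phi> x) < 1 * (\<psi> x - \<phi> x)"
      using x t less[of x] by (intro mult_strict_right_mono) auto
    ultimately show "cell_param (x, t) \<in> graph_cell c d \<phi> \<psi>"
      using x by (simp add: cell_param_def graph_cell_def)
  qed
  show "(\<lambda>v. (v $ 1, (v $ 2 - \<phi> (v $ 1)) / (\<psi> (v $ 1) - \<phi> (v $ 1)))) ` graph_cell c d \<phi> \<psi> \<subseteq>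
      {c<..<d} \<times> {0<..<1}"
    by (auto simp: graph_cell_def)
  show "(\<lambda>v. (v $ 1, (v $ 2 - \<phi> (v $ 1)) / (\<psi> (v $ 1) - \<phi> (v $ 1)))) (cell_param p) = p"
    if "p \<in> {c<..<d} \<times> {0<..<1}" for p
    using that less[of "fst p"] by (cases p) (auto simp: cell_param_def)
  show "cell_param (v $ 1, (v $ 2 - \<phi> (v $ 1)) / (\<psi> (v $ 1) - \<phi> (v $ 1))) = v"
    if "v \<in> graph_cell c d \<phi> \<psi>" for v
    using that less[of "v $ 1"] by (auto simp: cell_param_def graph_cell_def vec_eq_iff forall_2)
qed

lemma graph_cell_homeomorphic_ball: "graph_cell c d \<phi> \<psi> homeomorphic ball (0::real^2) 1"
proof -
  have "graph_cell c d \<phi> \<psi> homeomorphic ({c<..<d} \<times> {0<..<1::real})"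
    using homeomorphism_cell_param homeomorphic_sym homeomorphic_def by blast
  also have "{c<..<d} \<times> {0<..<1::real} homeomorphic (UNIV \<times> UNIV :: (real \<times> real) set)"
    using cd by (intro homeomorphic_Times homeomorphic_open_interval_UNIV) auto
  also have "UNIV \<times> UNIV = (UNIV :: (real \<times> real) set)" by simp
  also have "(UNIV :: (real \<times> real) set) homeomorphic (UNIV :: (real^2) set)"
    by (intro homeomorphic_subspaces) auto
  also have "(UNIV :: (real^2) set) homeomorphic ball (0::real^2) 1"
    using homeomorphic_ball01_UNIV homeomorphic_sym by blast
  finally show ?thesis .
qed

text \<open>The image of the closed rectangle under \<open>cell_param\<close> is compact and, by
  continuity, contained in the closure of the image of the open one.\<close>

lemma closure_graph_cell:
  "closure (graph_cell c d \<phi> \<psi>) = {v. c \<le> v $ 1 \<and> v $ 1 \<le> d \<and> \<phi> (v $ 1) \<le> v $ 2 \<and> v $ 2 \<le> \<psi> (v $ 1)}"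
    (is "_ = ?R")
proof -
  have clos: "closure ({c<..<d} \<times> {0<..<1::real}) = {c..d} \<times> {0..1}"
    using cd by (simp add: closure_Times)
  have img: "cell_param ` ({c<..<d} \<times> {0<..<1}) = graph_cell c d \<phi> \<psi>"
    using homeomorphism_cell_param by (rule homeomorphism_image1)
  have "cell_param ` ({c..d} \<times> {0..1}) = ?R"
  proof
    show "cell_param ` ({c..d} \<times> {0..1}) \<subseteq> ?R"
    proof safe
      fix x t :: real assume x: "x \<in> {c..d}" and t: "t \<in> {0..1}"
      have "0 \<le> t * (\<psi> x - \<phi> x)" using t graph_le[OF x] by simp
      moreover have "t * (\<psi> x - \<phi> x) \<le> 1 * (\<psi> x - \<phi> x)"
        using t graph_le[OF x] by (intro mult_right_mono) auto
      ultimately show "c \<le> cell_param (x, t) $ 1" "cell_param (x, t) $ 1 \<le> d"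
        "\<phi> (cell_param (x, t) $ 1) \<le> cell_param (x, t) $ 2" "cell_param (x, t) $ 2 \<le> \<psi> (cell_param (x, t) $ 1)"
        using x by (simp_all add: cell_param_def)
    qed
    show "?R \<subseteq> cell_param ` ({c..d} \<times> {0..1})"
    proof
      fix v :: "real^2" assume v: "v \<in> ?R"
      \<comment> \<open>Where the graphs meet, every fibre parameter gives the same point; 0 is
        taken.\<close>
      define t where "t = (if \<phi> (v $ 1) = \<psi> (v $ 1) then 0 else (v $ 2 - \<phi> (v $ 1)) / (\<psi> (v $ 1) - \<phi> (v $ 1)))"
      have "t \<in> {0..1}" using v by (auto simp: t_def divide_simps)
      moreover have "cell_param (v $ 1, t) = v"
        using v by (auto simp: t_def cell_param_def vec_eq_iff forall_2)
      ultimately show "v \<in> cell_param ` ({c..d} \<times> {0..1})"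
        using v by (intro image_eqI[of _ _ "(v $ 1, t)"]) auto
    qed
  qed
  moreover have "closure (graph_cell c d \<phi> \<psi>) = cell_param ` ({c..d} \<times> {0..1})"
  proof
    have "compact (cell_param ` ({c..d} \<times> {0..1}))"
      by (intro compact_continuous_image continuous_on_cell_param compact_Times) auto
    then show "closure (graph_cell c d \<phi> \<psi>) \<subseteq> cell_param ` ({c..d} \<times> {0..1})"
      unfolding img[symmetric] by (intro closure_minimal compact_imp_closed image_mono) auto
    show "cell_param ` ({c..d} \<times> {0..1}) \<subseteq> closure (graph_cell c d \<phi> \<psi>)"
      unfolding clos[symmetric]
      by (rule image_closure_subset)
         (use continuous_on_cell_param img closure_subset in \<open>auto simp: clos\<close>)
  qed
  ultimately show ?thesis by simp
qed

lemma open_graph_cell: "open (graph_cell c d \<phi> \<psi>)"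
proof -
  let ?S = "{v::real^2. c < v $ 1 \<and> v $ 1 < d}"
  have "continuous_on ?S (\<lambda>v. \<phi> (v $ 1))" "continuous_on ?S (\<lambda>v. \<psi> (v $ 1))"
    by (intro continuous_on_compose2[OF cont(1)] continuous_on_compose2[OF cont(2)] continuous_intros; auto)+
  then have "continuous_on ?S (\<lambda>v. (v $ 2 - \<phi> (v $ 1), \<psi> (v $ 1) - v $ 2))"
    by (intro continuous_intros)
  moreover have "open ?S"
    by (intro open_Collect_conj open_Collect_less continuous_intros)
  ultimately have "open (?S \<inter> (\<lambda>v. (v $ 2 - \<phi> (v $ 1), \<psi> (v $ 1) - v $ 2)) -` ({0<..} \<times> {0<..}))"
    by (intro continuous_open_preimage) (auto intro: open_Times)
  also have "?S \<inter> (\<lambda>v. (v $ 2 - \<phi> (v $ 1), \<psi> (v $ 1) - v $ 2)) -` ({0<..} \<times> {0<..}) = graph_cell c d \<phi> \<psi>"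
    by (auto simp: graph_cell_def)
  finally show ?thesis .
qed

text \<open>A point of the interior can be moved by some \<open>r > 0\<close> both ways along each
  axis within the closure, which turns all four weak inequalities into strict ones.\<close>

lemma interior_closure_graph_cell: "interior (closure (graph_cell c d \<phi> \<psi>)) = graph_cell c d \<phi> \<psi>"
proof
  show "graph_cell c d \<phi> \<psi> \<subseteq> interior (closure (graph_cell c d \<phi> \<psi>))"
    by (intro interior_maximal open_graph_cell closure_subset)
  show "interior (closure (graph_cell c d \<phi> \<psi>)) \<subseteq> graph_cell c d \<phi> \<psi>"
  proof
    fix v assume "v \<in> interior (closure (graph_cell c d \<phi> \<psi>))"
    then obtain r where r: "r > 0" "cball v r \<subseteq> closure (graph_cell c d \<phi> \<psi>)"
      by (meson mem_interior_cball)
    have "v + s *\<^sub>R axis i 1 \<in> closure (graph_cell c d \<phi> \<psi>)" if "\<bar>s\<bar> \<le> r" for s i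
      using r(2) that by (auto simp: subset_iff dist_norm norm_axis_1)
    from this[of r 1] this[of "-r" 1] this[of r 2] this[of "-r" 2]
    show "v \<in> graph_cell c d \<phi> \<psi>"
      using r(1) unfolding closure_graph_cell by (simp add: axis_def graph_cell_def)
  qed
qed

text \<open>The loop joins two arcs: the lower graph, and the upper graph with the two vertical
  sides attached at its ends, either of which may be a single point. The arcs share only the two
  lower corners.\<close>

lemma jordan_curve_graph_cell: "jordan_curve (frontier (graph_cell c d \<phi> \<psi>))"
proof -
  let ?G = "\<lambda>f. {v::real^2. c \<le> v $ 1 \<and> v $ 1 \<le> d \<and> v $ 2 = f (v $ 1)}"
  let ?V = "\<lambda>x. {v::real^2. v $ 1 = x \<and> \<phi> x \<le> v $ 2 \<and> v $ 2 \<le> \<psi> x}"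
  have le: "\<phi> c \<le> \<psi> c" "\<phi> d \<le> \<psi> d" using graph_le cd by auto
  obtain g where g: "arc g" "pathstart g = pt c (\<phi> c)" "pathfinish g = pt d (\<phi> d)" "path_image g = ?G \<phi>"
    using graph_arc[OF cd cont(1)] by blast
  obtain h0 where h0: "arc h0" "pathstart h0 = pt c (\<psi> c)" "pathfinish h0 = pt d (\<psi> d)" "path_image h0 = ?G \<psi>"
    using graph_arc[OF cd cont(2)] by blast
  have seg: "closed_segment (pt x (\<psi> x)) (pt x (\<phi> x)) = ?V x" if "x \<in> {c, d}" for x
    using vertical_segment[of "\<phi> x" "\<psi> x" x] that le by (auto simp: closed_segment_commute)
  have "path_image h0 \<inter> closed_segment (pt d (\<psi> d)) (pt d (\<phi> d)) \<subseteq> {pt d (\<psi> d)}"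
    unfolding h0 seg[of d, simplified] by (auto simp: vec_eq_iff forall_2)
  from arc_extend_segment[OF h0(1,3) this]
  obtain h1 where h1: "arc h1" "pathstart h1 = pt c (\<psi> c)" "pathfinish h1 = pt d (\<phi> d)"
    "path_image h1 = ?G \<psi> \<union> ?V d"
    unfolding h0 seg[of d, simplified] by auto
  have "path_image (reversepath h1) \<inter> closed_segment (pt c (\<psi> c)) (pt c (\<phi> c)) \<subseteq> {pt c (\<psi> c)}"
    unfolding path_image_reversepath h1 seg[of c, simplified] using cd by (auto simp: vec_eq_iff forall_2)
  from arc_extend_segment[OF _ _ this]
  obtain h where h: "arc h" "pathstart h = pt d (\<phi> d)" "pathfinish h = pt c (\<phi> c)"
    "path_image h = ?G \<psi> \<union> ?V d \<union> ?V c"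
    unfolding path_image_reversepath h1 seg[of c, simplified] using h1 by (auto simp: arc_reversepath)
  have "v \<in> {pt c (\<phi> c), pt d (\<phi> d)}" if v: "v \<in> ?G \<phi>" "v \<in> ?G \<psi> \<union> ?V d \<union> ?V c" for v
  proof -
    have "v $ 1 = c \<or> v $ 1 = d"
    proof (rule ccontr)
      assume "\<not> (v $ 1 = c \<or> v $ 1 = d)"
      then have "v $ 2 = \<phi> (v $ 1)" "v $ 2 = \<psi> (v $ 1)" "c < v $ 1" "v $ 1 < d" using v by auto
      then show False using less[of "v $ 1"] by simp
    qed
    then show ?thesis using v(1) pt_eta[of v] by auto
  qed
  then have "path_image g \<inter> path_image h \<subseteq> {pathstart g, pathstart h}"
    unfolding g h by blast
  then have "simple_path (g +++ h)"
    using g h by (intro simple_path_join_loop) simp_all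
  moreover have "pathfinish (g +++ h) = pathstart (g +++ h)" using g h by simp
  moreover have "path_image (g +++ h) = frontier (graph_cell c d \<phi> \<psi>)"
  proof -
    have "frontier (graph_cell c d \<phi> \<psi>) = closure (graph_cell c d \<phi> \<psi>) - graph_cell c d \<phi> \<psi>"
      using open_graph_cell by (simp add: frontier_def interior_open)
    also have "\<dots> = ?G \<phi> \<union> (?G \<psi> \<union> ?V d \<union> ?V c)"
      unfolding closure_graph_cell using graph_le cd le by (force simp: graph_cell_def)
    finally show ?thesis using g h by (simp add: path_image_join)
  qed
  ultimately show ?thesis unfolding jordan_curve_def by blast
qed

end

text \<open>Translates the double exterior into the interior of the closure, the form in which
  regularity and regularized unions are handled.\<close>

lemma exterior_exterior: "exterior (exterior P) = interior (closure P)"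
  by (simp add: exterior_def interior_complement closure_complement)

theorem graph_cell_curved_triangle:
  assumes "c < d" "continuous_on {c..d} \<phi>" "continuous_on {c..d} \<psi>"
    and "\<And>x. c < x \<Longrightarrow> x < d \<Longrightarrow> \<phi> x < \<psi> x"
    and "semianalytic (graph_cell c d \<phi> \<psi>)"
  shows "curved_triangle (graph_cell c d \<phi> \<psi>)"
proof -
  have j: "jordan_curve (frontier (graph_cell c d \<phi> \<psi>))"
    by (rule jordan_curve_graph_cell[OF assms(1-4)])
  then have "bounded (frontier (graph_cell c d \<phi> \<psi>))"
    unfolding jordan_curve_def by (metis bounded_simple_path_image)
  then have "yin_set (graph_cell c d \<phi> \<psi>)"
    using assms(5) interior_closure_graph_cell[OF assms(1-4)]
    by (simp add: yin_set_def regular_open_def exterior_exterior)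
  then show ?thesis
    unfolding curved_triangle_def curved_polygon_def
    using j jordan_curve_polygonal_structure[OF j] graph_cell_homeomorphic_ball[OF assms(1-4)] by blast
qed

section \<open>Analytic functions and semianalytic sets\<close>

lemma semianalytic_Int:
  assumes "semianalytic P" "semianalytic Q"
  shows "semianalytic (P \<inter> Q)"
proof -
  obtain G where G: "finite G" "\<forall>g\<in>G. real_analytic g" "P \<in> algebra UNIV hull ((\<lambda>g. {x. g x \<ge> 0}) ` G)"
    using assms(1) by (auto simp: semianalytic_def)
  obtain H where H: "finite H" "\<forall>g\<in>H. real_analytic g" "Q \<in> algebra UNIV hull ((\<lambda>g. {x. g x \<ge> 0}) ` H)"
    using assms(2) by (auto simp: semianalytic_def)
  have "P \<inter> Q \<in> algebra UNIV hull ((\<lambda>g. {x. g x \<ge> 0}) ` (G \<union> H))"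
    unfolding hull_def
  proof safe
    fix T assume T: "algebra UNIV T" "(\<lambda>g. {x. g x \<ge> 0}) ` (G \<union> H) \<subseteq> T"
    then have "(\<lambda>g. {x. g x \<ge> 0}) ` G \<subseteq> T" "(\<lambda>g. {x. g x \<ge> 0}) ` H \<subseteq> T" by auto
    then have "P \<in> T" "Q \<in> T"
      using G(3) H(3) T(1) unfolding hull_def by blast+
    then show "P \<inter> Q \<in> T" using T(1) by (simp add: algebra_iff_Int)
  qed
  then show ?thesis unfolding semianalytic_def using G H by (intro exI[of _ "G \<union> H"]) auto
qed

lemma semianalytic_UNIV: "semianalytic UNIV"
  unfolding semianalytic_def hull_def
  by (intro exI[of _ "{}"]) (auto simp: algebra.top)

lemma semianalytic_INT:
  assumes "finite I" "\<And>i. i \<in> I \<Longrightarrow> semianalytic (P i)"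
  shows "semianalytic (\<Inter>i\<in>I. P i)"
  using assms by (induction I rule: finite_induct) (auto intro: semianalytic_UNIV semianalytic_Int)

lemma semianalytic_less_0:
  assumes "real_analytic f"
  shows "semianalytic {v. f v < 0}"
  unfolding semianalytic_def hull_def
proof (intro exI[of _ "{f}"] conjI ballI InterI; clarsimp)
  fix T assume T: "algebra UNIV T" "{x. f x \<ge> 0} \<in> T"
  then have "UNIV - {x. f x \<ge> 0} \<in> T" unfolding algebra_iff_Int by blast
  also have "UNIV - {x. f x \<ge> 0} = {v. f v < 0}" by auto
  finally show "{v. f v < 0} \<in> T" .
qed (use assms in auto)

text \<open>The sets that do not separate \<open>v\<close> from \<open>w\<close> form a Boolean
  algebra.\<close>

lemma semianalytic_invariant:
  assumes "P \<in> algebra UNIV hull ((\<lambda>g. {x. g x \<ge> (0::real)}) ` G)"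
    and "\<And>g. g \<in> G \<Longrightarrow> g v \<ge> 0 \<longleftrightarrow> g w \<ge> 0"
  shows "v \<in> P \<longleftrightarrow> w \<in> P"
proof -
  have "algebra UNIV {A. v \<in> A \<longleftrightarrow> w \<in> A}"
    unfolding algebra_iff_Int by auto
  moreover have "(\<lambda>g. {x. g x \<ge> 0}) ` G \<subseteq> {A. v \<in> A \<longleftrightarrow> w \<in> A}"
    using assms(2) by auto
  ultimately have "P \<in> {A. v \<in> A \<longleftrightarrow> w \<in> A}"
    using assms(1) unfolding hull_def by blast
  then show ?thesis by simp
qed

text \<open>A square instead of a ball, so that the two coordinates range independently, as they do
  in \<open>dps_conv\<close> and in the later boxes.\<close>

definition has_dps :: "(real^2 \<Rightarrow> real) \<Rightarrow> real^2 \<Rightarrow> (nat \<Rightarrow> nat \<Rightarrow> real) \<Rightarrow> real \<Rightarrow> bool" where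
  "has_dps f p c r \<longleftrightarrow> dps_conv c r \<and>
     (\<forall>x y. \<bar>x\<bar> < r \<longrightarrow> \<bar>y\<bar> < r \<longrightarrow> f (pt (p $ 1 + x) (p $ 2 + y)) = dps c x y)"

lemma has_dpsD:
  assumes "has_dps f p c r" "\<bar>v $ 1 - p $ 1\<bar> < r" "\<bar>v $ 2 - p $ 2\<bar> < r"
  shows "f v = dps c (v $ 1 - p $ 1) (v $ 2 - p $ 2)"
  using assms pt_eta[of v] unfolding has_dps_def
  by (metis add.commute diff_add_cancel)

lemma has_dps_mono: "has_dps f p c r \<Longrightarrow> 0 < s \<Longrightarrow> s \<le> r \<Longrightarrow> has_dps f p c s"
  by (auto simp: has_dps_def intro: dps_conv_mono)

lemma norm_pt_le: "norm (pt x y) \<le> \<bar>x\<bar> + \<bar>y\<bar>"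
  using norm_le_l1_cart[of "pt x y"] by (simp add: UNIV_2)

lemma real_analytic_at_iff: "real_analytic_at f p \<longleftrightarrow> (\<exists>c r. has_dps f p c r)"
proof
  assume "real_analytic_at f p"
  then obtain c r where r: "r > 0" and hs: "\<And>x. x \<in> ball p r \<Longrightarrow>
      ((\<lambda>(i, j). c i j * (x $ 1 - p $ 1) ^ i * (x $ 2 - p $ 2) ^ j) has_sum f x) UNIV"
    unfolding real_analytic_at_def by blast
  \<comment> \<open>A square of half side \<open>r / 3\<close> fits into the ball, since its points
    have distance at most \<open>2 * s < r\<close>. Summability at its corner gives
    \<open>dps_conv\<close>.\<close>
  define s where "s = r / 3"
  have s: "0 < s" using r by (simp add: s_def)
  have in_ball: "pt (p $ 1 + x) (p $ 2 + y) \<in> ball p r" if "\<bar>x\<bar> \<le> s" "\<bar>y\<bar> \<le> s" for x y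
  proof -
    have "pt (p $ 1 + x) (p $ 2 + y) - p = pt x y" by (simp add: vec_eq_iff forall_2)
    then have "dist p (pt (p $ 1 + x) (p $ 2 + y)) \<le> \<bar>x\<bar> + \<bar>y\<bar>"
      using norm_pt_le[of x y] by (metis dist_commute dist_norm)
    then show ?thesis using that r by (simp add: s_def)
  qed
  have "(\<lambda>(i, j). c i j * s ^ i * s ^ j) summable_on UNIV"
    using hs[OF in_ball[of s s]] s has_sum_imp_summable by fastforce
  then have "(\<lambda>(i, j). c i j * s ^ i * s ^ j) abs_summable_on UNIV"
    by (rule summable_on_iff_abs_summable_on_real[THEN iffD1])
  then have conv: "dps_conv c s"
    using s by (simp add: dps_conv_def case_prod_unfold abs_mult)
  moreover have "f (pt (p $ 1 + x) (p $ 2 + y)) = dps c x y" if "\<bar>x\<bar> < s" "\<bar>y\<bar> < s" for x y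
  proof -
    have "((\<lambda>(i, j). c i j * x ^ i * y ^ j) has_sum f (pt (p $ 1 + x) (p $ 2 + y))) UNIV"
      using hs[OF in_ball[of x y]] that by simp
    moreover have "((\<lambda>(i, j). c i j * x ^ i * y ^ j) has_sum dps c x y) UNIV"
      using dps_has_sum[OF conv, of x y] that by simp
    ultimately show ?thesis by (rule has_sum_unique)
  qed
  ultimately show "\<exists>c r. has_dps f p c r" unfolding has_dps_def by blast
next
  assume "\<exists>c r. has_dps f p c r"
  then obtain c r where h: "has_dps f p c r" by blast
  then have c: "dps_conv c r" by (simp add: has_dps_def)
  show "real_analytic_at f p"
    unfolding real_analytic_at_def
  proof (intro exI[of _ c] exI[of _ r] conjI ballI)
    fix v assume "v \<in> ball p r"
    then have "norm (v - p) < r" by (simp add: dist_norm norm_minus_commute)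
    then have *: "\<bar>v $ 1 - p $ 1\<bar> < r" "\<bar>v $ 2 - p $ 2\<bar> < r"
      using component_le_norm_cart[of "v - p" 1] component_le_norm_cart[of "v - p" 2] by auto
    then show "((\<lambda>(i, j). c i j * (v $ 1 - p $ 1) ^ i * (v $ 2 - p $ 2) ^ j) has_sum f v) UNIV"
      using dps_has_sum[OF c, of "v $ 1 - p $ 1" "v $ 2 - p $ 2"] has_dpsD[OF h *] by simp
  qed (rule dps_conv_pos[OF c])
qed

text \<open>Supplies the linear functions that bound a box and the horizontal line through its
  centre.\<close>

lemma real_analytic_affine: "real_analytic (\<lambda>v. \<alpha> * v $ 1 + \<beta> * v $ 2 + \<gamma>)"
  unfolding real_analytic_def
proof
  fix p :: "real^2"
  define c where "c i j = (if i = 0 \<and> j = 0 then \<alpha> * p $ 1 + \<beta> * p $ 2 + \<gamma>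
     else if i = 1 \<and> j = 0 then \<alpha> else if i = 0 \<and> j = 1 then \<beta> else 0)" for i j :: nat
  have hs: "((\<lambda>(i, j). c i j * x ^ i * y ^ j) has_sum (\<alpha> * (p $ 1 + x) + \<beta> * (p $ 2 + y) + \<gamma>)) UNIV" for x y :: real
  proof -
    let ?A = "{(0, 0), (1, 0), (0, 1)} :: (nat \<times> nat) set"
    have "((\<lambda>(i, j). c i j * x ^ i * y ^ j) has_sum (\<Sum>(i, j)\<in>?A. c i j * x ^ i * y ^ j)) ?A"
      by (rule has_sum_finite) auto
    then have "((\<lambda>(i, j). c i j * x ^ i * y ^ j) has_sum (\<Sum>(i, j)\<in>?A. c i j * x ^ i * y ^ j)) UNIV"
      by (rule has_sum_cong_neutral[THEN iffD1, rotated -1]) (auto simp: c_def split: if_splits)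
    then show ?thesis by (simp add: c_def algebra_simps)
  qed
  show "real_analytic_at (\<lambda>v. \<alpha> * v $ 1 + \<beta> * v $ 2 + \<gamma>) p"
    unfolding real_analytic_at_def
  proof (intro exI[of _ c] exI[of _ 1] conjI ballI)
    fix v :: "real^2"
    show "((\<lambda>(i, j). c i j * (v $ 1 - p $ 1) ^ i * (v $ 2 - p $ 2) ^ j) has_sum
        (\<alpha> * v $ 1 + \<beta> * v $ 2 + \<gamma>)) UNIV"
      using hs[of "v $ 1 - p $ 1" "v $ 2 - p $ 2"] by simp
  qed simp
qed

lemma real_analytic_uminus:
  assumes "real_analytic f"
  shows "real_analytic (\<lambda>v. - f v)"
  unfolding real_analytic_def
proof
  fix p
  obtain c r where r: "r > 0" and hs: "\<And>x. x \<in> ball p r \<Longrightarrow>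
      ((\<lambda>(i, j). c i j * (x $ 1 - p $ 1) ^ i * (x $ 2 - p $ 2) ^ j) has_sum f x) UNIV"
    using assms unfolding real_analytic_def real_analytic_at_def by blast
  have "((\<lambda>(i, j). - c i j * (x $ 1 - p $ 1) ^ i * (x $ 2 - p $ 2) ^ j) has_sum - f x) UNIV" if "x \<in> ball p r" for x
    using has_sum_uminusI[OF hs[OF that]] by (simp add: case_prod_unfold)
  then show "real_analytic_at (\<lambda>v. - f v) p"
    unfolding real_analytic_at_def using r by (intro exI[of _ "\<lambda>i j. - c i j"] exI[of _ r]) auto
qed

lemma semianalytic_greater_0:
  assumes "real_analytic f"
  shows "semianalytic {v. f v > 0}"
  using semianalytic_less_0[OF real_analytic_uminus[OF assms]] by simp

section \<open>Vertical derivatives and the local normal form\<close>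

definition partial_y :: "(real^2 \<Rightarrow> real) \<Rightarrow> real^2 \<Rightarrow> real" where
  "partial_y f v = deriv (\<lambda>t. f (pt (v $ 1) t)) (v $ 2)"

lemma has_dps_DERIV:
  assumes "has_dps f p c r" "\<bar>x\<bar> < r" "\<bar>y\<bar> < r"
  shows "((\<lambda>t. f (pt (p $ 1 + x) t)) has_real_derivative dps (dps_dy c) x y) (at (p $ 2 + y))"
proof -
  have c: "dps_conv c r" using assms(1) by (simp add: has_dps_def)
  have "((\<lambda>t. dps c x (t + - p $ 2)) has_real_derivative dps (dps_dy c) x y) (at (p $ 2 + y))"
    using has_field_derivative_dps_dy[OF c, of x y] assms
    by (subst DERIV_shift[symmetric]) simp
  then show ?thesis
  proof (rule has_field_derivative_transform_within_open)
    show "open {p $ 2 - r<..<p $ 2 + r}" "p $ 2 + y \<in> {p $ 2 - r<..<p $ 2 + r}" using assms by auto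
    fix t assume "t \<in> {p $ 2 - r<..<p $ 2 + r}"
    then show "dps c x (t + - p $ 2) = f (pt (p $ 1 + x) t)"
      using has_dpsD[OF assms(1), of "pt (p $ 1 + x) t"] assms(2) by auto
  qed
qed

lemma has_dps_partial_y:
  assumes "has_dps f p c r" "0 < s" "s < r"
  shows "has_dps (partial_y f) p (dps_dy c) s"
proof -
  have "dps_conv c r" using assms(1) by (simp add: has_dps_def)
  then have "dps_conv (dps_dy c) s" using assms by (intro dps_conv_dy)
  moreover have "partial_y f (pt (p $ 1 + x) (p $ 2 + y)) = dps (dps_dy c) x y" if "\<bar>x\<bar> < s" "\<bar>y\<bar> < s" for x y
    unfolding partial_y_def using has_dps_DERIV[OF assms(1), of x y] that assms(3)
    by (simp add: DERIV_imp_deriv)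
  ultimately show ?thesis by (simp add: has_dps_def)
qed

text \<open>Analyticity on the whole plane is the point: sign conditions on the derivative are
  semianalytic, whereas the quotients in \<open>local_form\<close> exist only near one
  point.\<close>

lemma real_analytic_partial_y:
  assumes "real_analytic f"
  shows "real_analytic (partial_y f)"
  unfolding real_analytic_def real_analytic_at_iff
proof
  fix p
  obtain c r where h: "has_dps f p c r" using assms unfolding real_analytic_def real_analytic_at_iff by blast
  then have "0 < r" by (auto simp: has_dps_def dps_conv_pos)
  then have "has_dps (partial_y f) p (dps_dy c) (r / 2)" using h by (intro has_dps_partial_y) auto
  then show "\<exists>c r. has_dps (partial_y f) p c r" by blast
qed

lemma real_analytic_DERIV:
  assumes "real_analytic f"
  shows "((\<lambda>t. f (pt x t)) has_real_derivative partial_y f (pt x y)) (at y)"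
proof -
  obtain c r where h: "has_dps f (pt x y) c r"
    using assms unfolding real_analytic_def real_analytic_at_iff by blast
  then have "0 < r" by (auto simp: has_dps_def dps_conv_pos)
  then have "((\<lambda>t. f (pt x t)) has_real_derivative dps (dps_dy c) 0 0) (at y)"
    using has_dps_DERIV[OF h, of 0 0] by simp
  then show ?thesis by (simp add: partial_y_def DERIV_imp_deriv)
qed

lemma real_analytic_continuous_on:
  assumes "real_analytic f"
  shows "continuous_on S f"
proof (rule continuous_at_imp_continuous_on, rule ballI)
  fix p
  obtain c r where h: "has_dps f p c r" using assms unfolding real_analytic_def real_analytic_at_iff by blast
  then have c: "dps_conv c r" and r: "0 < r" by (auto simp: has_dps_def dps_conv_pos)
  let ?B = "{v::real^2. p $ 1 - r < v $ 1} \<inter> {v. v $ 1 < p $ 1 + r} \<inter> {v. p $ 2 - r < v $ 2} \<inter> {v. v $ 2 < p $ 2 + r}"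
  have "open ?B" by (intro open_Int open_Collect_less continuous_intros)
  have "continuous_on ?B ((\<lambda>q. dps c (fst q) (snd q)) \<circ> (\<lambda>v. (v $ 1 - p $ 1, v $ 2 - p $ 2)))"
    by (intro continuous_on_compose continuous_intros continuous_on_subset[OF continuous_on_dps[OF c]]) auto
  then have "continuous_on ?B f"
    by (rule continuous_on_eq) (auto intro!: has_dpsD[OF h, symmetric])
  then show "isCont f p"
    using \<open>open ?B\<close> r by (auto simp: continuous_on_eq_continuous_at)
qed

lemma real_analytic_funpow_partial_y: "real_analytic f \<Longrightarrow> real_analytic ((partial_y ^^ j) f)"
  by (induction j) (auto intro: real_analytic_partial_y)

lemma has_dps_funpow_partial_y:
  assumes "has_dps f p c r"
  shows "\<exists>s>0. has_dps ((partial_y ^^ j) f) p ((dps_dy ^^ j) c) s"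
proof (induction j)
  case 0
  then show ?case using assms by (intro exI[of _ r]) (auto simp: has_dps_def dps_conv_pos)
next
  case (Suc j)
  then obtain s where "s > 0" "has_dps ((partial_y ^^ j) f) p ((dps_dy ^^ j) c) s" by blast
  then show ?case using has_dps_partial_y[of _ p _ s "s / 2"] by (intro exI[of _ "s / 2"]) auto
qed

text \<open>Dividing by the largest power \<open>(v $ 1 - p $ 1) ^ k\<close> turns the germ of \<open>g\<close> at \<open>p\<close> into one
  that does not vanish on the vertical line through \<open>p\<close>; \<open>d\<close> is its order along that line.\<close>

lemma local_form:
  fixes p :: "real^2"
  assumes "real_analytic g"
  shows "\<exists>r>0. (\<forall>x y. \<bar>x\<bar> < r \<longrightarrow> \<bar>y\<bar> < r \<longrightarrow> g (pt (p $ 1 + x) (p $ 2 + y)) = 0) \<or>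
    (\<exists>k d e. (\<forall>j\<le>d. dps_conv (e j) r \<and> (\<exists>l. e j 0 l \<noteq> 0) \<and>
        (\<forall>x y. \<bar>x\<bar> < r \<longrightarrow> \<bar>y\<bar> < r \<longrightarrow>
           (partial_y ^^ j) g (pt (p $ 1 + x) (p $ 2 + y)) = x ^ k * dps (e j) x y)) \<and>
      (\<forall>x y::real. \<bar>x\<bar> < r \<longrightarrow> \<bar>y\<bar> < r \<longrightarrow> dps (e d) x y \<noteq> 0))"
proof -
  obtain c r0 where h: "has_dps g p c r0" using assms unfolding real_analytic_def real_analytic_at_iff by blast
  then have c: "dps_conv c r0" and r0: "0 < r0" by (auto simp: has_dps_def dps_conv_pos)
  show ?thesis
  proof (cases "\<forall>i j. c i j = 0")
    case True
    then have "dps c x y = 0" for x y :: real by (simp add: dps_def case_prod_unfold)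
    then show ?thesis using h r0 by (intro exI[of _ r0]) (simp add: has_dps_def)
  next
    case False
    \<comment> \<open>The least power of \<open>x\<close> in the expansion. The factor
      \<open>x ^ k\<close> does not involve \<open>y\<close>, so it passes through every vertical
      derivative and leaves the quotient \<open>e j\<close>.\<close>
    define k where "k = (LEAST k. \<exists>j. c k j \<noteq> 0)"
    have k: "\<exists>j. c k j \<noteq> 0" unfolding k_def by (rule LeastI_ex) (use False in blast)
    have k0: "c i j = 0" if "i < k" for i j
      using not_less_Least[of i "\<lambda>k. \<exists>j. c k j \<noteq> 0"] that by (auto simp: k_def)
    define d where "d = (LEAST d. c k d \<noteq> 0)"
    have d: "c k d \<noteq> 0" unfolding d_def using k by (rule LeastI_ex)
    define e where "e j = dps_shift k ((dps_dy ^^ j) c)" for j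
    obtain s where s: "\<And>j. s j > 0" "\<And>j. has_dps ((partial_y ^^ j) g) p ((dps_dy ^^ j) c) (s j)"
      using has_dps_funpow_partial_y[OF h] by metis
    define r1 where "r1 = Min (s ` {..d})"
    have r1: "0 < r1" "\<And>j. j \<le> d \<Longrightarrow> r1 \<le> s j" using s(1) by (auto simp: r1_def)
    have h1: "has_dps ((partial_y ^^ j) g) p ((dps_dy ^^ j) c) r1" if "j \<le> d" for j
      using s(2) r1 that by (blast intro: has_dps_mono)
    have ce: "dps_conv (e j) r1" if "j \<le> d" for j
      using h1[OF that] unfolding e_def by (intro dps_conv_shift) (simp add: has_dps_def)
    \<comment> \<open>This constant term is \<open>fact d * c k d\<close>; by continuity the
      \<open>d\<close>-th quotient has no zero near the centre.\<close>
    have "e d 0 0 \<noteq> 0" using d by (simp add: e_def dps_shift_def dps_dy_funpow)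
    then have "dps (e d) 0 (0::real) \<noteq> 0" by (simp add: dps_0_0)
    moreover have "isCont (\<lambda>q. dps (e d) (fst q) (snd q :: real)) (0, 0)"
      by (rule continuous_on_interior[OF continuous_on_dps[OF ce[OF order_refl]]])
        (simp add: interior_Times r1)
    then have "filterlim (\<lambda>q. dps (e d) (fst q) (snd q :: real)) (nhds (dps (e d) 0 0)) (nhds (0, 0))"
      using tendsto_at_iff_tendsto_nhds[of "\<lambda>q. dps (e d) (fst q) (snd q :: real)" "(0, 0)"]
      by (simp add: isCont_def)
    ultimately have "\<forall>\<^sub>F q in nhds (0, 0). dps (e d) (fst q) (snd q :: real) \<noteq> 0"
      by (intro tendsto_imp_eventually_ne)
    then obtain r2 where r2: "r2 > 0" "\<And>q. dist q (0, 0) < r2 \<Longrightarrow> dps (e d) (fst q) (snd q :: real) \<noteq> 0"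
      unfolding eventually_nhds_metric by blast
    define r where "r = min r1 (r2 / 2)"
    have r: "0 < r" "r \<le> r1" "2 * r \<le> r2" using r1 r2 by (auto simp: r_def)
    have "dps (e d) x y \<noteq> 0" if "\<bar>x\<bar> < r" "\<bar>y\<bar> < r" for x y :: real
    proof -
      have "dist (x, y) (0, 0) \<le> \<bar>x\<bar> + \<bar>y\<bar>"
        using norm_Pair_le[of x y] by (simp add: dist_norm zero_prod_def[symmetric])
      then show ?thesis using r2(2)[of "(x, y)"] that r by simp
    qed
    moreover have "dps_conv (e j) r" if "j \<le> d" for j
      using ce[OF that] r by (blast intro: dps_conv_mono)
    moreover have "\<exists>l. e j 0 l \<noteq> 0" if "j \<le> d" for j
      \<comment> \<open>The coefficient of index \<open>d - j\<close> is again a nonzero multiple of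
        \<open>c k d\<close>.\<close>
      using d that by (intro exI[of _ "d - j"]) (simp add: e_def dps_shift_def dps_dy_funpow)
    moreover have "(partial_y ^^ j) g (pt (p $ 1 + x) (p $ 2 + y)) = x ^ k * dps (e j) x y"
      if "j \<le> d" "\<bar>x\<bar> < r" "\<bar>y\<bar> < r" for j x y
    proof -
      have "(partial_y ^^ j) g (pt (p $ 1 + x) (p $ 2 + y)) = dps ((dps_dy ^^ j) c) x y"
        using h1[OF that(1)] that r by (simp add: has_dps_def)
      also have "\<dots> = x ^ k * dps (e j) x y"
        unfolding e_def using h1[OF that(1)] that r
        by (intro dps_shift[of _ r1]) (auto simp: has_dps_def dps_dy_funpow k0)
      finally show ?thesis .
    qed
    ultimately show ?thesis using r(1) by (intro exI[of _ r] conjI disjI2 exI[of _ k] exI[of _ d] exI[of _ e]) blast+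
  qed
qed

text \<open>Thom's lemma, with a nonvanishing derivative in place of the leading coefficient of a polynomial.\<close>

lemma thom:
  fixes D :: "nat \<Rightarrow> real \<Rightarrow> real"
  assumes deriv: "\<And>j t. j \<le> d \<Longrightarrow> l \<le> t \<Longrightarrow> t \<le> u \<Longrightarrow> (D j has_real_derivative D (Suc j) t) (at t)"
    and nz: "\<And>t. l \<le> t \<Longrightarrow> t \<le> u \<Longrightarrow> D d t \<noteq> 0"
    and sgn: "\<And>j. j \<le> d \<Longrightarrow> D j l \<noteq> 0 \<and> sgn (D j l) = sgn (D j u)"
    and t: "j \<le> d" "l \<le> t" "t \<le> u"
  shows "D j t \<noteq> 0"
proof -
  have "\<forall>t. l \<le> t \<and> t \<le> u \<longrightarrow> sgn (D j t) = sgn (D j l)"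
    using t(1)
  \<comment> \<open>Downward induction from \<open>d\<close>: a derivative of constant sign makes
    the function before it monotone, and equal signs at both ends then fix its sign in
    between.\<close>
  proof (induction j rule: inc_induct)
    case base
    show ?case
    proof (intro allI impI, rule ccontr)
      fix t assume t: "l \<le> t \<and> t \<le> u" and "sgn (D d t) \<noteq> sgn (D d l)"
      moreover have cont: "\<forall>x. l \<le> x \<and> x \<le> t \<longrightarrow> isCont (D d) x"
        using t by (auto intro!: DERIV_isCont[OF deriv])
      moreover have "D d t \<noteq> 0" "D d l \<noteq> 0" using nz t by auto
      ultimately consider "D d l \<le> 0" "0 \<le> D d t" | "D d t \<le> 0" "0 \<le> D d l"
        by (force simp: sgn_if split: if_splits)
      then obtain x where "l \<le> x" "x \<le> t" "D d x = 0"
        using IVT[of "D d" l 0 t] IVT2[of "D d" t 0 l] t cont by metis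
      then show False using nz t by auto
    qed
  next
    case (step j)
    show ?case
    proof (intro allI impI)
      fix t assume t: "l \<le> t \<and> t \<le> u"
      have d: "(D j has_real_derivative D (Suc j) x) (at x)" if "l \<le> x" "x \<le> u" for x
        using deriv step that by auto
      have S: "sgn (D (Suc j) x) = sgn (D (Suc j) l)" if "l \<le> x" "x \<le> u" for x
        using step that by blast
      have sj: "D j l \<noteq> 0" "sgn (D j l) = sgn (D j u)" using sgn[of j] step by auto
      have "D j l \<le> D j t \<and> D j t \<le> D j u \<or> D j u \<le> D j t \<and> D j t \<le> D j l"
      proof (cases "D (Suc j) l \<ge> 0")
        case True
        then have "D (Suc j) x \<ge> 0" if "l \<le> x" "x \<le> u" for x
          using S[OF that] by (auto simp: sgn_if split: if_splits)
        then show ?thesis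
          using t d DERIV_nonneg_imp_nondecreasing[of l t "D j"] DERIV_nonneg_imp_nondecreasing[of t u "D j"]
          by (meson order_trans)
      next
        case False
        then have "D (Suc j) x \<le> 0" if "l \<le> x" "x \<le> u" for x
          using S[OF that] by (auto simp: sgn_if split: if_splits)
        then show ?thesis
          using t d DERIV_nonpos_imp_nonincreasing[of l t "D j"] DERIV_nonpos_imp_nonincreasing[of t u "D j"]
          by (meson order_trans)
      qed
      then show "sgn (D j t) = sgn (D j l)"
        using sj by (auto simp: sgn_if split: if_splits)
    qed
  qed
  then show ?thesis using t sgn[OF t(1)] by (metis sgn_0_0)
qed

section \<open>Decompositions\<close>

definition rect :: "real \<Rightarrow> real \<Rightarrow> real \<Rightarrow> real \<Rightarrow> (real^2) set" where
  "rect c d y1 y2 = {v. c < v $ 1 \<and> v $ 1 < d \<and> y1 < v $ 2 \<and> v $ 2 < y2}"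

text \<open>The pieces need only be dense in \<open>S\<close>; boundary curves and cut lines belong
  to none of them. Pieces outside \<open>Y\<close> are kept, so that density refers to the rectangle
  alone and can be glued.\<close>

definition decomposes :: "(real^2) set set \<Rightarrow> (real^2) set \<Rightarrow> (real^2) set \<Rightarrow> bool" where
  "decomposes \<Q> Y S \<longleftrightarrow> finite \<Q> \<and> disjoint \<Q> \<and>
     (\<forall>Q\<in>\<Q>. curved_triangle Q \<and> Q \<subseteq> S \<and> (Q \<subseteq> Y \<or> Q \<inter> Y = {})) \<and> S \<subseteq> closure (\<Union>\<Q>)"

lemma decomposesD:
  assumes "decomposes \<Q> Y S"
  shows "finite \<Q>" "disjoint \<Q>" "Q \<in> \<Q> \<Longrightarrow> curved_triangle Q" "Q \<in> \<Q> \<Longrightarrow> Q \<subseteq> S"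
    "Q \<in> \<Q> \<Longrightarrow> Q \<subseteq> Y \<or> Q \<inter> Y = {}" "S \<subseteq> closure (\<Union>\<Q>)"
  using assms unfolding decomposes_def by blast+

lemma open_rect: "open (rect c d y1 y2)"
proof -
  have "rect c d y1 y2 = {v. c < v $ 1} \<inter> {v. v $ 1 < d} \<inter> {v. y1 < v $ 2} \<inter> {v. v $ 2 < y2}"
    by (auto simp: rect_def)
  then show ?thesis by (auto intro!: open_Int open_Collect_less continuous_intros)
qed

lemma decomposes_empty: "decomposes {} Y {}"
  by (simp add: decomposes_def)

text \<open>\<open>U\<close> may contain more than \<open>S\<close> and \<open>T\<close>, as long as
  the rest, such as a common edge, lies in their closure.\<close>

lemma decomposes_Un:
  assumes "decomposes \<Q> Y S" "decomposes \<R> Y T" "S \<inter> T = {}" "S \<union> T \<subseteq> U" "U \<subseteq> closure (S \<union> T)"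
  shows "decomposes (\<Q> \<union> \<R>) Y U"
  unfolding decomposes_def
proof (intro conjI ballI)
  note Q = decomposesD[OF assms(1)] and R = decomposesD[OF assms(2)]
  show "finite (\<Q> \<union> \<R>)" using Q(1) R(1) by blast
  have "A \<inter> B = {}" if "A \<in> \<Q>" "B \<in> \<R>" for A B
    using Q(4)[OF that(1)] R(4)[OF that(2)] assms(3) by blast
  then show "disjoint (\<Q> \<union> \<R>)"
    using Q(2) R(2) unfolding disjoint_def by (metis Int_commute Un_iff)
  have "closure (\<Union>\<Q>) \<subseteq> closure (\<Union>(\<Q> \<union> \<R>))" "closure (\<Union>\<R>) \<subseteq> closure (\<Union>(\<Q> \<union> \<R>))"
    by (rule closure_mono, blast)+
  then have "S \<union> T \<subseteq> closure (\<Union>(\<Q> \<union> \<R>))"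
    using Q(6) R(6) by blast
  then have "closure (S \<union> T) \<subseteq> closure (\<Union>(\<Q> \<union> \<R>))"
    by (rule closure_minimal) (rule closed_closure)
  then show "U \<subseteq> closure (\<Union>(\<Q> \<union> \<R>))" using assms(5) by blast
  fix A assume A: "A \<in> \<Q> \<union> \<R>"
  show "curved_triangle A" "A \<subseteq> U" "A \<subseteq> Y \<or> A \<inter> Y = {}"
    using A Q(3-5)[of A] R(3-5)[of A] assms(4) by blast+
qed

lemma open_minus_line_dense:
  fixes S :: "(real^2) set"
  assumes "open S"
  shows "S \<subseteq> closure (S - {v. v $ i = t})"
proof
  fix v assume v: "v \<in> S"
  show "v \<in> closure (S - {v. v $ i = t})"
  proof (cases "v $ i = t")
    case True
    obtain r where r: "r > 0" "cball v r \<subseteq> S" using assms v open_contains_cball by blast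
    show ?thesis
      unfolding closure_approachable
    proof (intro allI impI)
      fix \<epsilon> :: real assume "0 < \<epsilon>"
      define q where "q = min r (\<epsilon> / 2)"
      have q: "0 < q" "q \<le> r" "q < \<epsilon>" using r \<open>0 < \<epsilon>\<close> by (auto simp: q_def)
      have "dist (v + q *\<^sub>R axis i 1) v = q" using q by (simp add: dist_norm)
      moreover have "v + q *\<^sub>R axis i 1 \<in> cball v r" using q by (simp add: dist_norm)
      moreover have "(v + q *\<^sub>R axis i 1) $ i \<noteq> t" using True q by (simp add: axis_def)
      ultimately show "\<exists>y\<in>S - {v. v $ i = t}. dist y v < \<epsilon>"
        using r q by (intro bexI[of _ "v + q *\<^sub>R axis i 1"]) auto
    qed
  qed (use v closure_subset[of "S - {v. v $ i = t}"] in blast)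
qed

lemma decomposes_rect_join:
  assumes "c \<le> m" "m \<le> d"
    and "decomposes \<Q> Y (rect c m y1 y2)" "decomposes \<R> Y (rect m d y1 y2)"
  shows "decomposes (\<Q> \<union> \<R>) Y (rect c d y1 y2)"
proof (rule decomposes_Un[OF assms(3,4)])
  have "rect c d y1 y2 - {v. v $ 1 = m} \<subseteq> rect c m y1 y2 \<union> rect m d y1 y2"
    by (auto simp: rect_def)
  then show "rect c d y1 y2 \<subseteq> closure (rect c m y1 y2 \<union> rect m d y1 y2)"
    using open_minus_line_dense[OF open_rect, of c d y1 y2 1 m] closure_mono by blast
qed (use assms(1,2) in \<open>auto simp: rect_def\<close>)

lemma decomposes_rect_stack:
  assumes "y1 \<le> m" "m \<le> y2"
    and "decomposes \<Q> Y (rect c d y1 m)" "decomposes \<R> Y (rect c d m y2)"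
  shows "decomposes (\<Q> \<union> \<R>) Y (rect c d y1 y2)"
proof (rule decomposes_Un[OF assms(3,4)])
  have "rect c d y1 y2 - {v. v $ 2 = m} \<subseteq> rect c d y1 m \<union> rect c d m y2"
    by (auto simp: rect_def)
  then show "rect c d y1 y2 \<subseteq> closure (rect c d y1 m \<union> rect c d m y2)"
    using open_minus_line_dense[OF open_rect, of c d y1 y2 2 m] closure_mono by blast
qed (use assms(1,2) in \<open>auto simp: rect_def\<close>)

text \<open>For open \<open>U\<close> the part of a closure inside \<open>U\<close> is approached
  from within \<open>U\<close>, so density survives when \<open>U\<close> splits no piece.\<close>

lemma decomposes_restrict:
  assumes "decomposes \<Q> Y S" "open U" "\<And>Q. Q \<in> \<Q> \<Longrightarrow> Q \<subseteq> U \<or> Q \<inter> U = {}"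
  shows "decomposes {Q\<in>\<Q>. Q \<subseteq> U} Y (S \<inter> U)"
proof -
  note Q = decomposesD[OF assms(1)]
  have "S \<inter> U \<subseteq> U \<inter> closure (\<Union>\<Q>)" using Q(6) by blast
  also have "\<dots> \<subseteq> closure (U \<inter> \<Union>\<Q>)" by (rule open_Int_closure_subset[OF assms(2)])
  also have "U \<inter> \<Union>\<Q> \<subseteq> \<Union>{Q\<in>\<Q>. Q \<subseteq> U}" using assms(3) by blast
  then have "closure (U \<inter> \<Union>\<Q>) \<subseteq> closure (\<Union>{Q\<in>\<Q>. Q \<subseteq> U})" by (rule closure_mono)
  finally have *: "S \<inter> U \<subseteq> closure (\<Union>{Q\<in>\<Q>. Q \<subseteq> U})" .
  show ?thesis
    unfolding decomposes_def
  proof (intro conjI ballI)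
    show "finite {Q\<in>\<Q>. Q \<subseteq> U}" using Q(1) by simp
    show "disjoint {Q\<in>\<Q>. Q \<subseteq> U}" using Q(2) by (simp add: disjoint_def)
    fix A assume A: "A \<in> {Q\<in>\<Q>. Q \<subseteq> U}"
    show "curved_triangle A" "A \<subseteq> S \<inter> U" "A \<subseteq> Y \<or> A \<inter> Y = {}"
      using A Q(3-5)[of A] by blast+
  qed (rule *)
qed

section \<open>Stacks of cells between consecutive levels\<close>

context
  fixes c d :: real and n :: nat and \<Phi> :: "nat \<Rightarrow> real \<Rightarrow> real" and y1 y2 :: real
  assumes cd: "c < d" and n: "0 < n"
    and cont: "\<And>i. i \<le> n \<Longrightarrow> continuous_on {c..d} (\<Phi> i)"
    and bot: "\<And>x. c < x \<Longrightarrow> x < d \<Longrightarrow> \<Phi> 0 x = y1"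
    and top: "\<And>x. c < x \<Longrightarrow> x < d \<Longrightarrow> \<Phi> n x = y2"
    and step: "\<And>x i. c < x \<Longrightarrow> x < d \<Longrightarrow> i < n \<Longrightarrow> \<Phi> i x < \<Phi> (Suc i) x"
begin

lemma levels_mono:
  assumes "c < x" "x < d" "i \<le> j" "j \<le> n"
  shows "\<Phi> i x \<le> \<Phi> j x"
  using assms(3,4)
proof (induction j rule: dec_induct)
  case (step j)
  then show ?case using assms(1,2) \<open>\<And>x i. _ \<Longrightarrow> _ \<Longrightarrow> _ \<Longrightarrow> \<Phi> i x < \<Phi> (Suc i) x\<close>[of x j] by auto
qed simp

lemma cell_subset_rect:
  assumes "i < n"
  shows "graph_cell c d (\<Phi> i) (\<Phi> (Suc i)) \<subseteq> rect c d y1 y2"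
proof
  fix v assume v: "v \<in> graph_cell c d (\<Phi> i) (\<Phi> (Suc i))"
  then have x: "c < v $ 1" "v $ 1 < d" by (auto simp: graph_cell_def)
  have "\<Phi> 0 (v $ 1) \<le> \<Phi> i (v $ 1)" "\<Phi> (Suc i) (v $ 1) \<le> \<Phi> n (v $ 1)"
    using levels_mono[OF x] assms by auto
  then show "v \<in> rect c d y1 y2"
    using v bot[OF x] top[OF x] by (auto simp: rect_def graph_cell_def)
qed

lemma level_not_in_cell:
  assumes "pt x y \<in> graph_cell c d (\<Phi> i) (\<Phi> (Suc i))" "i < n" "j \<le> n"
  shows "y \<noteq> \<Phi> j x"
proof -
  have x: "c < x" "x < d" "\<Phi> i x < y" "y < \<Phi> (Suc i) x" using assms(1) by (auto simp: graph_cell_def)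
  consider "j \<le> i" | "Suc i \<le> j" by linarith
  then show ?thesis
    using levels_mono[OF x(1,2)] x assms(2,3) by cases fastforce+
qed

text \<open>Density already holds on each vertical line: only finitely many of its points lie on
  levels, so arbitrarily close to a given point there is one strictly between two consecutive
  levels.\<close>

lemma cells_decompose:
  assumes semi: "\<And>i. i < n \<Longrightarrow> semianalytic (graph_cell c d (\<Phi> i) (\<Phi> (Suc i)))"
    and Y: "\<And>i. i < n \<Longrightarrow> graph_cell c d (\<Phi> i) (\<Phi> (Suc i)) \<subseteq> Y \<or> graph_cell c d (\<Phi> i) (\<Phi> (Suc i)) \<inter> Y = {}"
  shows "decomposes ((\<lambda>i. graph_cell c d (\<Phi> i) (\<Phi> (Suc i))) ` {..<n}) Y (rect c d y1 y2)"
  unfolding decomposes_def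
proof (intro conjI ballI)
  let ?C = "\<lambda>i. graph_cell c d (\<Phi> i) (\<Phi> (Suc i))"
  have disj: "?C i \<inter> ?C j = {}" if "i < j" "j < n" for i j
  proof -
    have "\<Phi> (Suc i) x \<le> \<Phi> j x" if "c < x" "x < d" for x
      using levels_mono[OF that] \<open>i < j\<close> \<open>j < n\<close> by auto
    then show ?thesis by (fastforce simp: graph_cell_def)
  qed
  show "disjoint (?C ` {..<n})"
    unfolding disjoint_def
  proof (intro ballI impI)
    fix A B assume "A \<in> ?C ` {..<n}" "B \<in> ?C ` {..<n}" "A \<noteq> B"
    then obtain i j where ij: "A = ?C i" "B = ?C j" "i < n" "j < n" "i \<noteq> j" by auto
    then show "A \<inter> B = {}" using disj[of i j] disj[of j i] by (cases "i < j") auto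
  qed
  show "rect c d y1 y2 \<subseteq> closure (\<Union>(?C ` {..<n}))"
  proof
    fix v assume v: "v \<in> rect c d y1 y2"
    then have x: "c < v $ 1" "v $ 1 < d" and y: "y1 < v $ 2" "v $ 2 < y2" by (auto simp: rect_def)
    show "v \<in> closure (\<Union>(?C ` {..<n}))"
      unfolding closure_approachable
    proof (intro allI impI)
      fix \<epsilon> :: real assume "0 < \<epsilon>"
      have "infinite ({v $ 2<..<min y2 (v $ 2 + \<epsilon>)} - (\<lambda>i. \<Phi> i (v $ 1)) ` {..n})"
        using y \<open>0 < \<epsilon>\<close> by (intro Diff_infinite_finite) (auto simp: infinite_Ioo)
      then obtain y' where y': "y' \<in> {v $ 2<..<min y2 (v $ 2 + \<epsilon>)} - (\<lambda>i. \<Phi> i (v $ 1)) ` {..n}"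
        using infinite_imp_nonempty by blast
      \<comment> \<open>The last level below \<open>y'\<close> is the floor of the cell that
        contains it.\<close>
      define I where "I = {i\<in>{..n}. \<Phi> i (v $ 1) < y'}"
      have I: "finite I" "0 \<in> I" using y y' bot[OF x] by (auto simp: I_def)
      define i where "i = Max I"
      have "i \<in> I" unfolding i_def using I by (intro Max_in) auto
      have "n \<notin> I" using y' top[OF x] by (auto simp: I_def)
      then have i: "i < n" using \<open>i \<in> I\<close> by (auto simp: I_def le_less)
      have "Suc i \<notin> I" using Max_ge[OF I(1), of "Suc i"] by (auto simp: i_def)
      then have "y' \<le> \<Phi> (Suc i) (v $ 1)" using i by (auto simp: I_def)
      moreover have "y' \<noteq> \<Phi> (Suc i) (v $ 1)" using y' i by auto
      ultimately have "pt (v $ 1) y' \<in> ?C i"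
        using \<open>i \<in> I\<close> x by (auto simp: graph_cell_def I_def)
      moreover have "dist (pt (v $ 1) y') v < \<epsilon>"
      proof -
        have "pt (v $ 1) y' - v = pt 0 (y' - v $ 2)" by (simp add: vec_eq_iff forall_2)
        then have "dist (pt (v $ 1) y') v \<le> \<bar>y' - v $ 2\<bar>"
          using norm_pt_le[of 0 "y' - v $ 2"] by (simp add: dist_norm)
        then show ?thesis using y' by auto
      qed
      ultimately show "\<exists>w\<in>\<Union>(?C ` {..<n}). dist w v < \<epsilon>" using i by blast
    qed
  qed
  fix Q assume "Q \<in> ?C ` {..<n}"
  then obtain i where i: "i < n" "Q = ?C i" by auto
  show "curved_triangle Q"
    unfolding i using i cd cont step semi by (intro graph_cell_curved_triangle) auto
  show "Q \<subseteq> rect c d y1 y2" unfolding i using cell_subset_rect i by blast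
  show "Q \<subseteq> Y \<or> Q \<inter> Y = {}" unfolding i using Y i by blast
qed simp

lemma connected_cell:
  assumes "i < n"
  shows "connected (graph_cell c d (\<Phi> i) (\<Phi> (Suc i)))"
proof -
  have "graph_cell c d (\<Phi> i) (\<Phi> (Suc i)) homeomorphic ball (0::real^2) 1"
    using cd cont step assms by (intro graph_cell_homeomorphic_ball) auto
  then show ?thesis using homeomorphic_connectedness connected_ball by blast
qed

end

section \<open>Signs on a stack and the local decomposition\<close>

lemma sign_constant:
  fixes f :: "'a::topological_space \<Rightarrow> real"
  assumes "connected S" "continuous_on S f" "\<And>v. v \<in> S \<Longrightarrow> f v \<noteq> 0" "v \<in> S" "w \<in> S"
  shows "0 < f v \<longleftrightarrow> 0 < f w"
proof -
  have "connected (f ` S)" using assms by (intro connected_continuous_image)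
  then have "0 \<in> f ` S" if "a \<in> f ` S" "b \<in> f ` S" "a \<le> 0" "0 \<le> b" for a b
    using connectedD_interval that by metis
  moreover have "f v \<in> f ` S" "f w \<in> f ` S" "0 \<notin> f ` S" using assms by auto
  ultimately show ?thesis by (meson less_imp_le not_le)
qed

lemma rect_semianalytic: "semianalytic (rect c d y1 y2)"
proof -
  have "real_analytic (\<lambda>v. v $ 1 - c)" "real_analytic (\<lambda>v. d - v $ 1)"
    "real_analytic (\<lambda>v. v $ 2 - y1)" "real_analytic (\<lambda>v. y2 - v $ 2)"
    using real_analytic_affine[of 1 0 "-c"] real_analytic_affine[of "-1" 0 d]
      real_analytic_affine[of 0 1 "-y1"] real_analytic_affine[of 0 "-1" y2] by simp_all
  from this[THEN semianalytic_greater_0]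
  have "semianalytic ({v. 0 < v $ 1 - c} \<inter> {v. 0 < d - v $ 1} \<inter> {v. 0 < v $ 2 - y1} \<inter> {v. 0 < y2 - v $ 2})"
    by (intro semianalytic_Int)
  moreover have "{v. 0 < v $ 1 - c} \<inter> {v. 0 < d - v $ 1} \<inter> {v. 0 < v $ 2 - y1} \<inter> {v. 0 < y2 - v $ 2} = rect c d y1 y2"
    by (auto simp: rect_def)
  ultimately show ?thesis by simp
qed

text \<open>The sign vector of the family \<open>(partial_y ^^ j) g\<close> cuts a stack of cells apart: between two
  different cells on a vertical line lies a zero of some member, which Thom's lemma excludes.\<close>

lemma cell_semianalytic:
  fixes d :: "'g \<Rightarrow> nat" and h :: "'g \<Rightarrow> real^2 \<Rightarrow> real"
  assumes cd: "c < d'" and n: "0 < n"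
    and cont: "\<And>i. i \<le> n \<Longrightarrow> continuous_on {c..d'} (\<Phi> i)"
    and bot: "\<And>x. c < x \<Longrightarrow> x < d' \<Longrightarrow> \<Phi> 0 x = y1"
    and top: "\<And>x. c < x \<Longrightarrow> x < d' \<Longrightarrow> \<Phi> n x = y2"
    and step: "\<And>x i. c < x \<Longrightarrow> x < d' \<Longrightarrow> i < n \<Longrightarrow> \<Phi> i x < \<Phi> (Suc i) x"
    and N: "finite N" "\<And>g. g \<in> N \<Longrightarrow> real_analytic (h g)"
    and nz: "\<And>g x y. g \<in> N \<Longrightarrow> c < x \<Longrightarrow> x < d' \<Longrightarrow> y1 < y \<Longrightarrow> y < y2 \<Longrightarrow>
        (partial_y ^^ d g) (h g) (pt x y) \<noteq> 0"
    and zeros: "\<And>x y. c < x \<Longrightarrow> x < d' \<Longrightarrow> y1 < y \<Longrightarrow> y < y2 \<Longrightarrow>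
        (\<exists>g\<in>N. \<exists>j\<le>d g. (partial_y ^^ j) (h g) (pt x y) = 0) \<longleftrightarrow> (\<exists>i. 0 < i \<and> i < n \<and> y = \<Phi> i x)"
    and i: "i < n"
  shows "semianalytic (graph_cell c d' (\<Phi> i) (\<Phi> (Suc i)))"
    and "\<And>g j v. g \<in> N \<Longrightarrow> j \<le> d g \<Longrightarrow> v \<in> graph_cell c d' (\<Phi> i) (\<Phi> (Suc i)) \<Longrightarrow> (partial_y ^^ j) (h g) v \<noteq> 0"
    and "\<And>g j v w. g \<in> N \<Longrightarrow> j \<le> d g \<Longrightarrow> v \<in> graph_cell c d' (\<Phi> i) (\<Phi> (Suc i)) \<Longrightarrow> w \<in> graph_cell c d' (\<Phi> i) (\<Phi> (Suc i)) \<Longrightarrow>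
        0 < (partial_y ^^ j) (h g) v \<longleftrightarrow> 0 < (partial_y ^^ j) (h g) w"
proof -
  let ?C = "graph_cell c d' (\<Phi> i) (\<Phi> (Suc i))"
  note stack = cd n cont bot top step
  define H where "H = Sigma N (\<lambda>g. {..d g})"
  define D where "D p = (partial_y ^^ snd p) (h (fst p))" for p
  have H: "finite H" "\<And>p. p \<in> H \<Longrightarrow> real_analytic (D p)"
    using N by (auto simp: H_def D_def real_analytic_funpow_partial_y)
  have sub: "?C \<subseteq> rect c d' y1 y2"
    by (rule cell_subset_rect[OF stack i])
  have Dnz: "D p v \<noteq> 0" if p: "p \<in> H" and v: "v \<in> ?C" for p v
  proof
    assume "D p v = 0"
    moreover have "pt (v $ 1) (v $ 2) = v" by (rule pt_eta)
    ultimately have "\<exists>g\<in>N. \<exists>j\<le>d g. (partial_y ^^ j) (h g) (pt (v $ 1) (v $ 2)) = 0"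
      using p by (intro bexI[of _ "fst p"] exI[of _ "snd p"]) (auto simp: H_def D_def)
    moreover have "c < v $ 1" "v $ 1 < d'" "y1 < v $ 2" "v $ 2 < y2"
      using v sub by (auto simp: rect_def)
    ultimately obtain i' where i': "i' < n" "v $ 2 = \<Phi> i' (v $ 1)" using zeros by blast
    have "pt (v $ 1) (v $ 2) \<in> ?C" using v by (simp add: pt_eta)
    from level_not_in_cell[OF stack this i, of i'] i' show False by simp
  qed
  have Dsgn: "0 < D p v \<longleftrightarrow> 0 < D p w" if "p \<in> H" "v \<in> ?C" "w \<in> ?C" for p v w
    by (rule sign_constant[OF connected_cell[OF stack i]])
       (use that Dnz H real_analytic_continuous_on in blast)+
  show "(partial_y ^^ j) (h g) v \<noteq> 0" if "g \<in> N" "j \<le> d g" "v \<in> ?C" for g j v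
    using Dnz[of "(g, j)" v] that by (simp add: H_def D_def)
  show "0 < (partial_y ^^ j) (h g) v \<longleftrightarrow> 0 < (partial_y ^^ j) (h g) w"
    if "g \<in> N" "j \<le> d g" "v \<in> ?C" "w \<in> ?C" for g j v w
    using Dsgn[of "(g, j)" v w] that by (simp add: H_def D_def)
  define mid where "mid x = pt x ((\<Phi> i x + \<Phi> (Suc i) x) / 2)" for x
  have mid: "mid x \<in> ?C" if "c < x" "x < d'" for x
    using step[OF that i] that by (simp add: mid_def graph_cell_def)
  define w where "w = mid ((c + d') / 2)"
  have w: "w \<in> ?C" unfolding w_def using cd by (intro mid) auto
  \<comment> \<open>The constant sign of each function on the cell, read off at the sample point
    \<open>w\<close>.\<close>
  define S where "S p = (if 0 < D p w then {v. 0 < D p v} else {v. D p v < 0})" for p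
  have "semianalytic (rect c d' y1 y2 \<inter> (\<Inter>p\<in>H. S p))"
  proof (intro semianalytic_Int semianalytic_INT rect_semianalytic H(1))
    show "semianalytic (S p)" if "p \<in> H" for p
      using H(2)[OF that] semianalytic_less_0 semianalytic_greater_0 by (auto simp: S_def)
  qed
  also have "rect c d' y1 y2 \<inter> (\<Inter>p\<in>H. S p) = ?C"
  proof
    show "?C \<subseteq> rect c d' y1 y2 \<inter> (\<Inter>p\<in>H. S p)"
    proof (intro subsetI IntI INT_I)
      fix v p assume v: "v \<in> ?C" and p: "p \<in> H"
      show "v \<in> S p"
        using Dsgn[OF p v w] Dnz[OF p v] by (auto simp: S_def linorder_neq_iff)
    qed (use sub in blast)
    show "rect c d' y1 y2 \<inter> (\<Inter>p\<in>H. S p) \<subseteq> ?C"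
    proof
      fix v assume v: "v \<in> rect c d' y1 y2 \<inter> (\<Inter>p\<in>H. S p)"
      define x y where "x = v $ 1" and "y = v $ 2"
      have vxy: "v = pt x y" by (simp add: x_def y_def pt_eta)
      have xy: "c < x" "x < d'" "y1 < y" "y < y2" using v by (auto simp: rect_def x_def y_def)
      have sv: "D p v \<noteq> 0" "0 < D p v \<longleftrightarrow> 0 < D p w" if "p \<in> H" for p
      proof -
        have "v \<in> S p" using v that by blast
        then show "D p v \<noteq> 0" "0 < D p v \<longleftrightarrow> 0 < D p w" by (auto simp: S_def split: if_splits)
      qed
      show "v \<in> ?C"
      proof (rule ccontr)
        assume "v \<notin> ?C"
        then have outside: "y \<le> \<Phi> i x \<or> \<Phi> (Suc i) x \<le> y"
          using xy by (auto simp: graph_cell_def x_def y_def)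
        \<comment> \<open>\<open>m\<close> lies in the cell on the vertical line of
          \<open>v\<close>, so one of the two levels that bound the cell lies between
          \<open>y\<close> and \<open>m\<close>.\<close>
        define m where "m = (\<Phi> i x + \<Phi> (Suc i) x) / 2"
        have m: "\<Phi> i x < m" "m < \<Phi> (Suc i) x" "pt x m \<in> ?C"
          using step[OF xy(1,2) i] mid[OF xy(1,2)] by (simp_all add: m_def mid_def)
        have my: "y1 < m" "m < y2" using m(3) sub by (auto simp: rect_def)
        obtain i' where i': "i' = i \<or> i' = Suc i" "min y m \<le> \<Phi> i' x" "\<Phi> i' x \<le> max y m"
        proof (cases "y \<le> \<Phi> i x")
          case True
          then show ?thesis using m(1) by (intro that[of i]) auto
        next
          case False
          then show ?thesis using m(2) outside by (intro that[of "Suc i"]) auto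
        qed
        have i'n: "i' \<le> n" using i' i by auto
        have lev: "y1 < \<Phi> i' x" "\<Phi> i' x < y2" using i'(2,3) xy my by auto
        \<comment> \<open>A level strictly between bottom and top is an inner one, hence a zero of
          some derivative in the family.\<close>
        then have "i' \<noteq> 0" "i' \<noteq> n" using bot[OF xy(1,2)] top[OF xy(1,2)] by (metis less_irrefl)+
        then have "\<exists>i. 0 < i \<and> i < n \<and> \<Phi> i' x = \<Phi> i x" using i'n by (intro exI[of _ i']) auto
        then obtain g j where gj: "g \<in> N" "j \<le> d g" "(partial_y ^^ j) (h g) (pt x (\<Phi> i' x)) = 0"
          using zeros[OF xy(1,2) lev] by blast
        let ?D = "\<lambda>j t. (partial_y ^^ j) (h g) (pt x t)"
        have sg: "?D j' y \<noteq> 0 \<and> ?D j' m \<noteq> 0 \<and> sgn (?D j' y) = sgn (?D j' m)" if "j' \<le> d g" for j'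
        proof -
          have p: "(g, j') \<in> H" using gj(1) that by (simp add: H_def)
          have "0 < D (g, j') v \<longleftrightarrow> 0 < D (g, j') (pt x m)"
            using sv(2)[OF p] Dsgn[OF p m(3) w] by simp
          then show ?thesis
            using sv(1)[OF p] Dnz[OF p m(3)] by (auto simp: D_def vxy sgn_if)
        qed
        have "?D j (\<Phi> i' x) \<noteq> 0"
        \<comment> \<open>All derivatives of \<open>h g\<close> up to order \<open>d g\<close> have
          equal nonzero signs at \<open>y\<close> and \<open>m\<close>, so none vanishes in between,
          contrary to the zero on the level.\<close>
        proof (rule thom[where D = ?D and d = "d g" and l = "min y m" and u = "max y m"])
          show "(?D j' has_real_derivative ?D (Suc j') t) (at t)" for j' t
            using real_analytic_DERIV[OF real_analytic_funpow_partial_y[OF N(2)[OF gj(1)]]] by simp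
          show "?D (d g) t \<noteq> 0" if "min y m \<le> t" "t \<le> max y m" for t
            using that xy my by (intro nz[OF gj(1)]) auto
          show "?D j' (min y m) \<noteq> 0 \<and> sgn (?D j' (min y m)) = sgn (?D j' (max y m))" if "j' \<le> d g" for j'
            using sg[OF that] by (auto simp: min_def max_def)
        qed (use gj i' in auto)
        then show False using gj(3) by simp
      qed
    qed
  qed
  finally show "semianalytic ?C" .
qed

text \<open>This is what membership in the generated Boolean algebra contributes: a set on which the
  signs of \<open>G\<close> are constant lies in \<open>Y\<close> or misses it.\<close>

definition sign_determined :: "(real^2 \<Rightarrow> real) set \<Rightarrow> (real^2) set \<Rightarrow> bool" where
  "sign_determined G Y \<longleftrightarrow> (\<forall>v w. (\<forall>g\<in>G. 0 \<le> g v \<longleftrightarrow> 0 \<le> g w) \<longrightarrow> (v \<in> Y \<longleftrightarrow> w \<in> Y))"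

text \<open>The pieces avoid the height \<open>p $ 2\<close>, so that the box can later be cut
  there. The width \<open>e\<close> depends on the heights, as in
  \<open>local_levels\<close>.\<close>

lemma local_decomposition:
  fixes p :: "real^2"
  assumes G: "finite G" "\<forall>g\<in>G. real_analytic g" and Y: "sign_determined G Y"
  shows "\<exists>\<delta>>0. \<forall>y1 y2. p $ 2 - \<delta> < y1 \<and> y1 < p $ 2 \<and> p $ 2 < y2 \<and> y2 < p $ 2 + \<delta> \<longrightarrow>
      (\<exists>e>0. \<forall>c d. p $ 1 - e < c \<and> c < d \<and> d < p $ 1 + e \<and> (d \<le> p $ 1 \<or> p $ 1 \<le> c) \<longrightarrow>
        (\<exists>\<Q>. decomposes \<Q> Y (rect c d y1 y2) \<and>
          (\<forall>Q\<in>\<Q>. Q \<subseteq> {v. v $ 2 < p $ 2} \<or> Q \<subseteq> {v. p $ 2 < v $ 2})))"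
proof -
  define a b where "a = p $ 1" and "b = p $ 2"
  \<comment> \<open>Its zero set is the horizontal line through \<open>p\<close>; as a member of the
    family it forces every piece to lie above or below.\<close>
  define line where "line = (\<lambda>v::real^2. v $ 2 - b)"
  define G' where "G' = insert line G"
  have "real_analytic line"
    using real_analytic_affine[of 0 1 "- b"] by (simp add: line_def)
  then have G': "finite G'" "\<And>g. g \<in> G' \<Longrightarrow> real_analytic g" using G by (auto simp: G'_def)
  define Zero where "Zero g r \<longleftrightarrow> (\<forall>x y. \<bar>x\<bar> < r \<longrightarrow> \<bar>y\<bar> < r \<longrightarrow> g (pt (a + x) (b + y)) = 0)" for g :: "real^2 \<Rightarrow> real" and r
  define Form where "Form g r k d e \<longleftrightarrow> (\<forall>j\<le>d. dps_conv (e j) r \<and> (\<exists>l. e j 0 l \<noteq> 0) \<and>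
        (\<forall>x y. \<bar>x\<bar> < r \<longrightarrow> \<bar>y\<bar> < r \<longrightarrow>
           (partial_y ^^ j) g (pt (a + x) (b + y)) = x ^ k * dps (e j) x y)) \<and>
      (\<forall>x y::real. \<bar>x\<bar> < r \<longrightarrow> \<bar>y\<bar> < r \<longrightarrow> dps (e d) x y \<noteq> 0)" for g r k and d :: nat and e
  have "\<exists>r>0. Zero g r \<or> (\<exists>k d e. Form g r k d e)" if "g \<in> G'" for g
    using local_form[OF G'(2)[OF that], of p] unfolding Zero_def Form_def a_def b_def .
  then obtain \<rho> where \<rho>: "\<And>g. g \<in> G' \<Longrightarrow> 0 < \<rho> g"
    "\<And>g. g \<in> G' \<Longrightarrow> Zero g (\<rho> g) \<or> (\<exists>k d e. Form g (\<rho> g) k d e)"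
    by metis
  \<comment> \<open>A function that vanishes identically near \<open>p\<close> has constant sign
    there and contributes no curve, so it is left out of the family.\<close>
  define N where "N = {g\<in>G'. \<not> Zero g (\<rho> g)}"
  have N: "finite N" "N \<subseteq> G'" using G' by (auto simp: N_def)
  have "\<forall>g\<in>N. \<exists>k d e. Form g (\<rho> g) k d e" using \<rho>(2) by (auto simp: N_def)
  then obtain k d e where form: "\<And>g. g \<in> N \<Longrightarrow> Form g (\<rho> g) (k g) (d g) (e g)" by metis
  define r where "r = Min (\<rho> ` G')"
  have ne: "G' \<noteq> {}" by (simp add: G'_def)
  have r: "0 < r" "\<And>g. g \<in> G' \<Longrightarrow> r \<le> \<rho> g" using G'(1) ne \<rho>(1) by (auto simp: r_def)
  have lineN: "line \<in> N"
  proof -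
    have "line (pt (a + 0) (b + \<rho> line / 2)) \<noteq> 0" "\<bar>\<rho> line / 2\<bar> < \<rho> line" "\<bar>0\<bar> < \<rho> line"
      using \<rho>(1)[of line] by (auto simp: line_def G'_def)
    then have "\<not> Zero line (\<rho> line)" unfolding Zero_def by blast
    then show ?thesis by (simp add: N_def G'_def)
  qed
  \<comment> \<open>The quotients replace the derivatives, which vanish on the whole vertical line
    through \<open>p\<close> when \<open>k g > 0\<close>. Off that line both have the same
    zeros.\<close>
  define F where "F = (\<Union>g\<in>N. e g ` {..d g})"
  have F: "finite F" "\<forall>f\<in>F. dps_conv f r" "\<forall>f\<in>F. \<exists>l. f 0 l \<noteq> 0"
  proof -
    show "finite F" using N by (simp add: F_def)
    show "\<forall>f\<in>F. dps_conv f r"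
    proof
      fix f assume f: "f \<in> F"
      obtain g j where g: "g \<in> N" "j \<le> d g" "f = e g j" using f by (auto simp: F_def)
      then have "dps_conv f (\<rho> g)" using form[OF g(1)] by (auto simp: Form_def)
      then show "dps_conv f r" by (rule dps_conv_mono) (use r(1) r(2)[of g] N(2) g(1) in auto)
    qed
    show "\<forall>f\<in>F. \<exists>l. f 0 l \<noteq> 0" using form by (auto simp: F_def Form_def)
  qed
  from local_levels[OF F(1) r(1) F(2,3)]
  obtain s where s: "0 < s" "s < r" and levels: "\<forall>y1 y2. - s < y1 \<and> y1 < 0 \<and> 0 < y2 \<and> y2 < s \<longrightarrow> (\<exists>e>0. e < r \<and>
      (\<forall>c d. - e < c \<and> c < d \<and> d < e \<and> (d \<le> 0 \<or> 0 \<le> c) \<longrightarrow>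
        (\<exists>n \<phi>. 0 < n \<and> (\<forall>i\<le>n. continuous_on {c..d} (\<phi> i)) \<and>
          (\<forall>x. c < x \<and> x < d \<longrightarrow> \<phi> 0 x = y1 \<and> \<phi> n x = y2 \<and> (\<forall>i<n. \<phi> i x < \<phi> (Suc i) x) \<and>
             {y. y1 < y \<and> y < y2 \<and> (\<exists>f\<in>F. dps f x y = 0)} = {\<phi> i x |i. 0 < i \<and> i < (n::nat)}))))"
    by (elim exE conjE) (rule that)
  show ?thesis
    unfolding a_def[symmetric] b_def[symmetric]
  proof (rule exI[of _ s], intro conjI allI impI s(1))
    fix y1 y2 assume "b - s < y1 \<and> y1 < b \<and> b < y2 \<and> y2 < b + s"
    then have y: "b - s < y1" "y1 < b" "b < y2" "y2 < b + s" by auto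
    have "- s < y1 - b \<and> y1 - b < 0 \<and> 0 < y2 - b \<and> y2 - b < s" using y by auto
    from levels[rule_format, OF this]
    obtain \<epsilon> where \<epsilon>: "0 < \<epsilon>" "\<epsilon> < r" and lev: "\<forall>c d. - \<epsilon> < c \<and> c < d \<and> d < \<epsilon> \<and> (d \<le> 0 \<or> 0 \<le> c) \<longrightarrow>
        (\<exists>n \<phi>. 0 < n \<and> (\<forall>i\<le>n. continuous_on {c..d} (\<phi> i)) \<and>
          (\<forall>x. c < x \<and> x < d \<longrightarrow> \<phi> 0 x = y1 - b \<and> \<phi> n x = y2 - b \<and> (\<forall>i<n. \<phi> i x < \<phi> (Suc i) x) \<and>
             {y. y1 - b < y \<and> y < y2 - b \<and> (\<exists>f\<in>F. dps f x y = 0)} = {\<phi> i x |i. 0 < i \<and> i < (n::nat)}))"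
      by (elim exE conjE) (rule that)
    have "\<exists>\<Q>. decomposes \<Q> Y (rect c d' y1 y2) \<and> (\<forall>Q\<in>\<Q>. Q \<subseteq> {v. v $ 2 < b} \<or> Q \<subseteq> {v. b < v $ 2})"
      if cd: "a - \<epsilon> < c" "c < d'" "d' < a + \<epsilon>" "d' \<le> a \<or> a \<le> c" for c d'
    proof -
      have "- \<epsilon> < c - a \<and> c - a < d' - a \<and> d' - a < \<epsilon> \<and> (d' - a \<le> 0 \<or> 0 \<le> c - a)"
        using cd by auto
      from lev[rule_format, OF this]
      obtain n \<phi> where n: "0 < n" and \<phi>0: "\<forall>i\<le>n. continuous_on {c - a..d' - a} (\<phi> i)"
        "\<forall>x. c - a < x \<and> x < d' - a \<longrightarrow> \<phi> 0 x = y1 - b \<and> \<phi> n x = y2 - b \<and> (\<forall>i<n. \<phi> i x < \<phi> (Suc i) x) \<and>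
           {y. y1 - b < y \<and> y < y2 - b \<and> (\<exists>f\<in>F. dps f x y = 0)} = {\<phi> i x |i. 0 < i \<and> i < n}"
        by (elim exE conjE) (rule that)
      have \<phi>: "\<And>i. i \<le> n \<Longrightarrow> continuous_on {c - a..d' - a} (\<phi> i)"
        "\<And>x. c - a < x \<Longrightarrow> x < d' - a \<Longrightarrow> \<phi> 0 x = y1 - b"
        "\<And>x. c - a < x \<Longrightarrow> x < d' - a \<Longrightarrow> \<phi> n x = y2 - b"
        "\<And>x i. c - a < x \<Longrightarrow> x < d' - a \<Longrightarrow> i < n \<Longrightarrow> \<phi> i x < \<phi> (Suc i) x"
        "\<And>x. c - a < x \<Longrightarrow> x < d' - a \<Longrightarrow>
           {y. y1 - b < y \<and> y < y2 - b \<and> (\<exists>f\<in>F. dps f x y = 0)} = {\<phi> i x |i. 0 < i \<and> i < n}"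
        using \<phi>0 by (simp_all only: conj_ac)
      define \<Phi> where "\<Phi> i x = b + \<phi> i (x - a)" for i x
      have stack: "\<And>i. i \<le> n \<Longrightarrow> continuous_on {c..d'} (\<Phi> i)"
        "\<And>x. c < x \<Longrightarrow> x < d' \<Longrightarrow> \<Phi> 0 x = y1" "\<And>x. c < x \<Longrightarrow> x < d' \<Longrightarrow> \<Phi> n x = y2"
        "\<And>x i. c < x \<Longrightarrow> x < d' \<Longrightarrow> i < n \<Longrightarrow> \<Phi> i x < \<Phi> (Suc i) x"
      proof -
        show "continuous_on {c..d'} (\<Phi> i)" if "i \<le> n" for i
          unfolding \<Phi>_def
          by (intro continuous_intros continuous_on_compose2[OF \<phi>(1)[OF that]]) auto
      qed (use \<phi>(2-4) in \<open>auto simp: \<Phi>_def\<close>)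
      have val: "(partial_y ^^ j) g (pt x y) = (x - a) ^ k g * dps (e g j) (x - a) (y - b)"
        if "g \<in> N" "j \<le> d g" "c < x" "x < d'" "y1 < y" "y < y2" for g j x y
      proof -
        have "\<bar>x - a\<bar> < \<rho> g" "\<bar>y - b\<bar> < \<rho> g"
          using r(2)[of g] N that cd \<epsilon> y s by auto
        then have "(partial_y ^^ j) g (pt (a + (x - a)) (b + (y - b))) = (x - a) ^ k g * dps (e g j) (x - a) (y - b)"
          using form[OF that(1)] that(2) unfolding Form_def by blast
        then show ?thesis by simp
      qed
      \<comment> \<open>A half box lies off the central line, so the factor
        \<open>(x - a) ^ k g\<close> does not vanish there.\<close>
      have xa: "x \<noteq> a" if "c < x" "x < d'" for x using that cd by auto
      have zero_iff: "(\<exists>g\<in>N. \<exists>j\<le>d g. (partial_y ^^ j) g (pt x y) = 0) \<longleftrightarrow> (\<exists>i. 0 < i \<and> i < n \<and> y = \<Phi> i x)"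
        if xy: "c < x" "x < d'" "y1 < y" "y < y2" for x y
      proof -
        have "(partial_y ^^ j) g (pt x y) = 0 \<longleftrightarrow> dps (e g j) (x - a) (y - b) = 0" if "g \<in> N" "j \<le> d g" for g j
          using val[OF that xy] xa[OF xy(1,2)] by simp
        then have "(\<exists>g\<in>N. \<exists>j\<le>d g. (partial_y ^^ j) g (pt x y) = 0) \<longleftrightarrow>
            (\<exists>g\<in>N. \<exists>j\<in>{..d g}. dps (e g j) (x - a) (y - b) = 0)"
          by (meson atMost_iff)
        also have "\<dots> \<longleftrightarrow> (\<exists>f\<in>F. dps f (x - a) (y - b) = 0)"
          by (simp add: F_def)
        also have "\<dots> \<longleftrightarrow> y - b \<in> {y. y1 - b < y \<and> y < y2 - b \<and> (\<exists>f\<in>F. dps f (x - a) y = 0)}"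
          using xy by auto
        also have "\<dots> \<longleftrightarrow> (\<exists>i. 0 < i \<and> i < n \<and> y - b = \<phi> i (x - a))"
          using xy by (subst \<phi>(5)) auto
        also have "\<dots> \<longleftrightarrow> (\<exists>i. 0 < i \<and> i < n \<and> y = \<Phi> i x)"
          by (auto simp: \<Phi>_def algebra_simps)
        finally show ?thesis .
      qed
      have nz: "(partial_y ^^ d g) g (pt x y) \<noteq> 0"
        if "g \<in> N" "c < x" "x < d'" "y1 < y" "y < y2" for g x y
      proof -
        have "\<bar>x - a\<bar> < \<rho> g" "\<bar>y - b\<bar> < \<rho> g"
          using r(2)[of g] N that cd \<epsilon> y s by auto
        then have "dps (e g (d g)) (x - a) (y - b) \<noteq> 0"
          using form[OF that(1)] unfolding Form_def by blast
        then show ?thesis using val[of g "d g" x y] xa that by simp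
      qed
      let ?C = "\<lambda>i. graph_cell c d' (\<Phi> i) (\<Phi> (Suc i))"
      have anN: "real_analytic g" if "g \<in> N" for g using that G' N by auto
      note cell_rule = cell_semianalytic[where h = "\<lambda>g. g" and \<Phi> = \<Phi> and N = N and d = d and n = n
          and ?y1.0 = y1 and ?y2.0 = y2]
      note cell_facts = cd(2) n stack N(1) anN nz zero_iff
      have semi: "semianalytic (?C i)" if "i < n" for i
        by (rule cell_rule(1); fact cell_facts that)
      have nonzero: "(partial_y ^^ j) g v \<noteq> 0" if "i < n" "g \<in> N" "j \<le> d g" "v \<in> ?C i" for i g j v
        by (rule cell_rule(2)[where i = i]; fact cell_facts that)
      have same_sign: "0 < (partial_y ^^ j) g v \<longleftrightarrow> 0 < (partial_y ^^ j) g w"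
        if "i < n" "g \<in> N" "j \<le> d g" "v \<in> ?C i" "w \<in> ?C i" for i g j v w
        by (rule cell_rule(3)[where i = i]; fact cell_facts that)
      have sub: "?C i \<subseteq> rect c d' y1 y2" if "i < n" for i
        by (rule cell_subset_rect; fact cell_facts that)
      have "decomposes (?C ` {..<n}) Y (rect c d' y1 y2)"
      proof (rule cells_decompose)
        show "?C i \<subseteq> Y \<or> ?C i \<inter> Y = {}" if i: "i < n" for i
        proof -
          have "v \<in> Y \<longleftrightarrow> w \<in> Y" if vw: "v \<in> ?C i" "w \<in> ?C i" for v w
          proof -
            have "0 \<le> g v \<longleftrightarrow> 0 \<le> g w" if g: "g \<in> G" for g
            proof (cases "g \<in> N")
              case True
              have "g v \<noteq> 0" "g w \<noteq> 0" "0 < g v \<longleftrightarrow> 0 < g w"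
                using nonzero[OF i True, of 0] same_sign[OF i True, of 0 v w] vw by auto
              then show ?thesis by (auto simp: le_less)
            next
              case False
              then have z: "Zero g (\<rho> g)" using g by (auto simp: N_def G'_def)
              have "g u = 0" if "u \<in> ?C i" for u
              proof -
                have u: "u \<in> rect c d' y1 y2" using sub[OF i] that by blast
                then have "\<bar>u $ 1 - a\<bar> < \<rho> g" "\<bar>u $ 2 - b\<bar> < \<rho> g"
                  using r(2)[of g] g cd \<epsilon> y s by (auto simp: rect_def G'_def)
                then have "g (pt (a + (u $ 1 - a)) (b + (u $ 2 - b))) = 0"
                  using z unfolding Zero_def by blast
                then show ?thesis by (simp add: pt_eta)
              qed
              then show ?thesis using vw by simp
            qed
            then show ?thesis using Y unfolding sign_determined_def by blast
          qed
          then show ?thesis by blast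
        qed
      qed (fact cell_facts semi)+
      moreover have "Q \<subseteq> {v. v $ 2 < b} \<or> Q \<subseteq> {v. b < v $ 2}" if Q: "Q \<in> ?C ` {..<n}" for Q
      proof -
        obtain i where i: "i < n" "Q = ?C i" using Q by auto
        have "v $ 2 \<noteq> b" "b < v $ 2 \<longleftrightarrow> b < w $ 2" if "v \<in> Q" "w \<in> Q" for v w
          using nonzero[OF i(1) lineN, of 0 v] same_sign[OF i(1) lineN, of 0 v w] that i(2)
          by (auto simp: line_def)
        then show ?thesis by (metis (mono_tags, lifting) linorder_neqE mem_Collect_eq subsetI)
      qed
      ultimately show ?thesis by blast
    qed
    then show "\<exists>e>0. \<forall>c d. a - e < c \<and> c < d \<and> d < a + e \<and> (d \<le> a \<or> a \<le> c) \<longrightarrow>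
        (\<exists>\<Q>. decomposes \<Q> Y (rect c d y1 y2) \<and>
          (\<forall>Q\<in>\<Q>. Q \<subseteq> {v. v $ 2 < b} \<or> Q \<subseteq> {v. b < v $ 2}))"
      using \<epsilon>(1) by blast
  qed
qed

section \<open>Gluing by bisection\<close>

theorem decomposition_of_rect:
  assumes G: "finite G" "\<forall>g\<in>G. real_analytic g" and Y: "sign_determined G Y" and R: "0 < R"
  shows "\<exists>\<Q>. decomposes \<Q> Y (rect (- R) R (- R) R)"
proof -
  \<comment> \<open>The width is left open, since it shrinks as boxes are stacked; it has to be
    settled for the full height at each abscissa before the horizontal bisection.\<close>
  define strip where "strip a y1 y2 \<longleftrightarrow> (\<exists>e>0. \<forall>c d. a - e < c \<and> c < d \<and> d < a + e \<and> (d \<le> a \<or> a \<le> c) \<longrightarrow>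
        (\<exists>\<Q>. decomposes \<Q> Y (rect c d y1 y2)))" for a y1 y2
  have strip: "strip a (- R) R" for a
  proof (rule Bolzano[where P = "strip a"])
    show "- R \<le> R" using R by simp
    fix y1 y2 y3 assume st: "strip a y1 y2" "strip a y2 y3" and y: "y1 \<le> y2" "y2 \<le> y3"
    obtain e1 where e1: "e1 > 0" "\<And>c d. a - e1 < c \<and> c < d \<and> d < a + e1 \<and> (d \<le> a \<or> a \<le> c) \<Longrightarrow>
        \<exists>\<Q>. decomposes \<Q> Y (rect c d y1 y2)" using st(1) unfolding strip_def by blast
    obtain e2 where e2: "e2 > 0" "\<And>c d. a - e2 < c \<and> c < d \<and> d < a + e2 \<and> (d \<le> a \<or> a \<le> c) \<Longrightarrow>
        \<exists>\<Q>. decomposes \<Q> Y (rect c d y2 y3)" using st(2) unfolding strip_def by blast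
    show "strip a y1 y3"
      unfolding strip_def
    \<comment> \<open>Two boxes can be stacked over the smaller of their widths.\<close>
    proof (intro exI[of _ "min e1 e2"] conjI allI impI)
      fix c d assume cd: "a - min e1 e2 < c \<and> c < d \<and> d < a + min e1 e2 \<and> (d \<le> a \<or> a \<le> c)"
      obtain \<Q> \<R> where "decomposes \<Q> Y (rect c d y1 y2)" "decomposes \<R> Y (rect c d y2 y3)"
      proof -
        have "a - e1 < c \<and> c < d \<and> d < a + e1 \<and> (d \<le> a \<or> a \<le> c)"
          "a - e2 < c \<and> c < d \<and> d < a + e2 \<and> (d \<le> a \<or> a \<le> c)"
          using cd by (auto simp: min_def split: if_splits)
        then show thesis using e1(2) e2(2) that by blast
      qed
      then show "\<exists>\<Q>. decomposes \<Q> Y (rect c d y1 y3)" using decomposes_rect_stack[OF y] by blast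
    qed (use e1 e2 in auto)
  next
    fix b :: real
    from local_decomposition[OF G Y, of "pt a b", unfolded vector_2]
    obtain \<delta> where \<delta>: "0 < \<delta>" and loc: "\<forall>y1 y2. b - \<delta> < y1 \<and> y1 < b \<and> b < y2 \<and> y2 < b + \<delta> \<longrightarrow>
      (\<exists>e>0. \<forall>c d. a - e < c \<and> c < d \<and> d < a + e \<and> (d \<le> a \<or> a \<le> c) \<longrightarrow>
        (\<exists>\<Q>. decomposes \<Q> Y (rect c d y1 y2) \<and> (\<forall>Q\<in>\<Q>. Q \<subseteq> {v. v $ 2 < b} \<or> Q \<subseteq> {v. b < v $ 2})))"
      by blast
    show "\<exists>\<delta>>0. \<forall>y1 y2. y1 \<le> b \<and> b \<le> y2 \<and> y2 - y1 < \<delta> \<longrightarrow> strip a y1 y2"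
    proof (intro exI[of _ \<delta>] conjI allI impI \<delta>)
      fix y1 y2 assume y: "y1 \<le> b \<and> b \<le> y2 \<and> y2 - y1 < \<delta>"
      \<comment> \<open>Bisection also supplies intervals that end at \<open>b\<close>, whereas the
        local result needs \<open>b\<close> in the interior. Such an end is moved by
        \<open>\<delta> / 2\<close>, and the surplus is cut off at \<open>b\<close> again.\<close>
      define z1 z2 where "z1 = (if y1 = b then b - \<delta> / 2 else y1)" and "z2 = (if y2 = b then b + \<delta> / 2 else y2)"
      have z: "b - \<delta> < z1" "z1 < b" "b < z2" "z2 < b + \<delta>" using y \<delta> by (auto simp: z1_def z2_def)
      from z have "b - \<delta> < z1 \<and> z1 < b \<and> b < z2 \<and> z2 < b + \<delta>" by blast
      from loc[rule_format, OF this]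
      obtain e where e: "e > 0" and dec: "\<forall>c d. a - e < c \<and> c < d \<and> d < a + e \<and> (d \<le> a \<or> a \<le> c) \<longrightarrow>
        (\<exists>\<Q>. decomposes \<Q> Y (rect c d z1 z2) \<and> (\<forall>Q\<in>\<Q>. Q \<subseteq> {v. v $ 2 < b} \<or> Q \<subseteq> {v. b < v $ 2}))"
        by blast
      show "strip a y1 y2"
        unfolding strip_def
      proof (intro exI[of _ e] conjI allI impI e)
        fix c d assume cd: "a - e < c \<and> c < d \<and> d < a + e \<and> (d \<le> a \<or> a \<le> c)"
        from dec[rule_format, OF this]
        obtain \<Q> where \<Q>: "decomposes \<Q> Y (rect c d z1 z2)"
          "\<And>Q. Q \<in> \<Q> \<Longrightarrow> Q \<subseteq> {v. v $ 2 < b} \<or> Q \<subseteq> {v. b < v $ 2}"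
          by blast
        \<comment> \<open>\<open>U\<close> omits the added side and the line at height
          \<open>b\<close>; no piece crosses that height, so each lies in \<open>U\<close> or misses
          it.\<close>
        define U where "U = {v::real^2. y1 < b \<and> v $ 2 < b \<or> b < y2 \<and> b < v $ 2}"
        have "open U"
          unfolding U_def by (intro open_Collect_disj open_Collect_conj open_Collect_less continuous_intros open_Collect_const)
        moreover have "Q \<subseteq> U \<or> Q \<inter> U = {}" if "Q \<in> \<Q>" for Q
          using \<Q>(2)[OF that] by (auto simp: U_def subset_iff)
        ultimately have D: "decomposes {Q\<in>\<Q>. Q \<subseteq> U} Y (rect c d z1 z2 \<inter> U)"
          by (rule decomposes_restrict[OF \<Q>(1)])
        have "decomposes ({Q\<in>\<Q>. Q \<subseteq> U} \<union> {}) Y (rect c d y1 y2)"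
        proof (rule decomposes_Un[OF D decomposes_empty])
          show "rect c d z1 z2 \<inter> U \<union> {} \<subseteq> rect c d y1 y2"
            using y by (auto simp: U_def rect_def z1_def z2_def)
          have "rect c d y1 y2 - {v. v $ 2 = b} \<subseteq> rect c d z1 z2 \<inter> U \<union> {}"
            using y \<delta> by (auto simp: U_def rect_def z1_def z2_def)
          then show "rect c d y1 y2 \<subseteq> closure (rect c d z1 z2 \<inter> U \<union> {})"
            using open_minus_line_dense[OF open_rect, of c d y1 y2 2 b] closure_mono by blast
        qed simp
        then show "\<exists>\<Q>. decomposes \<Q> Y (rect c d y1 y2)" by blast
      qed
    qed
  qed
  show ?thesis
  proof (rule Bolzano[where P = "\<lambda>c d. \<exists>\<Q>. decomposes \<Q> Y (rect c d (- R) R)"])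
    show "- R \<le> R" using R by simp
    show "\<exists>\<Q>. decomposes \<Q> Y (rect c e (- R) R)"
      if "\<exists>\<Q>. decomposes \<Q> Y (rect c d (- R) R)" "\<exists>\<Q>. decomposes \<Q> Y (rect d e (- R) R)" "c \<le> d" "d \<le> e" for c d e
      using that decomposes_rect_join by blast
  next
    fix a :: real
    obtain e where e: "e > 0" and dec: "\<And>c d. a - e < c \<Longrightarrow> c < d \<Longrightarrow> d < a + e \<Longrightarrow> d \<le> a \<or> a \<le> c \<Longrightarrow>
        \<exists>\<Q>. decomposes \<Q> Y (rect c d (- R) R)"
      using strip[of a] unfolding strip_def by blast
    have empty: "rect c d (- R) R = {}" if "d \<le> c" for c d using that by (auto simp: rect_def)
    \<comment> \<open>For \<open>d \<le> c\<close> the rectangle is empty, which occurs below when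
      \<open>a\<close> is an endpoint of the interval.\<close>
    have dec': "\<exists>\<Q>. decomposes \<Q> Y (rect c d (- R) R)" if "a - e < c" "d < a + e" "d \<le> a \<or> a \<le> c" for c d
      using dec[of c d] that empty[of d c] decomposes_empty[of Y] by (cases "c < d") auto
    show "\<exists>\<delta>>0. \<forall>c d. c \<le> a \<and> a \<le> d \<and> d - c < \<delta> \<longrightarrow> (\<exists>\<Q>. decomposes \<Q> Y (rect c d (- R) R))"
    proof (intro exI[of _ e] conjI allI impI e)
      fix c d assume cd: "c \<le> a \<and> a \<le> d \<and> d - c < e"
      \<comment> \<open>The rectangle is cut at \<open>a\<close>, where levels may meet, and the
        halves are decomposed separately.\<close>
      have "\<exists>\<Q>. decomposes \<Q> Y (rect c a (- R) R)" "\<exists>\<Q>. decomposes \<Q> Y (rect a d (- R) R)"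
        using cd e by (auto intro!: dec')
      then show "\<exists>\<Q>. decomposes \<Q> Y (rect c d (- R) R)"
        using decomposes_rect_join cd by blast
    qed
  qed
qed

text \<open>Since \<open>Y\<close> is open, it lies in the closure of its intersection with the
  pieces, and a piece that meets \<open>Y\<close> is contained in \<open>Y\<close>. So
  \<open>Y\<close> and the selected pieces have the same closure, and regular openness recovers
  \<open>Y\<close>.\<close>

lemma decomposes_imp_regularized_Union:
  assumes "decomposes \<Q> Y S" "regular_open Y" "Y \<subseteq> S"
  shows "Y = regularized_Union {Q\<in>\<Q>. Q \<subseteq> Y}"
proof -
  note Q = decomposesD[OF assms(1)]
  have Y: "Y = interior (closure Y)" using assms(2) by (simp add: regular_open_def exterior_exterior)
  then have "open Y" by (metis open_interior)
  have "Y \<subseteq> Y \<inter> closure (\<Union>\<Q>)" using assms(3) Q(6) by blast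
  also have "\<dots> \<subseteq> closure (Y \<inter> \<Union>\<Q>)" by (rule open_Int_closure_subset[OF \<open>open Y\<close>])
  also have "Y \<inter> \<Union>\<Q> \<subseteq> \<Union>{Q\<in>\<Q>. Q \<subseteq> Y}" using Q(5) by blast
  then have "closure (Y \<inter> \<Union>\<Q>) \<subseteq> closure (\<Union>{Q\<in>\<Q>. Q \<subseteq> Y})" by (rule closure_mono)
  finally have "closure Y \<subseteq> closure (\<Union>{Q\<in>\<Q>. Q \<subseteq> Y})" by (rule closure_minimal) (rule closed_closure)
  moreover have "closure (\<Union>{Q\<in>\<Q>. Q \<subseteq> Y}) \<subseteq> closure Y" by (rule closure_mono) blast
  ultimately show ?thesis using Y by (simp add: regularized_Union_def exterior_exterior)
qed

theorem theorem2p5: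
  fixes Y :: "(real^2) set"
  assumes "yin_set Y" and "bounded Y"
  shows "\<exists>(n::nat) (Q :: nat \<Rightarrow> (real^2) set).
           (\<forall>i<n. yin_set (Q i) \<and> (curved_quadrilateral (Q i) \<or> curved_triangle (Q i))) \<and>
           disjoint_family_on Q {..<n} \<and>
           Y = regularized_Union (Q ` {..<n})"
proof -
  obtain G where G: "finite G" "\<forall>g\<in>G. real_analytic g" "Y \<in> algebra UNIV hull ((\<lambda>g. {x. g x \<ge> 0}) ` G)"
    using assms(1) by (auto simp: yin_set_def semianalytic_def)
  have "sign_determined G Y"
    unfolding sign_determined_def using semianalytic_invariant[OF G(3)] by blast
  obtain R where R: "0 < R" "\<And>v. v \<in> Y \<Longrightarrow> norm v < R"
    using bounded_pos_less assms(2) by metis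
  obtain \<Q> where \<Q>: "decomposes \<Q> Y (rect (- R) R (- R) R)"
    using decomposition_of_rect[OF G(1,2) \<open>sign_determined G Y\<close> R(1)] by blast
  have "Y \<subseteq> rect (- R) R (- R) R"
  proof
    fix v assume "v \<in> Y"
    then have "\<bar>v $ i\<bar> < R" for i using R(2)[of v] component_le_norm_cart[of v i] by force
    then show "v \<in> rect (- R) R (- R) R" by (simp add: rect_def abs_less_iff minus_less_iff)
  qed
  then have Y: "Y = regularized_Union {Q\<in>\<Q>. Q \<subseteq> Y}"
    using decomposes_imp_regularized_Union[OF \<Q>] assms(1) by (simp add: yin_set_def)
  note D = decomposesD[OF \<Q>]
  \<comment> \<open>The enumeration is injective, so that disjointness of distinct pieces becomes
    disjointness for distinct indices.\<close>
  obtain Q where Q: "bij_betw Q {0..<card {Q\<in>\<Q>. Q \<subseteq> Y}} {Q\<in>\<Q>. Q \<subseteq> Y}"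
    using ex_bij_betw_nat_finite[of "{Q\<in>\<Q>. Q \<subseteq> Y}"] D(1) by auto
  let ?n = "card {Q\<in>\<Q>. Q \<subseteq> Y}"
  have img: "Q ` {..<?n} = {Q\<in>\<Q>. Q \<subseteq> Y}" and inj: "inj_on Q {..<?n}"
    using Q by (auto simp: bij_betw_def lessThan_atLeast0)
  have mem: "Q i \<in> \<Q>" if "i < ?n" for i using img that by blast
  show ?thesis
  proof (intro exI[of _ ?n] exI[of _ Q] conjI allI impI)
    fix i assume i: "i < ?n"
    show "curved_quadrilateral (Q i) \<or> curved_triangle (Q i)" using D(3)[OF mem[OF i]] by blast
    show "yin_set (Q i)"
      using D(3)[OF mem[OF i]] by (simp add: curved_triangle_def curved_polygon_def)
  next
    show "disjoint_family_on Q {..<?n}"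
      unfolding disjoint_family_on_def
    proof (intro ballI impI)
      fix i j assume ij: "i \<in> {..<?n}" "j \<in> {..<?n}" "i \<noteq> j"
      then have "Q i \<noteq> Q j" using inj by (simp add: inj_on_eq_iff)
      moreover have "Q i \<in> \<Q>" "Q j \<in> \<Q>" using mem ij by blast+
      ultimately show "Q i \<inter> Q j = {}" using D(2) by (simp add: disjoint_def)
    qed
    show "Y = regularized_Union (Q ` {..<?n})" unfolding img by (rule Y)
  qed
qed

end
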